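(* Let $\mathbb F=\mathbb F_2$, let $M\in\mathbb F^{n\times n}$, let $0<\varepsilon\le1/2$, and suppose $\mathcal O:\mathbb F^n\to\mathbb F^n$ satisfies $\Pr_{z\sim\mathbb F^n}[\mathcal O(z)=Mz]\ge\varepsilon$. Suppose a perfect verifier $\mathcal V_M$ decides whether a proposed answer is correct, i.e. on input $(z,y)\in\mathbb F^n\times\mathbb F^n$ it decides whether $y=Mz$. If one call to $\mathcal O$ costs time $T\ge n$ and one call to $\mathcal V_M$ costs time $S$, then there is a reduction which, given access to $\mathcal O$, $\mathcal V_M$ and the entries of $M$, outputs $Mx$ with probability at least $2/3$ for every input $x\in\mathbb F^n$, with running time $$\widetilde O\left((2/\varepsilon)^{O(\log(1/\varepsilon))}(T+S)\right).$$ Moreover, using in place of $\mathcal V_M$ the known bounded-error quantum matrix-vector verifier of cost $\widetilde O(n^{3/2})$, one obtains a quantum reduction (with access to $\mathcal O$ and coherent entry access to $M$) that outputs $Mx$ with probability at least $2/3$ for every $x\in\mathbb F^n$, with running time $$\widetilde O\left((2/\varepsilon)^{O(\log(1/\varepsilon))}(T+n^{3/2})\right).$$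
   Context: The reductions are uniform: they know $n$ and $\varepsilon$ but receive no advice depending on $M$ or $\mathcal O$. Coherent entry access to $M$ means access to the unitary $U_M:|i,j,\beta\rangle\mapsto|i,j,\beta+M_{ij}\rangle$, each query costing a constant number of elementary operations. The known quantum matrix-vector verifier (Asadi, Golovnev, Gur, Shinkar, Subramanian, SODA 2024) is a quantum algorithm which, given coherent entry access to $M$, vectors $z,y\in\mathbb F^n$ and an error parameter $\eta$, decides whether $y=Mz$ with error probability at most $\eta$ in time $\widetilde O(n^{3/2})$ (with polylogarithmic dependence on $1/\eta$); it may be taken as given. Logarithms are base 2; $\widetilde O(\cdot)$ hides polylogarithmic factors in $n$, $1/\varepsilon$ and the relevant inverse error parameters. *)

theory Defs
  imports
    "HOL-Probability.Probability_Mass_Function"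
    "HOL-Library.Z2"
    "HOL-Library.Discrete_Functions"
    "Jordan_Normal_Form.Matrix"
begin

unbundle no vec_syntax

text \<open>
  The model of computation is a structured random access machine under the logarithmic cost
  criterion, with fair coins and with a quantum memory under classical control. The memory consists
  of arrays of natural numbers, named statically by natural numbers; \<open>Get a e\<close> reads array \<open>a\<close> at the
  position given by \<open>e\<close>. A program is a finite piece of syntax that does not depend on the
  dimension, so it is uniform.
\<close>

type_synonym store = "nat \<Rightarrow> nat \<Rightarrow> nat"

datatype exp =
    Const nat
  | Get nat exp
  | Add exp exp
  | Sub exp exp
  | Mul exp exp
  | Div exp exp

fun val :: "store \<Rightarrow> exp \<Rightarrow> nat" where
  "val \<sigma> (Const k) = k"
| "val \<sigma> (Get a e) = \<sigma> a (val \<sigma> e)"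
| "val \<sigma> (Add e f) = val \<sigma> e + val \<sigma> f"
| "val \<sigma> (Sub e f) = val \<sigma> e - val \<sigma> f"
| "val \<sigma> (Mul e f) = val \<sigma> e * val \<sigma> f"
| "val \<sigma> (Div e f) = val \<sigma> e div val \<sigma> f"

definition bit_length :: "nat \<Rightarrow> nat" where
  "bit_length k = Suc (floor_log k)"

text \<open>Every value that occurs, in particular every address, is charged its bit length.\<close>

fun val_cost :: "store \<Rightarrow> exp \<Rightarrow> nat" where
  "val_cost \<sigma> (Const k) = bit_length k"
| "val_cost \<sigma> (Get a e) = val_cost \<sigma> e + bit_length (val \<sigma> (Get a e))"
| "val_cost \<sigma> (Add e f) = val_cost \<sigma> e + val_cost \<sigma> f + bit_length (val \<sigma> (Add e f))"
| "val_cost \<sigma> (Sub e f) = val_cost \<sigma> e + val_cost \<sigma> f + bit_length (val \<sigma> (Sub e f))"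
| "val_cost \<sigma> (Mul e f) = val_cost \<sigma> e + val_cost \<sigma> f + bit_length (val \<sigma> (Mul e f))"
| "val_cost \<sigma> (Div e f) = val_cost \<sigma> e + val_cost \<sigma> f + bit_length (val \<sigma> (Div e f))"

text \<open>
  A pure state of the quantum memory assigns an amplitude to every basis label \<open>k\<close>; qubit \<open>q\<close> of the
  basis state with label \<open>k\<close> is binary digit \<open>q\<close> of \<open>k\<close>. All reachable states have finite support
  and norm one.
\<close>

type_synonym qstate = "nat \<Rightarrow> complex"

definition zero_ket :: qstate where
  "zero_ket k = (if k = 0 then 1 else 0)"

definition gate_X :: "nat \<Rightarrow> qstate \<Rightarrow> qstate" where
  "gate_X q \<psi> k = \<psi> (flip_bit q k)"

definition gate_H :: "nat \<Rightarrow> qstate \<Rightarrow> qstate" where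
  "gate_H q \<psi> k =
     (\<psi> (unset_bit q k) + (if bit k q then - 1 else 1) * \<psi> (set_bit q k)) / complex_of_real (sqrt 2)"

definition gate_T :: "nat \<Rightarrow> qstate \<Rightarrow> qstate" where
  "gate_T q \<psi> k = (if bit k q then cis (pi / 4) else 1) * \<psi> k"

definition gate_CNOT :: "nat \<Rightarrow> nat \<Rightarrow> qstate \<Rightarrow> qstate" where
  "gate_CNOT p q \<psi> k = \<psi> (if p \<noteq> q \<and> bit k p then flip_bit q k else k)"

text \<open>
  The perfect verifier \<open>ver\<close> and the average-case solver \<open>alg\<close> are black boxes; \<open>alg_cost\<close> and
  \<open>ver_cost\<close> are the costs of one call.
\<close>

record env =
  mdim :: nat
  matr :: "bit mat"
  alg :: "bit vec \<Rightarrow> bit vec"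
  ver :: "bit vec \<Rightarrow> bit vec \<Rightarrow> bool"
  alg_cost :: nat
  ver_cost :: nat

definition entry :: "env \<Rightarrow> nat \<Rightarrow> nat \<Rightarrow> bit" where
  "entry E i j = (if i < mdim E \<and> j < mdim E then matr E $$ (i, j) else 0)"

text \<open>
  The unitary sending \<open>|i, j, \<beta>\<rangle>\<close> to \<open>|i, j, \<beta> + M i j\<rangle>\<close>, where \<open>i\<close> and \<open>j\<close> are held in the
  blocks of qubits that start at \<open>p\<close> and \<open>q\<close>, and \<open>\<beta>\<close> is qubit \<open>t\<close>. It is the identity if \<open>t\<close> is
  one of the address qubits.
\<close>

definition query_unitary :: "env \<Rightarrow> nat \<Rightarrow> nat \<Rightarrow> nat \<Rightarrow> qstate \<Rightarrow> qstate" where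
  "query_unitary E p q t \<psi> k =
     (let w = bit_length (mdim E);
          i = take_bit w (drop_bit p k);
          j = take_bit w (drop_bit q k)
      in \<psi> (if t \<notin> {p..<p + w} \<union> {q..<q + w} \<and> entry E i j = 1 then flip_bit t k else k))"

definition outcome_prob :: "nat \<Rightarrow> bool \<Rightarrow> qstate \<Rightarrow> real" where
  "outcome_prob q b \<psi> = (\<Sum>k | \<psi> k \<noteq> 0 \<and> bit k q = b. (cmod (\<psi> k))\<^sup>2)"

definition post_measurement :: "nat \<Rightarrow> bool \<Rightarrow> qstate \<Rightarrow> qstate" where
  "post_measurement q b \<psi> k =
     (if bit k q = b then \<psi> k / complex_of_real (sqrt (outcome_prob q b \<psi>)) else 0)"

text \<open>
  \<open>Fresh a\<close> replaces array \<open>a\<close> by a newly allocated one, which is zero; \<open>QFresh\<close> discards the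
  quantum memory and takes fresh qubits in state zero. \<open>Read\<close> reads an entry of the matrix
  classically. \<open>CallAlg a b\<close> applies the solver to the vector in array \<open>a\<close> and puts the answer in
  array \<open>b\<close>; \<open>CallVer a b c\<close> calls the perfect verifier on the pair of vectors in \<open>a\<close> and \<open>b\<close>.
\<close>

datatype instr =
    Assign nat exp exp
  | Fresh nat
  | Flip nat exp
  | Read nat exp exp exp
  | CallAlg nat nat
  | CallVer nat nat nat
  | QFresh
  | QX exp
  | QH exp
  | QT exp
  | QCNOT exp exp
  | QQuery exp exp exp
  | QMeasure nat exp exp

datatype com =
    Skip
  | Do instr
  | Seq com com
  | Cond exp com com
  | While exp com

definition put :: "nat \<Rightarrow> nat \<Rightarrow> nat \<Rightarrow> store \<Rightarrow> store" where
  "put a i v \<sigma> = \<sigma>(a := (\<sigma> a)(i := v))"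

definition bit_nat :: "bit \<Rightarrow> nat" where
  "bit_nat b = (if b = 1 then 1 else 0)"

text \<open>The cells of a vector are read modulo \<open>2\<close>.\<close>

definition get_vec :: "nat \<Rightarrow> nat \<Rightarrow> store \<Rightarrow> bit vec" where
  "get_vec n a \<sigma> = vec n (\<lambda>i. of_nat (\<sigma> a i))"

definition put_vec :: "nat \<Rightarrow> nat \<Rightarrow> bit vec \<Rightarrow> store \<Rightarrow> store" where
  "put_vec n a v \<sigma> = \<sigma>(a := (\<lambda>i. if i < n then bit_nat (v $ i) else \<sigma> a i))"

fun effect :: "env \<Rightarrow> instr \<Rightarrow> store \<Rightarrow> qstate \<Rightarrow> (store \<times> qstate) pmf" where
  "effect E (Assign a e f) \<sigma> \<psi> = return_pmf (put a (val \<sigma> e) (val \<sigma> f) \<sigma>, \<psi>)"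
| "effect E (Fresh a) \<sigma> \<psi> = return_pmf (\<sigma>(a := (\<lambda>_. 0)), \<psi>)"
| "effect E (Flip a e) \<sigma> \<psi> =
     map_pmf (\<lambda>b. (put a (val \<sigma> e) (of_bool b) \<sigma>, \<psi>)) (bernoulli_pmf (1 / 2))"
| "effect E (Read a e i j) \<sigma> \<psi> =
     return_pmf (put a (val \<sigma> e) (bit_nat (entry E (val \<sigma> i) (val \<sigma> j))) \<sigma>, \<psi>)"
| "effect E (CallAlg a b) \<sigma> \<psi> =
     return_pmf (put_vec (mdim E) b (alg E (get_vec (mdim E) a \<sigma>)) \<sigma>, \<psi>)"
| "effect E (CallVer a b c) \<sigma> \<psi> =
     return_pmf (put c 0 (of_bool (ver E (get_vec (mdim E) a \<sigma>) (get_vec (mdim E) b \<sigma>))) \<sigma>, \<psi>)"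
| "effect E QFresh \<sigma> \<psi> = return_pmf (\<sigma>, zero_ket)"
| "effect E (QX e) \<sigma> \<psi> = return_pmf (\<sigma>, gate_X (val \<sigma> e) \<psi>)"
| "effect E (QH e) \<sigma> \<psi> = return_pmf (\<sigma>, gate_H (val \<sigma> e) \<psi>)"
| "effect E (QT e) \<sigma> \<psi> = return_pmf (\<sigma>, gate_T (val \<sigma> e) \<psi>)"
| "effect E (QCNOT e f) \<sigma> \<psi> = return_pmf (\<sigma>, gate_CNOT (val \<sigma> e) (val \<sigma> f) \<psi>)"
| "effect E (QQuery e f g) \<sigma> \<psi> =
     return_pmf (\<sigma>, query_unitary E (val \<sigma> e) (val \<sigma> f) (val \<sigma> g) \<psi>)"
| "effect E (QMeasure a e f) \<sigma> \<psi> =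
     map_pmf (\<lambda>b. (put a (val \<sigma> e) (of_bool b) \<sigma>, post_measurement (val \<sigma> f) b \<psi>))
       (bernoulli_pmf (outcome_prob (val \<sigma> f) True \<psi>))"

fun instr_cost :: "env \<Rightarrow> instr \<Rightarrow> store \<Rightarrow> nat" where
  "instr_cost E (Assign a e f) \<sigma> = 1 + val_cost \<sigma> e + val_cost \<sigma> f"
| "instr_cost E (Fresh a) \<sigma> = 1"
| "instr_cost E (Flip a e) \<sigma> = 1 + val_cost \<sigma> e"
| "instr_cost E (Read a e i j) \<sigma> = 1 + val_cost \<sigma> e + val_cost \<sigma> i + val_cost \<sigma> j"
| "instr_cost E (CallAlg a b) \<sigma> = alg_cost E"
| "instr_cost E (CallVer a b c) \<sigma> = ver_cost E"
| "instr_cost E QFresh \<sigma> = 1"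
| "instr_cost E (QX e) \<sigma> = 1 + val_cost \<sigma> e"
| "instr_cost E (QH e) \<sigma> = 1 + val_cost \<sigma> e"
| "instr_cost E (QT e) \<sigma> = 1 + val_cost \<sigma> e"
| "instr_cost E (QCNOT e f) \<sigma> = 1 + val_cost \<sigma> e + val_cost \<sigma> f"
| "instr_cost E (QQuery e f g) \<sigma> = 1 + val_cost \<sigma> e + val_cost \<sigma> f + val_cost \<sigma> g"
| "instr_cost E (QMeasure a e f) \<sigma> = 1 + val_cost \<sigma> e + val_cost \<sigma> f"

record state =
  store :: store
  qmem :: qstate
  elapsed :: nat

definition exec :: "env \<Rightarrow> instr \<Rightarrow> state \<Rightarrow> state pmf" where
  "exec E c s =
     map_pmf (\<lambda>(\<sigma>, \<psi>). \<lparr>store = \<sigma>, qmem = \<psi>, elapsed = elapsed s + instr_cost E c (store s)\<rparr>)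
       (effect E c (store s) (qmem s))"

definition test :: "exp \<Rightarrow> state \<Rightarrow> bool" where
  "test e s \<longleftrightarrow> val (store s) e \<noteq> 0"

definition tick :: "exp \<Rightarrow> state \<Rightarrow> state" where
  "tick e s = s\<lparr>elapsed := elapsed s + 1 + val_cost (store s) e\<rparr>"

text \<open>
  \<open>big_step E c s \<mu>\<close>: started in \<open>s\<close>, the program \<open>c\<close> halts on every computation path, and \<open>\<mu>\<close> is the
  distribution of the final state over coin tosses and measurement outcomes.
\<close>

inductive big_step :: "env \<Rightarrow> com \<Rightarrow> state \<Rightarrow> state pmf \<Rightarrow> bool" for E where
  Skip: "big_step E Skip s (return_pmf s)"
| Do: "big_step E (Do c) s (exec E c s)"
| Seq: "big_step E c s \<mu> \<Longrightarrow> (\<And>s'. s' \<in> set_pmf \<mu> \<Longrightarrow> big_step E d s' (\<nu> s')) \<Longrightarrow>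
    big_step E (Seq c d) s (bind_pmf \<mu> \<nu>)"
| CondTrue: "test e s \<Longrightarrow> big_step E c (tick e s) \<mu> \<Longrightarrow> big_step E (Cond e c d) s \<mu>"
| CondFalse: "\<not> test e s \<Longrightarrow> big_step E d (tick e s) \<mu> \<Longrightarrow> big_step E (Cond e c d) s \<mu>"
| WhileFalse: "\<not> test e s \<Longrightarrow> big_step E (While e c) s (return_pmf (tick e s))"
| WhileTrue: "test e s \<Longrightarrow> big_step E c (tick e s) \<mu> \<Longrightarrow>
    (\<And>s'. s' \<in> set_pmf \<mu> \<Longrightarrow> big_step E (While e c) s' (\<nu> s')) \<Longrightarrow>
    big_step E (While e c) s (bind_pmf \<mu> \<nu>)"

inductive_cases big_step_SkipE: "big_step E Skip s \<mu>"
inductive_cases big_step_DoE: "big_step E (Do c) s \<mu>"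
inductive_cases big_step_SeqE: "big_step E (Seq c d) s \<mu>"
inductive_cases big_step_CondE: "big_step E (Cond e c d) s \<mu>"
inductive_cases big_step_WhileE: "big_step E (While e c) s \<mu>"

lemma big_step_unique: "big_step E c s \<mu> \<Longrightarrow> big_step E c s \<mu>' \<Longrightarrow> \<mu> = \<mu>'"
proof (induction arbitrary: \<mu>' rule: big_step.induct)
  case (Skip s)
  then show ?case by (auto elim: big_step_SkipE)
next
  case (Do c s)
  then show ?case by (auto elim: big_step_DoE)
next
  case (Seq c s \<mu> d \<nu>)
  from Seq.prems obtain \<mu>1 \<nu>1 where 1: "\<mu>' = bind_pmf \<mu>1 \<nu>1" "big_step E c s \<mu>1"
    "\<And>s'. s' \<in> set_pmf \<mu>1 \<Longrightarrow> big_step E d s' (\<nu>1 s')"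
    by (rule big_step_SeqE) blast
  have "\<mu> = \<mu>1" using Seq.IH(1) 1(2) .
  moreover have "\<nu> s' = \<nu>1 s'" if "s' \<in> set_pmf \<mu>" for s'
    using Seq.IH(2)[OF that 1(3)] that calculation by simp
  ultimately show ?case using 1(1) by (simp cong: bind_pmf_cong)
next
  case (CondTrue e s c \<mu> d)
  from CondTrue.prems CondTrue.hyps(1) have "big_step E c (tick e s) \<mu>'"
    by (elim big_step_CondE) blast+
  then show ?case by (rule CondTrue.IH)
next
  case (CondFalse e s d \<mu> c)
  from CondFalse.prems CondFalse.hyps(1) have "big_step E d (tick e s) \<mu>'"
    by (elim big_step_CondE) blast+
  then show ?case by (rule CondFalse.IH)
next
  case (WhileFalse e s c)
  from WhileFalse.prems WhileFalse.hyps(1) show ?case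
    by (elim big_step_WhileE) auto
next
  case (WhileTrue e s c \<mu> \<nu>)
  from WhileTrue.prems WhileTrue.hyps(1) obtain \<mu>1 \<nu>1 where 1: "\<mu>' = bind_pmf \<mu>1 \<nu>1"
    "big_step E c (tick e s) \<mu>1"
    "\<And>s'. s' \<in> set_pmf \<mu>1 \<Longrightarrow> big_step E (While e c) s' (\<nu>1 s')"
    by (elim big_step_WhileE) auto
  have "\<mu> = \<mu>1" using WhileTrue.IH(1) 1(2) .
  moreover have "\<nu> s' = \<nu>1 s'" if "s' \<in> set_pmf \<mu>" for s'
    using WhileTrue.IH(2)[OF that 1(3)] that calculation by simp
  ultimately show ?case using 1(1) by (simp cong: bind_pmf_cong)
qed

datatype resource = Solver | Verifier | Entries | Quantum

fun instr_uses :: "instr \<Rightarrow> resource set" where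
  "instr_uses (Assign a e f) = {}"
| "instr_uses (Fresh a) = {}"
| "instr_uses (Flip a e) = {}"
| "instr_uses (Read a e i j) = {Entries}"
| "instr_uses (CallAlg a b) = {Solver}"
| "instr_uses (CallVer a b c) = {Verifier}"
| "instr_uses QFresh = {Quantum}"
| "instr_uses (QX e) = {Quantum}"
| "instr_uses (QH e) = {Quantum}"
| "instr_uses (QT e) = {Quantum}"
| "instr_uses (QCNOT e f) = {Quantum}"
| "instr_uses (QQuery e f g) = {Quantum}"
| "instr_uses (QMeasure a e f) = {Quantum}"

fun uses :: "com \<Rightarrow> resource set" where
  "uses Skip = {}"
| "uses (Do c) = instr_uses c"
| "uses (Seq c d) = uses c \<union> uses d"
| "uses (Cond e c d) = uses c \<union> uses d"
| "uses (While e c) = uses c"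

text \<open>
  A program receives the dimension and a natural number \<open>k\<close>, which stands for an accuracy \<open>1 / k\<close>,
  in array \<open>0\<close>, and its input vectors in the arrays \<open>1, 2, \<dots>\<close>. Everything else is zero.
\<close>

definition input_store :: "nat \<Rightarrow> nat \<Rightarrow> bit vec list \<Rightarrow> store" where
  "input_store n k vs a i =
     (if a = 0 then (if i = 0 then n else if i = 1 then k else 0)
      else if a \<le> length vs \<and> i < n then bit_nat (vs ! (a - 1) $ i) else 0)"

definition succeeds_within ::
    "env \<Rightarrow> com \<Rightarrow> nat \<Rightarrow> bit vec list \<Rightarrow> real \<Rightarrow> real \<Rightarrow> (store \<Rightarrow> bool) \<Rightarrow> bool" where
  "succeeds_within E c k vs t p P \<longleftrightarrow>
     (\<exists>\<mu>. big_step E c \<lparr>store = input_store (mdim E) k vs, qmem = zero_ket, elapsed = 0\<rparr> \<mu> \<and>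
        (\<forall>s \<in> set_pmf \<mu>. real (elapsed s) \<le> t) \<and>
        measure_pmf.prob \<mu> {s. P (store s)} \<ge> p)"

text \<open>
  The bounded-error quantum matrix-vector verifier: a quantum program with coherent entry access to
  the matrix that decides whether \<open>y = M z\<close> with error probability at most \<open>\<eta>\<close>; a nonzero value in
  cell \<open>0\<close> of array \<open>3\<close> means acceptance. The conditions do not involve the black boxes, which
  such a program cannot call.
\<close>

definition quantum_verifier :: "com \<Rightarrow> bool" where
  "quantum_verifier Q \<longleftrightarrow>
     uses Q \<subseteq> {Quantum} \<and>
     (\<exists>C::real. \<forall>E (\<eta>::real) z y.
        mdim E \<ge> 1 \<longrightarrow> matr E \<in> carrier_mat (mdim E) (mdim E) \<longrightarrow>
        z \<in> carrier_vec (mdim E) \<longrightarrow> y \<in> carrier_vec (mdim E) \<longrightarrow>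
        0 < \<eta> \<longrightarrow> \<eta> \<le> 1 / 2 \<longrightarrow>
        succeeds_within E Q (nat \<lceil>1 / \<eta>\<rceil>) [z, y]
          (C * real (mdim E) powr (3 / 2) * log 2 (real (mdim E) / \<eta>) powr C)
          (1 - \<eta>) (\<lambda>\<sigma>. \<sigma> 3 0 \<noteq> 0 \<longleftrightarrow> y = matr E *\<^sub>v z))"

end

theory Submission
  imports Defs
begin

text \<open>
  Let \<open>A\<close> be the set of vectors on which the solver is right; its density is at least \<open>1 / k\<close>. Keep a
  list of prefixes \<open>v\<close> of the input \<open>x\<close> (padded with zeros) for which \<open>M v\<close> is known. A trial for
  another prefix \<open>u\<close> picks \<open>r\<close> at random and forms \<open>\<O> r + \<O> (r + u + v) + M v\<close>, which equals \<open>M u\<close> as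
  soon as \<open>r\<close> and \<open>r + u + v\<close> lie in \<open>A\<close>; the verifier recognises this. If the trials fail for all
  \<open>v\<close>, then the translate \<open>A + u\<close> meets every \<open>A + v\<close> in density less than \<open>1 / (2 k\<^sup>2)\<close>, and by a second
  moment argument there are at most \<open>2 k\<close> translates with such small pairwise overlaps.

  Binary search over the prefix lengths finds a prefix whose answer is known and whose extension by
  one coordinate either fails or is \<open>x\<close> itself. Reading one column of \<open>M\<close> gives the answer for the
  extension, which joins the list. Hence at most \<open>2 k\<close> rounds are needed, and the running time is even
  polynomial in \<open>1 / \<epsilon>\<close>. The quantum verifier is run on its own block of arrays, with an error so
  small that a union bound over all its calls is harmless.
\<close>

section \<open>Program logic\<close>

text \<open>Success need not be monotone in the prefix length, so the search keeps only two facts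
  about its ends: the answer at the lower end is known, and the upper end either failed against the
  whole list or is the unprobed length \<open>n + 1\<close>, where the prefix is \<open>x\<close>.
  When the ends are adjacent, one column bridges them. A failed length thus joins the list with a
  correct answer although its own trials found none, and this is what keeps the list pairwise
  separated.

  The queries \<open>r\<close> and \<open>r + u + v\<close> are each uniform but not independent.
  Their joint success probability is the density of \<open>A\<close> met with a translate of itself,
  which may vanish for particular \<open>u\<close> and \<open>v\<close>. The threshold 1 / (2 k^2)
  is half the square of the guaranteed density; the off-diagonal part of the second moment then uses
  up at most half of the squared mean.

  The semantics demands halting and a time bound on every path, also after wrong verdicts. Hence
  every loop is cut off by a counter, no loop invariant mentions the correctness of stored answers,
  and errors are paid from a potential.\<close>

text \<open>\<open>Q\<close> and the time bound hold on every path; what holds only with high probability is expressed by the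
  potential \<open>g\<close>, whose expectation bounds the probability of failure.\<close>

definition run_from ::
  "env \<Rightarrow> com \<Rightarrow> store \<Rightarrow> qstate \<Rightarrow> nat \<Rightarrow> (store \<Rightarrow> qstate \<Rightarrow> bool) \<Rightarrow> (store \<Rightarrow> ennreal) \<Rightarrow> ennreal \<Rightarrow> bool"
  where
  "run_from E c \<sigma> \<psi> t Q g b \<longleftrightarrow>
     (\<forall>e. \<exists>\<mu>. big_step E c \<lparr>store = \<sigma>, qmem = \<psi>, elapsed = e\<rparr> \<mu> \<and>
        (\<forall>s \<in> set_pmf \<mu>. Q (store s) (qmem s) \<and> elapsed s \<le> e + t) \<and>
        (\<integral>\<^sup>+ s. g (store s) \<partial>measure_pmf \<mu>) \<le> b)"

text \<open>Quantifying over the quantum memory lets classical blocks compose without tracking it.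
  The quantum blocks meet this form because they reset the memory by \<open>QFresh\<close> before
  their first gate.\<close>

definition run :: "env \<Rightarrow> com \<Rightarrow> store \<Rightarrow> nat \<Rightarrow> (store \<Rightarrow> bool) \<Rightarrow> (store \<Rightarrow> ennreal) \<Rightarrow> ennreal \<Rightarrow> bool"
  where "run E c \<sigma> t Q g b \<longleftrightarrow> (\<forall>\<psi>. run_from E c \<sigma> \<psi> t (\<lambda>\<sigma>' _. Q \<sigma>') g b)"

lemma run_fromE:
  assumes "run_from E c \<sigma> \<psi> t Q g b"
  obtains \<mu> where "big_step E c \<lparr>store = \<sigma>, qmem = \<psi>, elapsed = e\<rparr> \<mu>"
    "\<And>s. s \<in> set_pmf \<mu> \<Longrightarrow> Q (store s) (qmem s)" "\<And>s. s \<in> set_pmf \<mu> \<Longrightarrow> elapsed s \<le> e + t"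
    "(\<integral>\<^sup>+ s. g (store s) \<partial>measure_pmf \<mu>) \<le> b"
  using assms unfolding run_from_def by meson

lemma runD: "run E c \<sigma> t Q g b \<Longrightarrow> run_from E c \<sigma> \<psi> t (\<lambda>\<sigma>' _. Q \<sigma>') g b"
  by (simp add: run_def)

lemma run_from_state:
  assumes "run_from E c (store s) (qmem s) t Q g b"
  shows "\<exists>\<mu>. big_step E c s \<mu> \<and>
        (\<forall>s' \<in> set_pmf \<mu>. Q (store s') (qmem s') \<and> elapsed s' \<le> elapsed s + t) \<and>
        (\<integral>\<^sup>+ s'. g (store s') \<partial>measure_pmf \<mu>) \<le> b"
  using assms unfolding run_from_def by (cases s) simp

lemma nn_integral_pmf_mono:
  assumes "\<And>s. s \<in> set_pmf \<mu> \<Longrightarrow> f s \<le> g s"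
  shows "(\<integral>\<^sup>+ s. f s \<partial>measure_pmf \<mu>) \<le> (\<integral>\<^sup>+ s. g s \<partial>measure_pmf \<mu>)"
  by (intro nn_integral_mono_AE) (simp add: AE_measure_pmf_iff assms)

text \<open>The slack \<open>p\<close> is the union bound of the logic: total mass is one, so
  raising the potential by a constant raises its expectation by that constant.\<close>

lemma run_from_mono:
  assumes "run_from E c \<sigma> \<psi> t Q g b" "t \<le> t'" "p + b \<le> b'"
    "\<And>\<sigma>' \<psi>'. Q \<sigma>' \<psi>' \<Longrightarrow> Q' \<sigma>' \<psi>'" "\<And>\<sigma>' \<psi>'. Q \<sigma>' \<psi>' \<Longrightarrow> g' \<sigma>' \<le> p + g \<sigma>'"
  shows "run_from E c \<sigma> \<psi> t' Q' g' b'"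
  unfolding run_from_def
proof
  fix e
  obtain \<mu> where \<mu>: "big_step E c \<lparr>store = \<sigma>, qmem = \<psi>, elapsed = e\<rparr> \<mu>"
    "\<And>s. s \<in> set_pmf \<mu> \<Longrightarrow> Q (store s) (qmem s)" "\<And>s. s \<in> set_pmf \<mu> \<Longrightarrow> elapsed s \<le> e + t"
    "(\<integral>\<^sup>+ s. g (store s) \<partial>measure_pmf \<mu>) \<le> b"
    by (rule run_fromE[OF assms(1), where e = e]) blast
  have "(\<integral>\<^sup>+ s. g' (store s) \<partial>measure_pmf \<mu>) \<le> (\<integral>\<^sup>+ s. p + g (store s) \<partial>measure_pmf \<mu>)"
    by (rule nn_integral_pmf_mono) (use assms(5) \<mu>(2) in blast)
  also have "\<dots> = p + (\<integral>\<^sup>+ s. g (store s) \<partial>measure_pmf \<mu>)"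
    by (subst nn_integral_add) simp_all
  also have "\<dots> \<le> p + b" using \<mu>(4) by (rule add_left_mono)
  finally have "(\<integral>\<^sup>+ s. g' (store s) \<partial>measure_pmf \<mu>) \<le> b'" using assms(3) by (rule order_trans)
  moreover have "elapsed s \<le> e + t'" if "s \<in> set_pmf \<mu>" for s
    using \<mu>(3)[OF that] assms(2) by simp
  ultimately show "\<exists>\<mu>. big_step E c \<lparr>store = \<sigma>, qmem = \<psi>, elapsed = e\<rparr> \<mu> \<and>
        (\<forall>s \<in> set_pmf \<mu>. Q' (store s) (qmem s) \<and> elapsed s \<le> e + t') \<and>
        (\<integral>\<^sup>+ s. g' (store s) \<partial>measure_pmf \<mu>) \<le> b'"
    using \<mu> assms(4) by blast
qed

lemma run_add:
  assumes "run E c \<sigma> t Q g b" "\<And>\<sigma>'. Q \<sigma>' \<Longrightarrow> g' \<sigma>' \<le> p + g \<sigma>'"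
  shows "run E c \<sigma> t Q g' (p + b)"
  unfolding run_def by (intro allI run_from_mono[OF runD[OF assms(1)] order_refl order_refl]) (use assms(2) in auto)

lemma run_mono:
  assumes "run E c \<sigma> t Q g b" "t \<le> t'" "b \<le> b'"
    "\<And>\<sigma>'. Q \<sigma>' \<Longrightarrow> Q' \<sigma>'" "\<And>\<sigma>'. Q \<sigma>' \<Longrightarrow> g' \<sigma>' \<le> g \<sigma>'"
  shows "run E c \<sigma> t' Q' g' b'"
  unfolding run_def by (intro allI run_from_mono[OF runD[OF assms(1)] assms(2), of 0]) (use assms(3-5) in auto)

lemma run_bound:
  assumes "run E c \<sigma> t Q g b" "\<And>\<sigma>'. Q \<sigma>' \<Longrightarrow> g' \<sigma>' \<le> b'"
  shows "run E c \<sigma> t Q g' b'"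
proof -
  have "run_from E c \<sigma> \<psi> t (\<lambda>\<sigma>' _. Q \<sigma>') (\<lambda>_. 0) 0" for \<psi>
    using runD[OF assms(1), of \<psi>] unfolding run_from_def by fastforce
  from run_from_mono[OF this order_refl, of b'] show ?thesis
    unfolding run_def using assms(2) by auto
qed

lemma run_from_Skip: "Q \<sigma> \<psi> \<Longrightarrow> g \<sigma> \<le> b \<Longrightarrow> run_from E Skip \<sigma> \<psi> 0 Q g b"
  unfolding run_from_def by (intro allI exI conjI, rule big_step.Skip) simp_all

lemma run_Skip: "Q \<sigma> \<Longrightarrow> g \<sigma> \<le> b \<Longrightarrow> run E Skip \<sigma> 0 Q g b"
  by (simp add: run_def run_from_Skip)

text \<open>Here \<open>f\<close> acts as a pre-expectation of \<open>d\<close>: by the tower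
  property of \<open>bind_pmf\<close>, the bound on the expectation of \<open>f\<close> passes to
  \<open>g\<close>. The continuation is chosen state by state, which serves \<open>Seq\<close> and
  \<open>While\<close> alike; \<open>t\<close> depends on the state for the sake of loops.\<close>

lemma run_from_bind:
  assumes \<mu>: "\<And>s. s \<in> set_pmf \<mu> \<Longrightarrow> P (store s) (qmem s)" "(\<integral>\<^sup>+ s. f (store s) \<partial>measure_pmf \<mu>) \<le> b"
    and d: "\<And>s. P (store s) (qmem s) \<Longrightarrow> run_from E d (store s) (qmem s) (t s) Q g (f (store s))"
  obtains \<nu> where "\<And>s. s \<in> set_pmf \<mu> \<Longrightarrow> big_step E d s (\<nu> s)"
    "\<And>s s'. s \<in> set_pmf \<mu> \<Longrightarrow> s' \<in> set_pmf (\<nu> s) \<Longrightarrow> Q (store s') (qmem s') \<and> elapsed s' \<le> elapsed s + t s"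
    "(\<integral>\<^sup>+ s. g (store s) \<partial>measure_pmf (bind_pmf \<mu> \<nu>)) \<le> b"
proof -
  have "\<exists>\<nu>. big_step E d s \<nu> \<and> (\<forall>s' \<in> set_pmf \<nu>. Q (store s') (qmem s') \<and> elapsed s' \<le> elapsed s + t s) \<and>
    (\<integral>\<^sup>+ s'. g (store s') \<partial>measure_pmf \<nu>) \<le> f (store s)" if "s \<in> set_pmf \<mu>" for s
    by (rule run_from_state[OF d[OF \<mu>(1)[OF that]]])
  then obtain \<nu> where \<nu>: "\<And>s. s \<in> set_pmf \<mu> \<Longrightarrow> big_step E d s (\<nu> s)"
    "\<And>s s'. s \<in> set_pmf \<mu> \<Longrightarrow> s' \<in> set_pmf (\<nu> s) \<Longrightarrow> Q (store s') (qmem s') \<and> elapsed s' \<le> elapsed s + t s"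
    "\<And>s. s \<in> set_pmf \<mu> \<Longrightarrow> (\<integral>\<^sup>+ s'. g (store s') \<partial>measure_pmf (\<nu> s)) \<le> f (store s)"
    by metis
  have "(\<integral>\<^sup>+ s'. g (store s') \<partial>measure_pmf (bind_pmf \<mu> \<nu>))
      = (\<integral>\<^sup>+ s. \<integral>\<^sup>+ s'. g (store s') \<partial>measure_pmf (\<nu> s) \<partial>measure_pmf \<mu>)"
    by simp
  also have "\<dots> \<le> (\<integral>\<^sup>+ s. f (store s) \<partial>measure_pmf \<mu>)"
    by (rule nn_integral_pmf_mono) (rule \<nu>(3))
  also note \<mu>(2)
  finally show ?thesis using that \<nu>(1,2) by blast
qed

lemma run_from_Seq:
  assumes c: "run_from E c \<sigma> \<psi> t1 P f b"
    and d: "\<And>\<sigma>' \<psi>'. P \<sigma>' \<psi>' \<Longrightarrow> run_from E d \<sigma>' \<psi>' t2 Q g (f \<sigma>')"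
  shows "run_from E (Seq c d) \<sigma> \<psi> (t1 + t2) Q g b"
  unfolding run_from_def
proof
  fix e
  obtain \<mu> where \<mu>: "big_step E c \<lparr>store = \<sigma>, qmem = \<psi>, elapsed = e\<rparr> \<mu>"
    "\<And>s. s \<in> set_pmf \<mu> \<Longrightarrow> P (store s) (qmem s)" "\<And>s. s \<in> set_pmf \<mu> \<Longrightarrow> elapsed s \<le> e + t1"
    "(\<integral>\<^sup>+ s. f (store s) \<partial>measure_pmf \<mu>) \<le> b"
    by (rule run_fromE[OF c, where e = e]) blast
  obtain \<nu> where \<nu>: "\<And>s. s \<in> set_pmf \<mu> \<Longrightarrow> big_step E d s (\<nu> s)"
    "\<And>s s'. s \<in> set_pmf \<mu> \<Longrightarrow> s' \<in> set_pmf (\<nu> s) \<Longrightarrow> Q (store s') (qmem s') \<and> elapsed s' \<le> elapsed s + t2"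
    "(\<integral>\<^sup>+ s. g (store s) \<partial>measure_pmf (bind_pmf \<mu> \<nu>)) \<le> b"
    by (rule run_from_bind[where P = P and f = f and t = "\<lambda>_. t2", OF \<mu>(2,4) d]) auto
  have "elapsed s' \<le> e + (t1 + t2)" if "s \<in> set_pmf \<mu>" "s' \<in> set_pmf (\<nu> s)" for s s'
    using \<mu>(3)[OF that(1)] \<nu>(2)[OF that] by simp
  then show "\<exists>\<mu>. big_step E (Seq c d) \<lparr>store = \<sigma>, qmem = \<psi>, elapsed = e\<rparr> \<mu> \<and>
        (\<forall>s \<in> set_pmf \<mu>. Q (store s) (qmem s) \<and> elapsed s \<le> e + (t1 + t2)) \<and>
        (\<integral>\<^sup>+ s. g (store s) \<partial>measure_pmf \<mu>) \<le> b"
    using big_step.Seq[OF \<mu>(1) \<nu>(1)] \<nu>(2,3) by (intro exI[of _ "bind_pmf \<mu> \<nu>"]) auto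
qed

lemma run_Seq:
  assumes "run E c \<sigma> t1 P f b" "\<And>\<sigma>'. P \<sigma>' \<Longrightarrow> run E d \<sigma>' t2 Q g (f \<sigma>')"
  shows "run E (Seq c d) \<sigma> (t1 + t2) Q g b"
  unfolding run_def by (intro allI run_from_Seq[OF runD[OF assms(1)]] runD assms(2))

lemma run_Seq_sure:
  assumes "run E c \<sigma> t1 P f b'" "\<And>\<sigma>'. P \<sigma>' \<Longrightarrow> run E d \<sigma>' t2 Q g b"
  shows "run E (Seq c d) \<sigma> (t1 + t2) Q g b"
  by (rule run_Seq[OF run_bound[OF assms(1), of "\<lambda>_. b"]]) (use assms(2) in auto)

lemma run_from_Cond:
  assumes "val \<sigma> e \<noteq> 0 \<Longrightarrow> run_from E c \<sigma> \<psi> t Q g b" "val \<sigma> e = 0 \<Longrightarrow> run_from E d \<sigma> \<psi> t Q g b"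
    "1 + val_cost \<sigma> e \<le> t'"
  shows "run_from E (Cond e c d) \<sigma> \<psi> (t' + t) Q g b"
  unfolding run_from_def
proof
  fix u
  let ?s = "\<lparr>store = \<sigma>, qmem = \<psi>, elapsed = u\<rparr>"
  have tick: "tick e ?s = \<lparr>store = \<sigma>, qmem = \<psi>, elapsed = u + 1 + val_cost \<sigma> e\<rparr>"
    by (simp add: tick_def)
  have "run_from E (if val \<sigma> e \<noteq> 0 then c else d) \<sigma> \<psi> t Q g b" using assms(1,2) by simp
  then obtain \<mu> where \<mu>: "big_step E (if val \<sigma> e \<noteq> 0 then c else d) (tick e ?s) \<mu>"
    "\<And>s. s \<in> set_pmf \<mu> \<Longrightarrow> Q (store s) (qmem s)"
    "\<And>s. s \<in> set_pmf \<mu> \<Longrightarrow> elapsed s \<le> (u + 1 + val_cost \<sigma> e) + t"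
    "(\<integral>\<^sup>+ s. g (store s) \<partial>measure_pmf \<mu>) \<le> b"
    unfolding tick by (rule run_fromE[where e = "u + 1 + val_cost \<sigma> e"]) blast
  have "big_step E (Cond e c d) ?s \<mu>"
    using \<mu>(1) by (cases "val \<sigma> e = 0") (auto intro: big_step.CondTrue big_step.CondFalse simp: test_def)
  moreover have "elapsed s \<le> u + (t' + t)" if "s \<in> set_pmf \<mu>" for s
    using \<mu>(3)[OF that] assms(3) by simp
  ultimately show "\<exists>\<mu>. big_step E (Cond e c d) ?s \<mu> \<and>
        (\<forall>s \<in> set_pmf \<mu>. Q (store s) (qmem s) \<and> elapsed s \<le> u + (t' + t)) \<and>
        (\<integral>\<^sup>+ s. g (store s) \<partial>measure_pmf \<mu>) \<le> b"
    using \<mu> by blast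
qed

lemma run_Cond:
  assumes "val \<sigma> e \<noteq> 0 \<Longrightarrow> run E c \<sigma> t Q g b" "val \<sigma> e = 0 \<Longrightarrow> run E d \<sigma> t Q g b"
    "1 + val_cost \<sigma> e \<le> t'"
  shows "run E (Cond e c d) \<sigma> (t' + t) Q g b"
  unfolding run_def by (intro allI run_from_Cond runD assms)

text \<open>The variant falls on every path, so at most \<open>v \<sigma>\<close> iterations occur
  with certainty, while \<open>f\<close> is a supermartingale along the loop. The extra
  \<open>t'\<close> pays for the final test.\<close>

lemma run_from_While:
  assumes step: "\<And>\<sigma> \<psi>. I \<sigma> \<psi> \<Longrightarrow> val \<sigma> e \<noteq> 0 \<Longrightarrow>
      run_from E c \<sigma> \<psi> t (\<lambda>\<sigma>' \<psi>'. I \<sigma>' \<psi>' \<and> v \<sigma>' < v \<sigma>) f (f \<sigma>)"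
    and cost: "\<And>\<sigma> \<psi>. I \<sigma> \<psi> \<Longrightarrow> 1 + val_cost \<sigma> e \<le> t'"
    and "I \<sigma> \<psi>"
  shows "run_from E (While e c) \<sigma> \<psi> (v \<sigma> * (t' + t) + t') (\<lambda>\<sigma>' \<psi>'. I \<sigma>' \<psi>' \<and> val \<sigma>' e = 0) f (f \<sigma>)"
  using \<open>I \<sigma> \<psi>\<close>
proof (induction "v \<sigma>" arbitrary: \<sigma> \<psi> rule: less_induct)
  case less
  show ?case
    unfolding run_from_def
  proof
    fix u
    let ?s = "\<lparr>store = \<sigma>, qmem = \<psi>, elapsed = u\<rparr>"
    have tick: "tick e ?s = \<lparr>store = \<sigma>, qmem = \<psi>, elapsed = u + 1 + val_cost \<sigma> e\<rparr>"
      by (simp add: tick_def)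
    show "\<exists>\<mu>. big_step E (While e c) ?s \<mu> \<and>
        (\<forall>s \<in> set_pmf \<mu>. (I (store s) (qmem s) \<and> val (store s) e = 0) \<and>
            elapsed s \<le> u + (v \<sigma> * (t' + t) + t')) \<and>
        (\<integral>\<^sup>+ s. f (store s) \<partial>measure_pmf \<mu>) \<le> f \<sigma>"
    proof (cases "val \<sigma> e = 0")
      case True
      have "big_step E (While e c) ?s (return_pmf (tick e ?s))"
        by (rule big_step.WhileFalse) (simp add: test_def True)
      then show ?thesis
        using cost[OF less.prems] less.prems True
        by (intro exI[of _ "return_pmf (tick e ?s)"]) (simp add: tick)
    next
      case False
      obtain \<mu> where \<mu>: "big_step E c (tick e ?s) \<mu>"
        "\<And>s. s \<in> set_pmf \<mu> \<Longrightarrow> I (store s) (qmem s) \<and> v (store s) < v \<sigma>"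
        "\<And>s. s \<in> set_pmf \<mu> \<Longrightarrow> elapsed s \<le> (u + 1 + val_cost \<sigma> e) + t"
        "(\<integral>\<^sup>+ s. f (store s) \<partial>measure_pmf \<mu>) \<le> f \<sigma>"
        unfolding tick
        by (rule run_fromE[OF step[OF less.prems False], where e = "u + 1 + val_cost \<sigma> e"]) blast
      obtain \<nu> where \<nu>: "\<And>s. s \<in> set_pmf \<mu> \<Longrightarrow> big_step E (While e c) s (\<nu> s)"
        "\<And>s s'. s \<in> set_pmf \<mu> \<Longrightarrow> s' \<in> set_pmf (\<nu> s) \<Longrightarrow> (I (store s') (qmem s') \<and> val (store s') e = 0) \<and>
            elapsed s' \<le> elapsed s + (v (store s) * (t' + t) + t')"
        "(\<integral>\<^sup>+ s. f (store s) \<partial>measure_pmf (bind_pmf \<mu> \<nu>)) \<le> f \<sigma>"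
        by (rule run_from_bind[where P = "\<lambda>\<sigma>' \<psi>'. I \<sigma>' \<psi>' \<and> v \<sigma>' < v \<sigma>"
            and f = f and t = "\<lambda>s. v (store s) * (t' + t) + t'", OF \<mu>(2,4) less.hyps]) auto
      have "elapsed s' \<le> u + (v \<sigma> * (t' + t) + t')"
        if s: "s \<in> set_pmf \<mu>" "s' \<in> set_pmf (\<nu> s)" for s s'
      proof -
        have "Suc (v (store s)) \<le> v \<sigma>" using \<mu>(2)[OF s(1)] by simp
        then have "Suc (v (store s)) * (t' + t) \<le> v \<sigma> * (t' + t)" by (rule mult_le_mono1)
        then show ?thesis
          using \<mu>(3)[OF s(1)] \<nu>(2)[OF s] cost[OF less.prems] by (simp add: algebra_simps)
      qed
      moreover have "big_step E (While e c) ?s (bind_pmf \<mu> \<nu>)"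
        by (rule big_step.WhileTrue[OF _ \<mu>(1) \<nu>(1)]) (simp_all add: test_def False)
      ultimately show ?thesis
        using \<nu>(2,3) by (intro exI[of _ "bind_pmf \<mu> \<nu>"]) auto
    qed
  qed
qed

lemma run_While:
  assumes "\<And>\<sigma>. I \<sigma> \<Longrightarrow> val \<sigma> e \<noteq> 0 \<Longrightarrow> run E c \<sigma> t (\<lambda>\<sigma>'. I \<sigma>' \<and> v \<sigma>' < v \<sigma>) f (f \<sigma>)"
    "\<And>\<sigma>. I \<sigma> \<Longrightarrow> 1 + val_cost \<sigma> e \<le> t'" "I \<sigma>"
  shows "run E (While e c) \<sigma> (v \<sigma> * (t' + t) + t') (\<lambda>\<sigma>'. I \<sigma>' \<and> val \<sigma>' e = 0) f (f \<sigma>)"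
  unfolding run_def by (intro allI run_from_While runD assms)

lemma run_from_Do:
  assumes "effect E i \<sigma> \<psi> = return_pmf (\<sigma>', \<psi>')" "instr_cost E i \<sigma> \<le> t" "Q \<sigma>' \<psi>'" "g \<sigma>' \<le> b"
  shows "run_from E (Do i) \<sigma> \<psi> t Q g b"
  unfolding run_from_def
proof
  fix e
  let ?s = "\<lparr>store = \<sigma>, qmem = \<psi>, elapsed = e\<rparr>"
  show "\<exists>\<mu>. big_step E (Do i) ?s \<mu> \<and>
        (\<forall>s \<in> set_pmf \<mu>. Q (store s) (qmem s) \<and> elapsed s \<le> e + t) \<and>
        (\<integral>\<^sup>+ s. g (store s) \<partial>measure_pmf \<mu>) \<le> b"
    using assms big_step.Do[of E i ?s] by (intro exI[of _ "exec E i ?s"]) (simp add: exec_def)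
qed

lemma run_Do:
  assumes "\<And>\<psi>. effect E i \<sigma> \<psi> = return_pmf (\<sigma>', \<psi>' \<psi>)" "instr_cost E i \<sigma> \<le> t" "Q \<sigma>'" "g \<sigma>' \<le> b"
  shows "run E (Do i) \<sigma> t Q g b"
  unfolding run_def using assms by (auto intro: run_from_Do[where \<sigma>' = \<sigma>'])

lemma run_Flip:
  assumes "1 + val_cost \<sigma> e \<le> t"
    "\<And>v. v \<in> {0, 1} \<Longrightarrow> Q (put a (val \<sigma> e) v \<sigma>)"
    "(g (put a (val \<sigma> e) 0 \<sigma>) + g (put a (val \<sigma> e) 1 \<sigma>)) * ennreal (1 / 2) \<le> b"
  shows "run E (Do (Flip a e)) \<sigma> t Q g b"
  unfolding run_def run_from_def
proof (intro allI)
  fix \<psi> u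
  let ?s = "\<lparr>store = \<sigma>, qmem = \<psi>, elapsed = u\<rparr>"
  have "(\<integral>\<^sup>+ s. g (store s) \<partial>measure_pmf (exec E (Flip a e) ?s)) \<le> b"
    using assms(3) by (simp add: exec_def algebra_simps del: ennreal_half)
  then show "\<exists>\<mu>. big_step E (Do (Flip a e)) ?s \<mu> \<and>
        (\<forall>s \<in> set_pmf \<mu>. Q (store s) \<and> elapsed s \<le> u + t) \<and>
        (\<integral>\<^sup>+ s. g (store s) \<partial>measure_pmf \<mu>) \<le> b"
    using assms(1,2) big_step.Do[of E "Flip a e" ?s]
    by (intro exI[of _ "exec E (Flip a e) ?s"]) (auto simp: exec_def)
qed

section \<open>Logarithmic cost of straight-line code\<close>

fun straight :: "com \<Rightarrow> bool" where
  "straight Skip = True"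
| "straight (Do (Assign a e f)) = True"
| "straight (Do (Fresh a)) = True"
| "straight (Do _) = False"
| "straight (Seq c d) = (straight c \<and> straight d)"
| "straight (Cond e c d) = (straight c \<and> straight d)"
| "straight (While e c) = False"

fun det :: "com \<Rightarrow> store \<Rightarrow> store" where
  "det Skip \<sigma> = \<sigma>"
| "det (Do (Assign a e f)) \<sigma> = put a (val \<sigma> e) (val \<sigma> f) \<sigma>"
| "det (Do (Fresh a)) \<sigma> = \<sigma>(a := (\<lambda>_. 0))"
| "det (Do _) \<sigma> = \<sigma>"
| "det (Seq c d) \<sigma> = det d (det c \<sigma>)"
| "det (Cond e c d) \<sigma> = (if val \<sigma> e \<noteq> 0 then det c \<sigma> else det d \<sigma>)"
| "det (While e c) \<sigma> = \<sigma>"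

text \<open>Arrays from 40 on are left out because they belong to an arbitrary hosted program, whose
  cells are not known to stay below \<open>B\<close>.\<close>

definition bdd :: "nat \<Rightarrow> store \<Rightarrow> bool" where
  "bdd B \<sigma> \<longleftrightarrow> (\<forall>a<40. \<forall>i. \<sigma> a i \<le> B)"

text \<open>This is the exponent in the bound \<open>B ^ esize e\<close> on values: products add
  exponents, and sums stay below products because both factors are at least 2. Addresses count as
  well, since they are charged.\<close>

fun esize :: "exp \<Rightarrow> nat" where
  "esize (Const k) = 1"
| "esize (Get a e) = esize e + 1"
| "esize (Add e f) = esize e + esize f"
| "esize (Sub e f) = esize e + esize f"
| "esize (Mul e f) = esize e + esize f"
| "esize (Div e f) = esize e + esize f"

fun small_exp :: "nat \<Rightarrow> exp \<Rightarrow> bool" where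
  "small_exp B (Const k) = (k \<le> B)"
| "small_exp B (Get a e) = (a < 40 \<and> small_exp B e)"
| "small_exp B (Add e f) = (small_exp B e \<and> small_exp B f)"
| "small_exp B (Sub e f) = (small_exp B e \<and> small_exp B f)"
| "small_exp B (Mul e f) = (small_exp B e \<and> small_exp B f)"
| "small_exp B (Div e f) = (small_exp B e \<and> small_exp B f)"

lemma esize_pos: "esize e \<ge> 1"
  by (induction e) auto

lemma val_le_power:
  assumes "bdd B \<sigma>" "B \<ge> 2" "small_exp B e"
  shows "val \<sigma> e \<le> B ^ esize e"
  using assms(3)
proof (induction e)
  case (Const k)
  then show ?case by simp
next
  case (Get a e)
  have "\<sigma> a (val \<sigma> e) \<le> B ^ 1" using Get assms(1) by (simp add: bdd_def)
  also have "\<dots> \<le> B ^ esize (Get a e)" using assms(2) by (intro power_increasing) auto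
  finally show ?case by simp
next
  case (Add e f)
  have "B ^ 1 \<le> B ^ esize e" "B ^ 1 \<le> B ^ esize f"
    using assms(2) esize_pos by (intro power_increasing; simp)+
  then have "2 \<le> B ^ esize e" "2 \<le> B ^ esize f" using assms(2) by auto
  then have "B ^ esize e + B ^ esize f \<le> B ^ esize e * B ^ esize f"
    by (metis add_le_mono le_trans mult_2 mult_le_mono1 mult_le_mono2 mult.commute nat_le_linear)
  then show ?case using Add by (simp add: power_add)
next
  case (Sub e f)
  have "val \<sigma> e - val \<sigma> f \<le> B ^ esize e" using Sub by simp
  also have "\<dots> \<le> B ^ (esize e + esize f)" using assms(2) by (intro power_increasing) auto
  finally show ?case by simp
next
  case (Mul e f)
  then show ?case by (simp add: power_add mult_le_mono)
next
  case (Div e f)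
  have "val \<sigma> e div val \<sigma> f \<le> B ^ esize e"
    using Div by (meson div_le_dividend order_trans small_exp.simps)
  also have "\<dots> \<le> B ^ (esize e + esize f)" using assms(2) by (intro power_increasing) auto
  finally show ?case by simp
qed

lemma power_floor_log_less: "k < 2 ^ bit_length k"
  unfolding bit_length_def by (cases "k = 0") (auto simp: floor_log_exp2_gt)

lemma bit_length_le: 
  assumes "k < 2 ^ m" "m \<ge> 1" shows "bit_length k \<le> m"
proof (cases "k = 0")
  case True
  then show ?thesis using assms(2) by (simp add: bit_length_def)
next
  case False
  then have "2 ^ floor_log k \<le> k" by (simp add: floor_log_exp2_le)
  then have "(2::nat) ^ floor_log k < 2 ^ m" using assms(1) by (rule le_less_trans)
  then have "floor_log k < m" by (simp only: power_strict_increasing_iff[of "2::nat"])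
  then show ?thesis by (simp add: bit_length_def)
qed

lemma bit_length_mono: "k \<le> m \<Longrightarrow> bit_length k \<le> bit_length m"
  unfolding bit_length_def by (simp add: floor_log_mono[THEN monoD])

lemma bit_length_val:
  assumes "bdd B \<sigma>" "B \<ge> 2" "small_exp B e"
  shows "bit_length (val \<sigma> e) \<le> bit_length B * esize e"
proof (rule bit_length_le)
  have "val \<sigma> e \<le> B ^ esize e" by (rule val_le_power[OF assms])
  also have "\<dots> < (2 ^ bit_length B) ^ esize e"
    using esize_pos[of e] by (intro power_strict_mono power_floor_log_less) auto
  finally show "val \<sigma> e < 2 ^ (bit_length B * esize e)" by (simp add: power_mult)
  show "1 \<le> bit_length B * esize e" using esize_pos[of e] by (simp add: bit_length_def)
qed

text \<open>The reason for a quadratic cost bound: it is closed under binary operators, because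
  \<open>2 * p * q\<close> is at least \<open>p + q\<close> for positive \<open>p\<close> and
  \<open>q\<close>, and this pays for the value at the new node.\<close>

lemma add_esize_bound:
  fixes l :: nat
  assumes "x \<le> l * p\<^sup>2" "y \<le> l * q\<^sup>2" "z \<le> l * (p + q)" "p \<ge> 1" "q \<ge> 1"
  shows "x + y + z \<le> l * (p + q)\<^sup>2"
proof -
  have "p * 1 \<le> p * q" "1 * q \<le> p * q" using assms(4,5) by (intro mult_le_mono; simp)+
  then have "p\<^sup>2 + q\<^sup>2 + (p + q) \<le> (p + q)\<^sup>2"
    unfolding power2_eq_square add_mult_distrib add_mult_distrib2 mult.commute[of q p] by linarith
  then have "l * (p\<^sup>2 + q\<^sup>2 + (p + q)) \<le> l * (p + q)\<^sup>2" by (rule mult_le_mono2)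
  then show ?thesis using assms(1-3) by (simp add: algebra_simps)
qed

lemma val_cost_le:
  assumes "bdd B \<sigma>" "B \<ge> 2" "small_exp B e"
  shows "val_cost \<sigma> e \<le> bit_length B * (esize e)\<^sup>2"
  using assms(3)
proof (induction e)
  case (Const k)
  then show ?case by (simp add: bit_length_mono)
next
  case (Get a e)
  then show ?case
    using bit_length_val[OF assms(1,2) Get.prems] by (simp add: power2_eq_square algebra_simps)
next
  case (Add e f)
  then show ?case
    using bit_length_val[OF assms(1,2) Add.prems] esize_pos[of e] esize_pos[of f]
    by (auto intro: add_esize_bound)
next
  case (Sub e f)
  then show ?case
    using bit_length_val[OF assms(1,2) Sub.prems] esize_pos[of e] esize_pos[of f]
    by (auto intro: add_esize_bound)
next
  case (Mul e f)
  then show ?case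
    using bit_length_val[OF assms(1,2) Mul.prems] esize_pos[of e] esize_pos[of f]
    by (auto intro: add_esize_bound)
next
  case (Div e f)
  then show ?case
    using bit_length_val[OF assms(1,2) Div.prems] esize_pos[of e] esize_pos[of f]
    by (auto intro: add_esize_bound)
qed

fun small :: "nat \<Rightarrow> com \<Rightarrow> bool" where
  "small B Skip = True"
| "small B (Do (Assign a e f)) = (a < 40 \<and> small_exp B e \<and> small_exp B f)"
| "small B (Do (Fresh a)) = (a < 40)"
| "small B (Do _) = False"
| "small B (Seq c d) = (small B c \<and> small B d)"
| "small B (Cond e c d) = (small_exp B e \<and> small B c \<and> small B d)"
| "small B (While e c) = False"

text \<open>Only written values are tested. Addresses may exceed \<open>B\<close>, as they do in the
  table of answers, and their cost is covered through \<open>esize\<close>.\<close>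

fun det_bdd :: "nat \<Rightarrow> com \<Rightarrow> store \<Rightarrow> bool" where
  "det_bdd B (Do (Assign a e f)) \<sigma> = (val \<sigma> f \<le> B)"
| "det_bdd B (Seq c d) \<sigma> = (det_bdd B c \<sigma> \<and> det_bdd B d (det c \<sigma>))"
| "det_bdd B (Cond e c d) \<sigma> = (if val \<sigma> e \<noteq> 0 then det_bdd B c \<sigma> else det_bdd B d \<sigma>)"
| "det_bdd B _ \<sigma> = True"

fun ccost :: "com \<Rightarrow> nat" where
  "ccost (Do (Assign a e f)) = 1 + (esize e)\<^sup>2 + (esize f)\<^sup>2"
| "ccost (Do _) = 1"
| "ccost (Seq c d) = ccost c + ccost d"
| "ccost (Cond e c d) = 1 + (esize e)\<^sup>2 + ccost c + ccost d"
| "ccost _ = 0"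

lemma bdd_put: "bdd B \<sigma> \<Longrightarrow> v \<le> B \<Longrightarrow> bdd B (put a i v \<sigma>)"
  by (simp add: bdd_def put_def)

lemma bit_length_ge_1: "bit_length B \<ge> 1"
  by (simp add: bit_length_def)

lemma run_straight_aux:
  assumes "straight c" "small B c" "bdd B \<sigma>" "B \<ge> 2" "det_bdd B c \<sigma>"
  shows "run E c \<sigma> (bit_length B * ccost c) (\<lambda>\<sigma>'. \<sigma>' = det c \<sigma> \<and> bdd B \<sigma>') (\<lambda>_. 0) 0"
  using assms
proof (induction c arbitrary: \<sigma>)
  case Skip
  then show ?case by (simp add: run_Skip)
next
  case (Do i)
  note L = bit_length_ge_1[of B]
  show ?case
  proof (cases i)
    case (Assign a e f)
    have "val_cost \<sigma> e \<le> bit_length B * (esize e)\<^sup>2" "val_cost \<sigma> f \<le> bit_length B * (esize f)\<^sup>2"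
      using Do Assign by (intro val_cost_le; simp)+
    then have "instr_cost E i \<sigma> \<le> bit_length B * ccost (Do i)"
      using L Assign by (simp add: algebra_simps)
    then show ?thesis
      using Do Assign by (intro run_Do[where \<sigma>' = "det (Do i) \<sigma>" and \<psi>' = id]) (auto intro: bdd_put)
  next
    case (Fresh a)
    then show ?thesis
      using Do L by (intro run_Do[where \<sigma>' = "det (Do i) \<sigma>" and \<psi>' = id]) (auto simp: bdd_def)
  qed (use Do in simp_all)
next
  case (Seq c d)
  have "run E (Seq c d) \<sigma> (bit_length B * ccost c + bit_length B * ccost d)
      (\<lambda>\<sigma>'. \<sigma>' = det (Seq c d) \<sigma> \<and> bdd B \<sigma>') (\<lambda>_. 0) 0"
    using Seq.prems Seq.IH
    by (intro run_Seq_sure[where P = "\<lambda>\<sigma>'. \<sigma>' = det c \<sigma> \<and> bdd B \<sigma>'" and f = "\<lambda>_. 0" and b' = 0]) auto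
  then show ?case by (simp add: algebra_simps)
next
  case (Cond e c d)
  note L = bit_length_ge_1[of B]
  have 1: "1 + val_cost \<sigma> e \<le> bit_length B * (1 + (esize e)\<^sup>2)"
    using val_cost_le[of B \<sigma> e] Cond.prems L by (simp add: algebra_simps)
  have "run E (Cond e c d) \<sigma> (bit_length B * (1 + (esize e)\<^sup>2) + bit_length B * (ccost c + ccost d))
      (\<lambda>\<sigma>'. \<sigma>' = det (Cond e c d) \<sigma> \<and> bdd B \<sigma>') (\<lambda>_. 0) 0"
  proof (rule run_Cond[OF _ _ 1])
    assume *: "val \<sigma> e \<noteq> 0"
    have "run E c \<sigma> (bit_length B * ccost c) (\<lambda>\<sigma>'. \<sigma>' = det c \<sigma> \<and> bdd B \<sigma>') (\<lambda>_. 0) 0"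
      using Cond * by simp
    then show "run E c \<sigma> (bit_length B * (ccost c + ccost d))
        (\<lambda>\<sigma>'. \<sigma>' = det (Cond e c d) \<sigma> \<and> bdd B \<sigma>') (\<lambda>_. 0) 0"
      by (rule run_mono) (use * in auto)
  next
    assume *: "val \<sigma> e = 0"
    have "run E d \<sigma> (bit_length B * ccost d) (\<lambda>\<sigma>'. \<sigma>' = det d \<sigma> \<and> bdd B \<sigma>') (\<lambda>_. 0) 0"
      using Cond * by simp
    then show "run E d \<sigma> (bit_length B * (ccost c + ccost d))
        (\<lambda>\<sigma>'. \<sigma>' = det (Cond e c d) \<sigma> \<and> bdd B \<sigma>') (\<lambda>_. 0) 0"
      by (rule run_mono) (use * in auto)
  qed
  then show ?case by (simp add: algebra_simps)
qed simp

text \<open>The cost of loop-free code is read off its syntax, so applications only have to evaluate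
  \<open>det\<close> and to bound the values written.\<close>

lemma run_straight:
  assumes "straight c" "small B c" "bdd B \<sigma>" "B \<ge> 2" "det_bdd B c \<sigma>"
    and "bdd B (det c \<sigma>) \<Longrightarrow> Q (det c \<sigma>)" "g (det c \<sigma>) \<le> b"
    and "bit_length B * ccost c \<le> t"
  shows "run E c \<sigma> t Q g b"
  by (rule run_mono[OF run_bound[OF run_straight_aux[OF assms(1-5)], of g b]])
    (use assms(6-8) in auto)

section \<open>Counting loops over the coordinates\<close>

abbreviation "scalar a \<equiv> Get a (Const 0)"

abbreviation assign :: "nat \<Rightarrow> exp \<Rightarrow> com" where
  "assign a e \<equiv> Do (Assign a (Const 0) e)"

definition for_dim :: "nat \<Rightarrow> com \<Rightarrow> com" where
  "for_dim a c = Seq (assign a (Const 0))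
     (While (Sub (scalar 0) (scalar a)) (Seq c (assign a (Add (scalar a) (Const 1)))))"

text \<open>The counter is advanced outside the body, hence invariant and potential are evaluated
  after a hypothetical \<open>put\<close>. In units of \<open>bit_length B\<close>, 28 is 17 for the
  test plus 11 for the increment, and 20 is the final test plus 3 for the initial
  assignment.\<close>

lemma run_for_dim:
  fixes I :: "nat \<Rightarrow> store \<Rightarrow> bool" and f :: "nat \<Rightarrow> store \<Rightarrow> ennreal"
  assumes a: "a < 40" "a \<noteq> 0" and B: "n < B" "B \<ge> 2"
    and init: "bdd B \<sigma>" "\<sigma> 0 0 = n" "I 0 (put a 0 0 \<sigma>)" "f 0 (put a 0 0 \<sigma>) \<le> b"
    and step: "\<And>j \<sigma>. j < n \<Longrightarrow> I j \<sigma> \<Longrightarrow> bdd B \<sigma> \<Longrightarrow> \<sigma> a 0 = j \<Longrightarrow> \<sigma> 0 0 = n \<Longrightarrow>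
      run E c \<sigma> t (\<lambda>\<sigma>'. bdd B \<sigma>' \<and> \<sigma>' a 0 = j \<and> \<sigma>' 0 0 = n \<and> I (Suc j) (put a 0 (Suc j) \<sigma>'))
        (\<lambda>\<sigma>'. f (Suc j) (put a 0 (Suc j) \<sigma>')) (f j \<sigma>)"
    and t': "n * (t + bit_length B * 28) + bit_length B * 20 \<le> t'"
  shows "run E (for_dim a c) \<sigma> t'
    (\<lambda>\<sigma>'. bdd B \<sigma>' \<and> \<sigma>' a 0 = n \<and> \<sigma>' 0 0 = n \<and> I n \<sigma>') (f n) b"
proof -
  let ?L = "bit_length B"
  note L = bit_length_ge_1[of B]
  \<comment> \<open>The loop rule has no round index; it is recovered from the counter cell.\<close>
  define J where "J \<sigma> \<longleftrightarrow> bdd B \<sigma> \<and> \<sigma> 0 0 = n \<and> \<sigma> a 0 \<le> n \<and> I (\<sigma> a 0) \<sigma>" for \<sigma>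
  have init': "run E (assign a (Const 0)) \<sigma> (?L * 3)
      (\<lambda>\<sigma>'. J \<sigma>' \<and> \<sigma>' a 0 = 0) (\<lambda>\<sigma>'. f (\<sigma>' a 0) \<sigma>') b"
    by (rule run_straight[where B = B]) (use init a B in \<open>auto simp: J_def put_def\<close>)
  have body: "run E (Seq c (assign a (Add (scalar a) (Const 1)))) \<sigma>' (t + ?L * 11)
      (\<lambda>\<sigma>''. J \<sigma>'' \<and> n - \<sigma>'' a 0 < n - \<sigma>' a 0) (\<lambda>\<sigma>''. f (\<sigma>'' a 0) \<sigma>'') (f (\<sigma>' a 0) \<sigma>')"
    if J: "J \<sigma>'" and nz: "val \<sigma>' (Sub (scalar 0) (scalar a)) \<noteq> 0" for \<sigma>'
  proof (rule run_Seq)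
    show "run E c \<sigma>' t (\<lambda>\<sigma>''. bdd B \<sigma>'' \<and> \<sigma>'' a 0 = \<sigma>' a 0 \<and> \<sigma>'' 0 0 = n \<and>
         I (Suc (\<sigma>' a 0)) (put a 0 (Suc (\<sigma>' a 0)) \<sigma>''))
        (\<lambda>\<sigma>''. f (Suc (\<sigma>' a 0)) (put a 0 (Suc (\<sigma>' a 0)) \<sigma>'')) (f (\<sigma>' a 0) \<sigma>')"
      by (rule step) (use J nz in \<open>auto simp: J_def\<close>)
  next
    fix \<sigma>''
    assume *: "bdd B \<sigma>'' \<and> \<sigma>'' a 0 = \<sigma>' a 0 \<and> \<sigma>'' 0 0 = n \<and>
         I (Suc (\<sigma>' a 0)) (put a 0 (Suc (\<sigma>' a 0)) \<sigma>'')"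
    have "\<sigma>' a 0 < n" using J nz by (auto simp: J_def)
    then show "run E (assign a (Add (scalar a) (Const 1))) \<sigma>'' (?L * 11)
       (\<lambda>\<sigma>''. J \<sigma>'' \<and> n - \<sigma>'' a 0 < n - \<sigma>' a 0) (\<lambda>\<sigma>''. f (\<sigma>'' a 0) \<sigma>'')
       (f (Suc (\<sigma>' a 0)) (put a 0 (Suc (\<sigma>' a 0)) \<sigma>''))"
      using * a B
      by (intro run_straight[where B = B]) (auto simp: J_def put_def power2_eq_square)
  qed
  have cost: "1 + val_cost \<sigma>' (Sub (scalar 0) (scalar a)) \<le> ?L * 17" if "J \<sigma>'" for \<sigma>'
    using val_cost_le[of B \<sigma>' "Sub (scalar 0) (scalar a)"] that a B L
    by (simp add: J_def power2_eq_square)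
  have loop: "run E (While (Sub (scalar 0) (scalar a)) (Seq c (assign a (Add (scalar a) (Const 1))))) \<sigma>'
     ((n - \<sigma>' a 0) * (?L * 17 + (t + ?L * 11)) + ?L * 17)
     (\<lambda>\<sigma>''. J \<sigma>'' \<and> val \<sigma>'' (Sub (scalar 0) (scalar a)) = 0) (\<lambda>\<sigma>''. f (\<sigma>'' a 0) \<sigma>'') (f (\<sigma>' a 0) \<sigma>')"
    if "J \<sigma>'" for \<sigma>'
    by (rule run_While[where I = J and v = "\<lambda>\<sigma>. n - \<sigma> a 0", OF body cost that])
  have "run E (for_dim a c) \<sigma> (?L * 3 + (n * (?L * 17 + (t + ?L * 11)) + ?L * 17))
     (\<lambda>\<sigma>''. J \<sigma>'' \<and> val \<sigma>'' (Sub (scalar 0) (scalar a)) = 0) (\<lambda>\<sigma>''. f (\<sigma>'' a 0) \<sigma>'') b"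
    unfolding for_dim_def
  proof (rule run_Seq[OF init'])
    fix \<sigma>' assume *: "J \<sigma>' \<and> \<sigma>' a 0 = 0"
    show "run E (While (Sub (scalar 0) (scalar a)) (Seq c (assign a (Add (scalar a) (Const 1))))) \<sigma>'
     (n * (?L * 17 + (t + ?L * 11)) + ?L * 17)
     (\<lambda>\<sigma>''. J \<sigma>'' \<and> val \<sigma>'' (Sub (scalar 0) (scalar a)) = 0) (\<lambda>\<sigma>''. f (\<sigma>'' a 0) \<sigma>'') (f (\<sigma>' a 0) \<sigma>')"
      using loop[of \<sigma>'] * by simp
  qed
  then show ?thesis
    by (rule run_mono) (use t' in \<open>auto simp: J_def algebra_simps\<close>)
qed

section \<open>Overlapping translates and random vectors\<close>

lemma card_carrier_vec: "card (carrier_vec n :: bit vec set) = 2 ^ n"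
  and finite_carrier_vec: "finite (carrier_vec n :: bit vec set)"
proof -
  have bij: "bij_betw (vec n) (PiE {..<n} (\<lambda>_. UNIV :: bit set)) (carrier_vec n)"
  proof (rule bij_betwI[where g = "\<lambda>v. \<lambda>i\<in>{..<n}. v $ i"])
    show "(\<lambda>v. \<lambda>i\<in>{..<n}. v $ i) (vec n x) = x" if "x \<in> PiE {..<n} (\<lambda>_. UNIV :: bit set)" for x
      using that by (auto simp: fun_eq_iff PiE_def extensional_def)
  qed auto
  have U: "(UNIV :: bit set) = {0, 1}" using bit_not_one_iff by blast
  have "finite (PiE {..<n} (\<lambda>_. UNIV :: bit set))" by (intro finite_PiE) (simp_all add: U)
  with bij show "finite (carrier_vec n :: bit vec set)" by (simp add: bij_betw_finite)
  have "card (PiE {..<n} (\<lambda>_. UNIV :: bit set)) = 2 ^ n" by (simp add: card_PiE U numeral_2_eq_2)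
  with bij show "card (carrier_vec n :: bit vec set) = 2 ^ n" by (simp add: bij_betw_same_card)
qed

lemma bit_vec_add_cancel:
  fixes u v :: "bit vec"
  assumes "u \<in> carrier_vec n" "v \<in> carrier_vec n"
  shows "u + v + v = u"
proof -
  have "a + b + b = a" for a b :: bit by (cases a; cases b) simp_all
  then show ?thesis using assms by (intro eq_vecI) auto
qed

lemma bit_vec_add_self:
  fixes u v :: "bit vec"
  assumes "u \<in> carrier_vec n" "v \<in> carrier_vec n"
  shows "u + (v + v) = u"
  using bit_vec_add_cancel[OF assms] assms by (simp add: assoc_add_vec[of _ n])

lemma card_translate:
  fixes v :: "bit vec"
  assumes v: "v \<in> carrier_vec n"
  shows "card {u \<in> carrier_vec n. P (u + v)} = card {u \<in> carrier_vec n. P u}"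
proof (rule bij_betw_same_card[of "\<lambda>u. u + v"], rule bij_betwI[where g = "\<lambda>u. u + v"])
qed (use v in \<open>auto simp: bit_vec_add_self\<close>)

text \<open>Compare the first two moments of the number of translates \<open>A + v j\<close> that contain a given point.\<close>

lemma few_separated_translates:
  fixes v :: "nat \<Rightarrow> bit vec" and k J :: nat
  assumes A: "A \<subseteq> carrier_vec n" "real (card A) * real k \<ge> 2 ^ n" and k: "k \<ge> 1"
    and v: "\<And>j. j < J \<Longrightarrow> v j \<in> carrier_vec n"
    and sep: "\<And>i j. i < j \<Longrightarrow> j < J \<Longrightarrow>
      2 * real k ^ 2 * real (card {r \<in> A. r + (v j + v i) \<in> A}) < 2 ^ n"
  shows "J \<le> 2 * k"
proof (rule ccontr)
  assume "\<not> J \<le> 2 * k"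
  then have J: "real J > 2 * real k" by (simp flip: of_nat_less_iff)
  let ?V = "carrier_vec n :: bit vec set"
  define a where "a = real (card A)"
  define X where "X = (2::real) ^ n"
  have X: "X > 0" by (simp add: X_def)
  have fin: "finite ?V" by (rule finite_carrier_vec)
  have count: "real (card {u \<in> ?V. P u}) = (\<Sum>u\<in>?V. of_bool (P u))" for P
    using fin by (simp add: Int_def of_bool_def sum.If_cases)
  define c where "c u = (\<Sum>j<J. of_bool (u + v j \<in> A) :: real)" for u
  have "(\<Sum>u\<in>?V. c u) = (\<Sum>j<J. \<Sum>u\<in>?V. of_bool (u + v j \<in> A))"
    unfolding c_def by (rule sum.swap)
  also have "\<dots> = (\<Sum>j<J. a)"
  proof (intro sum.cong refl)
    fix j assume "j \<in> {..<J}"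
    then have "(\<Sum>u\<in>?V. of_bool (u + v j \<in> A)) = real (card {u \<in> ?V. u \<in> A})"
      using card_translate[of "v j" n "\<lambda>u. u \<in> A"] v by (simp flip: count)
    also have "{u \<in> ?V. u \<in> A} = A" using A by auto
    finally show "(\<Sum>u\<in>?V. of_bool (u + v j \<in> A)) = a" by (simp add: a_def)
  qed
  finally have first: "(\<Sum>u\<in>?V. c u) = real J * a" by simp
  \<comment> \<open>In characteristic two the substitution \<open>r = u + v i\<close> turns
    \<open>u + v j\<close> into \<open>r + (v j + v i)\<close>, so two translates overlap as much as
    \<open>A\<close> does with a single translate of itself.\<close>
  have pair: "2 * real k ^ 2 * real (card {u \<in> ?V. u + v i \<in> A \<and> u + v j \<in> A}) < X"
    if "i < j" "j < J" for i j
  proof -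
    have "card {u \<in> ?V. u + v i \<in> A \<and> u + v j \<in> A}
        = card {u \<in> ?V. u + v i \<in> A \<and> (u + v i) + (v j + v i) \<in> A}"
    proof (intro arg_cong[of _ _ card] Collect_cong conj_cong refl)
      fix u assume u: "u \<in> ?V"
      have vi: "v i \<in> ?V" "v j \<in> ?V" using v that by auto
      have bits: "(a + c) + (b + c) = a + b" for a b c :: bit
        by (cases a; cases b; cases c) simp_all
      have "(u + v i) + (v j + v i) = u + v j"
        using carrier_vecD[OF u] carrier_vecD[OF vi(1)] carrier_vecD[OF vi(2)]
        by (intro eq_vecI) (simp_all add: bits del: add_bit_eq_xor)
      then show "(u + v j \<in> A) = ((u + v i) + (v j + v i) \<in> A)" by simp
    qed
    also have "\<dots> = card {r \<in> ?V. r \<in> A \<and> r + (v j + v i) \<in> A}"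
      using card_translate[of "v i" n "\<lambda>r. r \<in> A \<and> r + (v j + v i) \<in> A"] v that by simp
    also have "{r \<in> ?V. r \<in> A \<and> r + (v j + v i) \<in> A} = {r \<in> A. r + (v j + v i) \<in> A}"
      using A by auto
    finally show ?thesis using sep[OF that] by (simp add: X_def)
  qed
  have "(\<Sum>u\<in>?V. (c u)\<^sup>2) = (\<Sum>u\<in>?V. \<Sum>i<J. \<Sum>j<J. of_bool (u + v i \<in> A \<and> u + v j \<in> A))"
    unfolding c_def power2_eq_square sum_product by (intro sum.cong refl) auto
  also have "\<dots> = (\<Sum>i<J. \<Sum>j<J. real (card {u \<in> ?V. u + v i \<in> A \<and> u + v j \<in> A}))"
    unfolding count by (subst sum.swap, intro sum.cong refl, rule sum.swap)
  \<comment> \<open>Diagonal pairs contribute the full size of \<open>A\<close>, all others at most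
    the separation threshold.\<close>
  also have "\<dots> \<le> (\<Sum>i<J. \<Sum>j<J. (if i = j then a else 0) + X / (2 * real k ^ 2))"
  proof (intro sum_mono)
    fix i j assume ij: "i \<in> {..<J}" "j \<in> {..<J}"
    let ?C = "real (card {u \<in> ?V. u + v i \<in> A \<and> u + v j \<in> A})"
    show "?C \<le> (if i = j then a else 0) + X / (2 * real k ^ 2)"
    proof (cases "i = j")
      case True
      have "?C = real (card {u \<in> ?V. u \<in> A})"
        using True card_translate[of "v j" n "\<lambda>u. u \<in> A"] v ij by simp
      also have "{u \<in> ?V. u \<in> A} = A" using A by auto
      finally show ?thesis using True X by (simp add: a_def)
    next
      case False
      have "2 * real k ^ 2 * ?C < X"
        using pair[of i j] pair[of j i] False ij by (cases i j rule: linorder_cases) (auto simp: conj_commute)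
      then have "?C \<le> X / (2 * real k ^ 2)" using k by (simp add: field_simps)
      then show ?thesis using False by simp
    qed
  qed
  also have "\<dots> = real J * a + real J ^ 2 * (X / (2 * real k ^ 2))"
    by (simp add: sum.distrib power2_eq_square algebra_simps)
  finally have second: "(\<Sum>u\<in>?V. (c u)\<^sup>2) \<le> real J * a + real J ^ 2 * (X / (2 * real k ^ 2))" .
  have "(\<Sum>u\<in>?V. c u * 1)\<^sup>2 \<le> (\<Sum>u\<in>?V. (c u)\<^sup>2) * (\<Sum>u\<in>?V. 1\<^sup>2)"
    by (rule Cauchy_Schwarz_ineq_sum)
  then have "(real J * a)\<^sup>2 \<le> (\<Sum>u\<in>?V. (c u)\<^sup>2) * X"
    by (simp add: first card_carrier_vec X_def)
  also have "\<dots> \<le> (real J * a + real J ^ 2 * (X / (2 * real k ^ 2))) * X"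
    using second X by (intro mult_right_mono) auto
  finally have CS: "(real J * a)\<^sup>2 \<le> real J * a * X + real J ^ 2 * (X\<^sup>2 / (2 * real k ^ 2))"
    by (simp add: algebra_simps power2_eq_square)
  \<comment> \<open>The threshold is half of the squared minimal density, so the off-diagonal part
    is at most half of the left-hand side and is absorbed there.\<close>
  have "X / real k \<le> a" using A(2) k by (simp add: a_def X_def field_simps)
  then have "(X / real k)\<^sup>2 \<le> a\<^sup>2" using X by (intro power_mono) auto
  then have "X\<^sup>2 / (2 * real k ^ 2) \<le> a\<^sup>2 / 2" by (simp add: power_divide)
  then have "real J ^ 2 * (X\<^sup>2 / (2 * real k ^ 2)) \<le> real J ^ 2 * (a\<^sup>2 / 2)"
    by (intro mult_left_mono) auto
  then have "(real J * a)\<^sup>2 \<le> real J * a * X + real J ^ 2 * (a\<^sup>2 / 2)" using CS by linarith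
  then have "(real J * a) * (real J * a) \<le> 2 * X * (real J * a)"
    by (simp add: power2_eq_square algebra_simps)
  moreover have "X / real k > 0" using X k by simp
  ultimately have "a > 0" "(real J * a) * (real J * a) \<le> 2 * X * (real J * a)"
    using \<open>X / real k \<le> a\<close> by linarith+
  then have "real J * a \<le> 2 * X" using J by (simp add: mult_le_cancel_right)
  also have "\<dots> \<le> 2 * real k * a" using A(2) by (simp add: a_def X_def mult.commute)
  finally show False using J \<open>a > 0\<close> by simp
qed

section \<open>Uniform vectors drawn bit by bit\<close>

definition completions :: "nat \<Rightarrow> nat \<Rightarrow> (nat \<Rightarrow> nat) \<Rightarrow> bit vec set" where
  "completions n i w = {u \<in> carrier_vec n. \<forall>j<i. u $ j = of_nat (w j)}"

text \<open>The conditional expectation of \<open>G\<close> at a uniform vector whose first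
  \<open>i\<close> bits are fixed by \<open>w\<close>. It is a martingale in the bits drawn, hence a
  valid potential for the sampling loop, at whose end it equals \<open>G\<close> itself.\<close>

definition avg :: "nat \<Rightarrow> (bit vec \<Rightarrow> ennreal) \<Rightarrow> nat \<Rightarrow> (nat \<Rightarrow> nat) \<Rightarrow> ennreal" where
  "avg n G i w = ennreal (1 / 2 ^ (n - i)) * (\<Sum>u \<in> completions n i w. G u)"

lemma avg_step:
  assumes "i < n"
  shows "(avg n G (Suc i) (w(i := 0)) + avg n G (Suc i) (w(i := 1))) * ennreal (1 / 2) = avg n G i w"
proof -
  have "b = 0 \<or> b = 1" for b :: bit by (cases b) auto
  then have un: "completions n i w = completions n (Suc i) (w(i := 0)) \<union> completions n (Suc i) (w(i := 1))"
    by (auto simp: completions_def less_Suc_eq)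
  have disj: "completions n (Suc i) (w(i := 0)) \<inter> completions n (Suc i) (w(i := 1)) = {}"
    by (auto simp: completions_def)
  have fin: "finite (completions n j w')" for j w'
    unfolding completions_def using finite_carrier_vec by simp
  have "(1::real) / 2 ^ (n - i) = 1 / 2 ^ (n - Suc i) * (1 / 2)"
    using assms by (simp add: Suc_diff_Suc flip: power_Suc2)
  then have e: "ennreal (1 / 2 ^ (n - i)) = ennreal (1 / 2 ^ (n - Suc i)) * ennreal (1 / 2)"
    by (simp only:) (rule ennreal_mult; simp)
  show ?thesis
    unfolding avg_def un sum.union_disjoint[OF fin fin disj] e by (simp add: algebra_simps del: ennreal_half)
qed

lemma avg_dim: "avg n G n w = G (vec n (\<lambda>i. of_nat (w i)))"
proof -
  have "completions n n w = {vec n (\<lambda>i. of_nat (w i))}"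
    by (auto simp: completions_def)
  then show ?thesis by (simp add: avg_def)
qed

lemma avg_0: "avg n G 0 w = ennreal (1 / 2 ^ n) * (\<Sum>u \<in> carrier_vec n. G u)"
  by (simp add: avg_def completions_def)

section \<open>The reduction\<close>

text \<open>The frame condition stops at 30, so that scratch space and the arrays of the hosted
  verifier may change freely.\<close>

definition same :: "nat set \<Rightarrow> store \<Rightarrow> store \<Rightarrow> bool" where
  "same S \<sigma> \<sigma>' \<longleftrightarrow> (\<forall>a<30. a \<notin> S \<longrightarrow> \<sigma>' a = \<sigma> a)"

lemma sameD: "same S \<sigma> \<sigma>' \<Longrightarrow> a < 30 \<Longrightarrow> a \<notin> S \<Longrightarrow> \<sigma>' a = \<sigma> a"
  by (simp add: same_def)

lemma same_trans: "same S \<sigma> \<sigma>' \<Longrightarrow> same S' \<sigma>' \<sigma>'' \<Longrightarrow> S \<subseteq> U \<Longrightarrow> S' \<subseteq> U \<Longrightarrow> same U \<sigma> \<sigma>''"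
  unfolding same_def by (metis subsetD)

text \<open>Lengths beyond the dimension are allowed, so that \<open>n + 1\<close> also denotes the
  full vector \<open>x\<close>.\<close>

definition prefix :: "bit vec \<Rightarrow> nat \<Rightarrow> bit vec" where
  "prefix x m = vec (dim_vec x) (\<lambda>i. if i < m then x $ i else 0)"

definition answer :: "nat \<Rightarrow> store \<Rightarrow> nat \<Rightarrow> bit vec" where
  "answer n \<sigma> j = vec n (\<lambda>i. of_nat (\<sigma> 11 (j * n + i)))"

text \<open>Truncated subtraction turns a comparison into a number: \<open>e + 1 - f\<close>
  vanishes exactly if \<open>e\<close> is less than \<open>f\<close>.\<close>

abbreviation less_exp :: "exp \<Rightarrow> exp \<Rightarrow> exp" where
  "less_exp e f \<equiv> Sub (Const 1) (Sub (Add e (Const 1)) f)"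

abbreviation parity_exp :: "exp \<Rightarrow> exp" where
  "parity_exp e \<equiv> Sub e (Mul (Const 2) (Div e (Const 2)))"

text \<open>
  The arrays used by the reduction are: 0 the parameters, 1 the input, 2 the current answer, 3 a loop
  counter, 4 and 6 the solver's inputs, 5 and 7 its outputs, 8 and 9 the verifier's inputs, 12 its
  output, 10 and 11 the known prefix lengths and answers, 13 their number, 14 to 16 the bounds and
  midpoint of the binary search, 17 a matrix entry, 18 the verifier's accuracy, 19 the number of
  trials per known prefix, 20 the number of rounds, 21 the trial counter, 22 whether a trial has
  succeeded, 23 and 24 the computation of \<open>bit_length n\<close>. Arrays 30 and 31 are scratch space, and those from 40 on belong to the hosted verifier.
\<close>

definition sample_tail :: com where
  "sample_tail =
     Seq (Do (Assign 6 (scalar 3) (Add (Get 4 (scalar 3)) (Mul (Get 1 (scalar 3))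
           (Add (less_exp (scalar 3) (scalar 16))
             (less_exp (scalar 3) (Get 10 (Div (scalar 21) (scalar 19)))))))))
       (Do (Assign 8 (scalar 3) (Mul (Get 1 (scalar 3)) (less_exp (scalar 3) (scalar 16)))))"

definition sample :: com where
  "sample = for_dim 3 (Seq (Do (Flip 4 (scalar 3))) sample_tail)"

text \<open>The trial counter divided by \<open>N\<close> selects the known prefix, so a single loop
  runs through all pairs of list entry and trial.\<close>

definition combine_body :: com where
  "combine_body = Do (Assign 9 (scalar 3) (parity_exp (Add (Add (Get 5 (scalar 3)) (Get 7 (scalar 3)))
     (Get 11 (Add (Mul (Div (scalar 21) (scalar 19)) (scalar 0)) (scalar 3))))))"

definition attempt_tail :: com where
  "attempt_tail = Seq (assign 22 (scalar 12)) (assign 21 (Add (scalar 21) (Const 1)))"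

definition attempt :: "com \<Rightarrow> com" where
  "attempt Vc = Seq sample (Seq (Do (CallAlg 4 5)) (Seq (Do (CallAlg 6 7))
     (Seq (for_dim 3 combine_body) (Seq Vc attempt_tail))))"

text \<open>The choice of \<open>N\<close> and \<open>einv\<close> makes the failure probability of one probe at most
  \<open>1 / (6 k w)\<close>, where \<open>w = bit_length n\<close> is the number of probes in a round and there are at most \<open>2 k\<close>
  rounds. Each of the \<open>N D\<close> trials of a probe may suffer a verifier error of probability \<open>1 / einv\<close>.\<close>

lemma of_nat_bit_nat [simp]: "of_nat (bit_nat b) = (b :: bit)"
  by (cases b) (simp_all add: bit_nat_def)

lemma of_nat_mod_2_bit: "of_nat (m mod 2) = (of_nat m :: bit)"
proof -
  have "of_nat m = (of_nat (m mod 2 + 2 * (m div 2)) :: bit)" by simp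
  also have "\<dots> = of_nat (m mod 2) + of_nat 2 * of_nat (m div 2)"
    by (simp only: of_nat_add of_nat_mult)
  also have "\<dots> = of_nat (m mod 2)" by (simp del: add_bit_eq_xor)
  finally show ?thesis by simp
qed

lemma val_parity: "val \<sigma> (parity_exp e) = val \<sigma> e mod 2"
  by (simp add: minus_mult_div_eq_mod)

lemma get_put_vec: "v \<in> carrier_vec m \<Longrightarrow> get_vec m a (put_vec m b v \<sigma>) = (if a = b then v else get_vec m a \<sigma>)"
  by (auto simp: get_vec_def put_vec_def intro!: eq_vecI)

lemma get_vec_carrier [simp]: "get_vec m a \<sigma> \<in> carrier_vec m"
  by (simp add: get_vec_def)

lemma get_vec_cong: "\<sigma> a = \<sigma>' a \<Longrightarrow> get_vec m a \<sigma> = get_vec m a \<sigma>'"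
  by (simp add: get_vec_def)

text \<open>Both reductions are instances. The verifying program \<open>Vc\<close> and the
  entry-reading program \<open>Rc\<close> enter only through their time bounds \<open>tv\<close> and
  \<open>tr\<close>, and \<open>Vc\<close> may err with probability \<open>1 / einv\<close>. As the
  largest parameter, \<open>einv\<close> dominates the bound \<open>B\<close> on cell values. The
  reader may be asked for column \<open>n\<close>, just outside the matrix, where
  \<open>entry\<close> is 0.\<close>

locale reduction =
  fixes E :: env and n k D N einv B tv tr :: nat and M :: "bit mat" and x :: "bit vec"
    and Vc Rc :: com
  assumes dim: "mdim E = n" "n \<ge> 1" and M: "M \<in> carrier_mat n n" "matr E = M"
    and alg: "alg E \<in> carrier_vec n \<rightarrow> carrier_vec n" and x: "x \<in> carrier_vec n"
    and k: "k \<ge> 2"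
    and dense: "real (card {z \<in> carrier_vec n. alg E z = M *\<^sub>v z}) * real k \<ge> 2 ^ n"
    and D: "D = 2 * k + 1" and N: "N = 24 * k ^ 3 * bit_length n"
    and einv: "einv = 12 * k * bit_length n * N * D" and B: "B = einv + n + 2"
    and verifier: "\<And>\<sigma>. \<sigma> 0 0 = n \<Longrightarrow> \<sigma> 18 0 = einv \<Longrightarrow> bdd B \<sigma> \<Longrightarrow>
      run E Vc \<sigma> tv (\<lambda>\<sigma>'. bdd B \<sigma>' \<and> same {12} \<sigma> \<sigma>' \<and> \<sigma>' 12 0 \<le> 1)
        (\<lambda>\<sigma>'. of_bool ((\<sigma>' 12 0 \<noteq> 0) \<noteq> (get_vec n 9 \<sigma> = M *\<^sub>v get_vec n 8 \<sigma>))) (ennreal (1 / einv))"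
    and reader: "\<And>\<sigma>. \<sigma> 0 0 = n \<Longrightarrow> \<sigma> 3 0 < n \<Longrightarrow> \<sigma> 14 0 \<le> n \<Longrightarrow> bdd B \<sigma> \<Longrightarrow>
      run E Rc \<sigma> tr (\<lambda>\<sigma>'. bdd B \<sigma>' \<and> same {17} \<sigma> \<sigma>' \<and>
          \<sigma>' 17 0 = bit_nat (entry E (\<sigma> 3 0) (\<sigma> 14 0))) (\<lambda>_. 0) 0"
begin

abbreviation "L \<equiv> bit_length B"

abbreviation "\<eta> \<equiv> 1 / real einv"

definition A :: "bit vec set" where
  "A = {z \<in> carrier_vec n. alg E z = M *\<^sub>v z}"

definition x_cells :: "nat \<Rightarrow> nat" where
  "x_cells i = (if i < n then bit_nat (x $ i) else 0)"

definition standing :: "store \<Rightarrow> bool" where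
  "standing \<sigma> \<longleftrightarrow> bdd B \<sigma> \<and> \<sigma> 0 0 = n \<and> \<sigma> 0 1 = k \<and> \<sigma> 1 = x_cells \<and> \<sigma> 18 0 = einv \<and> \<sigma> 19 0 = N \<and> \<sigma> 20 0 = D \<and>
     1 \<le> \<sigma> 13 0 \<and> \<sigma> 13 0 \<le> D"

lemma standing_same:
  assumes "standing \<sigma>" "same S \<sigma> \<sigma>'" "bdd B \<sigma>'" "S \<inter> {0, 1, 13, 18, 19, 20} = {}"
  shows "standing \<sigma>'"
proof -
  have "0 \<notin> S" "1 \<notin> S" "13 \<notin> S" "18 \<notin> S" "19 \<notin> S" "20 \<notin> S" using assms(4) by auto
  then show ?thesis using assms(1-3) by (auto simp: standing_def same_def)
qed

lemma params: "N \<ge> 1" "einv \<ge> 288" "D \<le> einv" "N * D \<le> einv" "N \<le> einv" "k \<le> einv"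
  "12 * k * bit_length n * N * D \<le> einv"
proof -
  have W: "bit_length n \<ge> 1" by (rule bit_length_ge_1)
  have k3: "k ^ 3 \<ge> 1" using k by simp
  have "24 * 1 * 1 \<le> 24 * k ^ 3 * bit_length n" using W k3 by (intro mult_le_mono) auto
  then have N24: "N \<ge> 24" by (simp add: N)
  then show "N \<ge> 1" by simp
  have "12 * 1 * 1 * 24 * 1 \<le> 12 * k * bit_length n * N * D" using W N24 k D by (intro mult_le_mono) auto
  then show "einv \<ge> 288" by (simp add: einv)
  have "1 * 1 * 1 * N * D \<le> 12 * k * bit_length n * N * D" using W k by (intro mult_le_mono) auto
  then show ND: "N * D \<le> einv" by (simp add: einv)
  have "1 \<le> N" "1 \<le> D" using N24 D by simp_all
  then have *: "D \<le> N * D" "N \<le> N * D" by auto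
  show "D \<le> einv" by (rule order_trans[OF *(1) ND])
  show "N \<le> einv" by (rule order_trans[OF *(2) ND])
  have "k \<le> D" using D by simp
  then show "k \<le> einv" using \<open>D \<le> einv\<close> by simp
  show "12 * k * bit_length n * N * D \<le> einv" by (simp add: einv)
qed

lemma B_ge: "B \<ge> 290" "n + 2 \<le> B" "D \<le> B" "N * D \<le> B"
  using params B by auto

lemma dim_x [simp]: "dim_vec x = n"
  using x by simp

lemma prefix_carrier [simp]: "prefix x m \<in> carrier_vec n"
  by (simp add: prefix_def)

lemma x_cells_le: "x_cells i \<le> 1"
  by (simp add: x_cells_def bit_nat_def)

text \<open>Integrating an arbitrary \<open>G\<close> expresses that array 4 holds an exactly
  uniform vector. Arrays 6 and 8 are determined by it and by the store, so they belong in the sure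
  postcondition.\<close>

lemma sample_run:
  fixes G :: "bit vec \<Rightarrow> ennreal"
  assumes standing: "standing \<sigma>"
  defines "u \<equiv> prefix x (\<sigma> 16 0)" and "v \<equiv> prefix x (\<sigma> 10 (\<sigma> 21 0 div N))"
  shows "run E sample \<sigma> (n * (L * (5 + ccost sample_tail) + L * 28) + L * 20)
     (\<lambda>\<sigma>'. bdd B \<sigma>' \<and> same {3, 4, 6, 8} \<sigma> \<sigma>' \<and> get_vec n 8 \<sigma>' = u \<and> get_vec n 6 \<sigma>' = get_vec n 4 \<sigma>' + (u + v))
     (\<lambda>\<sigma>'. G (get_vec n 4 \<sigma>')) (ennreal (1 / 2 ^ n) * (\<Sum>r \<in> carrier_vec n. G r))"
proof -
  define I where "I i \<sigma>' \<longleftrightarrow> same {3, 4, 6, 8} \<sigma> \<sigma>' \<and> (\<forall>l<i. of_nat (\<sigma>' 8 l) = u $ l \<and>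
      of_nat (\<sigma>' 6 l) = of_nat (\<sigma>' 4 l) + (u $ l + v $ l))" for i and \<sigma>' :: store
  have "run E sample \<sigma> (n * (L * (5 + ccost sample_tail) + L * 28) + L * 20)
     (\<lambda>\<sigma>'. bdd B \<sigma>' \<and> \<sigma>' 3 0 = n \<and> \<sigma>' 0 0 = n \<and> I n \<sigma>')
     (\<lambda>\<sigma>'. avg n G n (\<sigma>' 4)) (ennreal (1 / 2 ^ n) * (\<Sum>r \<in> carrier_vec n. G r))"
    unfolding sample_def
  proof (rule run_for_dim[where B = B and n = n and I = I and f = "\<lambda>i \<sigma>'. avg n G i (\<sigma>' 4)", OF _ _ _ _ _ _ _ _ _ order_refl])
    fix i \<sigma>1
    assume i: "i < n" and I: "I i \<sigma>1" and b: "bdd B \<sigma>1" and i3: "\<sigma>1 3 0 = i" and n0: "\<sigma>1 0 0 = n"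
    note sm = sameD[of "{3, 4, 6, 8}" \<sigma> \<sigma>1]
    have eqs: "\<sigma>1 16 = \<sigma> 16" "\<sigma>1 10 = \<sigma> 10" "\<sigma>1 21 = \<sigma> 21" "\<sigma>1 19 0 = N" "\<sigma>1 1 = x_cells"
      using I standing by (auto simp: I_def standing_def sm)
    have val_lt: "val \<sigma>' (less_exp e f) = of_bool (val \<sigma>' e < val \<sigma>' f)" for e f \<sigma>' by auto
    show "run E (Seq (Do (Flip 4 (scalar 3))) sample_tail) \<sigma>1 (L * (5 + ccost sample_tail))
      (\<lambda>\<sigma>'. bdd B \<sigma>' \<and> \<sigma>' 3 0 = i \<and> \<sigma>' 0 0 = n \<and> I (Suc i) (put 3 0 (Suc i) \<sigma>'))
      (\<lambda>\<sigma>'. avg n G (Suc i) ((put 3 0 (Suc i) \<sigma>') 4)) (avg n G i (\<sigma>1 4))"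
      unfolding distrib_left
    proof (rule run_Seq[where P = "\<lambda>\<sigma>2. \<exists>w\<in>{0,1}. \<sigma>2 = put 4 i w \<sigma>1" and f = "\<lambda>\<sigma>2. avg n G (Suc i) (\<sigma>2 4)"])
      have "val_cost \<sigma>1 (scalar 3) \<le> L * 4"
        using val_cost_le[OF b, of "scalar 3"] B_ge by (simp add: power2_eq_square)
      then have "1 + val_cost \<sigma>1 (scalar 3) \<le> L * 5" using bit_length_ge_1[of B] by simp
      then show "run E (Do (Flip 4 (scalar 3))) \<sigma>1 (L * 5)
          (\<lambda>\<sigma>2. \<exists>w\<in>{0,1}. \<sigma>2 = put 4 i w \<sigma>1) (\<lambda>\<sigma>2. avg n G (Suc i) (\<sigma>2 4)) (avg n G i (\<sigma>1 4))"
      proof (rule run_Flip)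
        show "(avg n G (Suc i) ((put 4 (val \<sigma>1 (scalar 3)) 0 \<sigma>1) 4) +
            avg n G (Suc i) ((put 4 (val \<sigma>1 (scalar 3)) 1 \<sigma>1) 4)) * ennreal (1 / 2) \<le> avg n G i (\<sigma>1 4)"
          using avg_step[OF i, of G "\<sigma>1 4"] i3 by (simp add: put_def)
      qed (auto simp: i3)
    next
      fix \<sigma>2 assume "\<exists>w\<in>{0,1}. \<sigma>2 = put 4 i w \<sigma>1"
      then obtain w where w: "w \<in> {0, 1}" and \<sigma>2: "\<sigma>2 = put 4 i w \<sigma>1" by blast
      have w1: "w \<le> 1" using w by auto
      \<comment> \<open>The cell of array 6 holds an unreduced sum of up to three bits;
        \<open>get_vec\<close> reads it modulo 2.\<close>
      define z where "z = w + x_cells i * (of_bool (i < \<sigma> 16 0) + of_bool (i < \<sigma> 10 (\<sigma> 21 0 div N)))"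
      define p where "p = x_cells i * of_bool (i < \<sigma> 16 0)"
      have "z \<le> 1 + 1 * (1 + 1)" unfolding z_def using w1 x_cells_le[of i] by (intro add_mono mult_mono) auto
      then have zB: "z \<le> B" using B_ge by simp
      have "p \<le> 1" unfolding p_def using x_cells_le[of i] by simp
      then have pB: "p \<le> B" using B_ge by simp
      have det: "det sample_tail \<sigma>2 = put 8 i p (put 6 i z \<sigma>2)"
        unfolding sample_tail_def det.simps val.simps(1-3,5,6) val_lt
        by (simp add: \<sigma>2 put_def i3 eqs eqs(5)[unfolded One_nat_def] z_def p_def fun_eq_iff)
      have ui: "of_nat p = u $ i" "of_nat z = of_nat w + (u $ i + v $ i)"
        using i by (simp_all add: p_def z_def u_def v_def prefix_def x_cells_def)
      show "run E sample_tail \<sigma>2 (L * ccost sample_tail)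
         (\<lambda>\<sigma>'. bdd B \<sigma>' \<and> \<sigma>' 3 0 = i \<and> \<sigma>' 0 0 = n \<and> I (Suc i) (put 3 0 (Suc i) \<sigma>'))
         (\<lambda>\<sigma>'. avg n G (Suc i) ((put 3 0 (Suc i) \<sigma>') 4)) (avg n G (Suc i) (\<sigma>2 4))"
      proof (rule run_straight[where B = B])
        show "straight sample_tail" by (simp add: sample_tail_def)
        show "small B sample_tail" using B_ge by (simp add: sample_tail_def)
        show "bdd B \<sigma>2" unfolding \<sigma>2 using b w1 B_ge by (intro bdd_put) auto
        show "2 \<le> B" using B_ge by simp
        show "det_bdd B sample_tail \<sigma>2"
          using zB pB unfolding sample_tail_def det_bdd.simps det.simps val.simps(1-3,5,6) val_lt
          by (simp add: \<sigma>2 put_def i3 eqs eqs(5)[unfolded One_nat_def] z_def p_def)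
        assume bd: "bdd B (det sample_tail \<sigma>2)"
        have "same {3, 4, 6, 8} \<sigma> \<sigma>1" using I by (simp add: I_def)
        then show "bdd B (det sample_tail \<sigma>2) \<and> det sample_tail \<sigma>2 3 0 = i \<and> det sample_tail \<sigma>2 0 0 = n \<and>
            I (Suc i) (put 3 0 (Suc i) (det sample_tail \<sigma>2))"
          using bd I i3 n0 ui unfolding det I_def
          by (auto simp: put_def \<sigma>2 same_def less_Suc_eq)
      qed (simp_all add: det put_def)
    qed
  qed (use standing B_ge in \<open>auto simp: standing_def I_def same_def put_def avg_0\<close>)
  then show ?thesis
  proof (rule run_mono)
    fix \<sigma>' assume *: "bdd B \<sigma>' \<and> \<sigma>' 3 0 = n \<and> \<sigma>' 0 0 = n \<and> I n \<sigma>'"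
    have uv: "u \<in> carrier_vec n" "v \<in> carrier_vec n" by (simp_all add: u_def v_def)
    show "bdd B \<sigma>' \<and> same {3, 4, 6, 8} \<sigma> \<sigma>' \<and> get_vec n 8 \<sigma>' = u \<and> get_vec n 6 \<sigma>' = get_vec n 4 \<sigma>' + (u + v)"
      using * uv by (auto simp: I_def get_vec_def intro!: eq_vecI)
    show "G (get_vec n 4 \<sigma>') \<le> avg n G n (\<sigma>' 4)"
      by (simp add: avg_dim get_vec_def)
  qed simp_all
qed

lemma combine_run:
  assumes b: "bdd B \<sigma>" and n0: "\<sigma> 0 0 = n" and N: "\<sigma> 19 0 = N"
  shows "run E (for_dim 3 combine_body) \<sigma> (n * (L * ccost combine_body + L * 28) + L * 20)
     (\<lambda>\<sigma>'. bdd B \<sigma>' \<and> same {3, 9} \<sigma> \<sigma>' \<and>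
        get_vec n 9 \<sigma>' = get_vec n 5 \<sigma> + get_vec n 7 \<sigma> + answer n \<sigma> (\<sigma> 21 0 div N))
     (\<lambda>_. 0) 0"
proof -
  let ?j = "\<sigma> 21 0 div N"
  define I where "I i \<sigma>' \<longleftrightarrow> same {3, 9} \<sigma> \<sigma>' \<and> (\<forall>l<i. of_nat (\<sigma>' 9 l) =
      (of_nat (\<sigma> 5 l) + of_nat (\<sigma> 7 l) + of_nat (\<sigma> 11 (?j * n + l)) :: bit))" for i and \<sigma>' :: store
  have "run E (for_dim 3 combine_body) \<sigma> (n * (L * ccost combine_body + L * 28) + L * 20)
     (\<lambda>\<sigma>'. bdd B \<sigma>' \<and> \<sigma>' 3 0 = n \<and> \<sigma>' 0 0 = n \<and> I n \<sigma>') (\<lambda>_. 0) 0"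
  proof (rule run_for_dim[where B = B and n = n and I = I and f = "\<lambda>_ _. 0", OF _ _ _ _ _ _ _ _ _ order_refl])
    fix i \<sigma>1
    assume i: "i < n" and I: "I i \<sigma>1" and b: "bdd B \<sigma>1" and i3: "\<sigma>1 3 0 = i" and n0: "\<sigma>1 0 0 = n"
    have sm: "same {3, 9} \<sigma> \<sigma>1" using I by (simp add: I_def)
    note s = sameD[OF sm]
    define m where "m = \<sigma> 5 i + \<sigma> 7 i + \<sigma> 11 (?j * n + i)"
    have det: "det combine_body \<sigma>1 = put 9 i (m mod 2) \<sigma>1"
      unfolding combine_body_def det.simps val_parity using n0 i3 N by (simp add: s m_def)
    have "m mod 2 < 2" by simp
    then have m2: "m mod 2 \<le> B" using B_ge by linarith
    show "run E combine_body \<sigma>1 (L * ccost combine_body)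
        (\<lambda>\<sigma>'. bdd B \<sigma>' \<and> \<sigma>' 3 0 = i \<and> \<sigma>' 0 0 = n \<and> I (Suc i) (put 3 0 (Suc i) \<sigma>')) (\<lambda>_. 0) 0"
    proof (rule run_straight[where B = B])
      show "small B combine_body" using B_ge by (simp add: combine_body_def)
      have "det_bdd B combine_body \<sigma>1 \<longleftrightarrow> m mod 2 \<le> B"
        unfolding combine_body_def det_bdd.simps val_parity using n0 i3 N by (simp add: s m_def)
      then show "det_bdd B combine_body \<sigma>1" using m2 by simp
      assume "bdd B (det combine_body \<sigma>1)"
      then show "bdd B (det combine_body \<sigma>1) \<and> det combine_body \<sigma>1 3 0 = i \<and> det combine_body \<sigma>1 0 0 = n \<and>
            I (Suc i) (put 3 0 (Suc i) (det combine_body \<sigma>1))"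
        using I i3 n0 of_nat_mod_2_bit[of m] unfolding det I_def
        by (auto simp: put_def same_def less_Suc_eq m_def simp del: add_bit_eq_xor)
    qed (use b B_ge in \<open>simp_all add: combine_body_def\<close>)
  qed (use b n0 B_ge in \<open>auto simp: I_def same_def put_def\<close>)
  then show ?thesis
    by (rule run_mono) (auto simp: I_def get_vec_def answer_def intro!: eq_vecI simp del: add_bit_eq_xor)
qed

lemma bdd_put_vec: "bdd B \<sigma> \<Longrightarrow> bdd B (put_vec m a v \<sigma>)"
  using B_ge by (auto simp: bdd_def put_vec_def bit_nat_def)

lemma alg_carrier [simp]: "v \<in> carrier_vec n \<Longrightarrow> alg E v \<in> carrier_vec n"
  using alg by auto

lemma run_CallAlg:
  assumes "run E c (put_vec n b (alg E (get_vec n a \<sigma>)) \<sigma>) t Q g p"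
  shows "run E (Seq (Do (CallAlg a b)) c) \<sigma> (alg_cost E + t) Q g p"
proof (rule run_Seq_sure)
  let ?\<sigma> = "put_vec n b (alg E (get_vec n a \<sigma>)) \<sigma>"
  show "run E (Do (CallAlg a b)) \<sigma> (alg_cost E) (\<lambda>\<sigma>'. \<sigma>' = ?\<sigma>) (\<lambda>_. 0) 0"
    by (rule run_Do[where \<sigma>' = ?\<sigma> and \<psi>' = id]) (simp_all add: dim)
qed (use assms in simp)

definition t_attempt :: nat where
  "t_attempt = (n * (L * (5 + ccost sample_tail) + L * 28) + L * 20) + (alg_cost E + (alg_cost E +
     ((n * (L * ccost combine_body + L * 28) + L * 20) + (tv + L * ccost attempt_tail))))"

text \<open>\<open>q\<close> is a lower bound for the probability that both solver calls are answered correctly.\<close>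

lemma attempt_run:
  fixes q \<rho> :: real
  assumes standing: "standing \<sigma>" and c: "\<sigma> 21 0 < N * \<sigma> 13 0"
  defines "u \<equiv> prefix x (\<sigma> 16 0)" and "v \<equiv> prefix x (\<sigma> 10 (\<sigma> 21 0 div N))"
  assumes \<rho>: "0 \<le> \<rho>" "\<rho> \<le> 1"
    and q: "q = 0 \<or> answer n \<sigma> (\<sigma> 21 0 div N) = M *\<^sub>v v \<and> q * 2 ^ n \<le> card {r \<in> A. r + (u + v) \<in> A}"
  shows "run E (attempt Vc) \<sigma> t_attempt
     (\<lambda>\<sigma>'. bdd B \<sigma>' \<and> same {3, 4, 5, 6, 7, 8, 9, 12, 21, 22} \<sigma> \<sigma>' \<and> \<sigma>' 21 0 = Suc (\<sigma> 21 0) \<and> \<sigma>' 22 0 \<le> 1)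
     (\<lambda>\<sigma>'. ennreal (if \<sigma>' 22 0 = 0 then \<rho> else of_bool (get_vec n 9 \<sigma>' \<noteq> M *\<^sub>v u)))
     (ennreal (\<eta> + \<rho> * (1 - q)))"
proof -
  let ?Q = "\<lambda>\<sigma>'. bdd B \<sigma>' \<and> same {3, 4, 5, 6, 7, 8, 9, 12, 21, 22} \<sigma> \<sigma>' \<and> \<sigma>' 21 0 = Suc (\<sigma> 21 0) \<and> \<sigma>' 22 0 \<le> 1"
  let ?g = "\<lambda>\<sigma>'. ennreal (if \<sigma>' 22 0 = 0 then \<rho> else of_bool (get_vec n 9 \<sigma>' \<noteq> M *\<^sub>v u))"
  define y where "y r = alg E r + alg E (r + (u + v)) + answer n \<sigma> (\<sigma> 21 0 div N)" for r
  \<comment> \<open>Given \<open>r\<close> there are two charges: a possible verifier error, and, if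
    the candidate is wrong, the value \<open>\<rho>\<close> of the trials still to come.\<close>
  define G where "G r = ennreal (\<eta> + \<rho> * of_bool (y r \<noteq> M *\<^sub>v u))" for r
  have uv: "u \<in> carrier_vec n" "v \<in> carrier_vec n" by (simp_all add: u_def v_def)
  have rest: "run E (Seq (Do (CallAlg 4 5)) (Seq (Do (CallAlg 6 7)) (Seq (for_dim 3 combine_body) (Seq Vc attempt_tail)))) \<sigma>1
      (alg_cost E + (alg_cost E + ((n * (L * ccost combine_body + L * 28) + L * 20) + (tv + L * ccost attempt_tail))))
      ?Q ?g (G (get_vec n 4 \<sigma>1))"
    if \<sigma>1: "bdd B \<sigma>1 \<and> same {3, 4, 6, 8} \<sigma> \<sigma>1 \<and> get_vec n 8 \<sigma>1 = u \<and> get_vec n 6 \<sigma>1 = get_vec n 4 \<sigma>1 + (u + v)" for \<sigma>1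
  proof -
    let ?r = "get_vec n 4 \<sigma>1"
    define \<sigma>2 where "\<sigma>2 = put_vec n 5 (alg E ?r) \<sigma>1"
    define \<sigma>3 where "\<sigma>3 = put_vec n 7 (alg E (get_vec n 6 \<sigma>2)) \<sigma>2"
    have SI1: "standing \<sigma>1" using standing_same[OF standing, of "{3, 4, 6, 8}"] \<sigma>1 by simp
    have b: "bdd B \<sigma>2" "bdd B \<sigma>3" using \<sigma>1 by (simp_all add: \<sigma>2_def \<sigma>3_def bdd_put_vec)
    have s3: "same {5, 7} \<sigma>1 \<sigma>3" by (simp add: same_def \<sigma>2_def \<sigma>3_def put_vec_def)
    have SI3: "standing \<sigma>3" using standing_same[OF SI1 s3 b(2)] by simp
    have s3': "same {3, 4, 5, 6, 7, 8} \<sigma> \<sigma>3"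
      by (rule same_trans[OF _ s3]) (use \<sigma>1 in auto)
    have v3: "get_vec n 5 \<sigma>3 = alg E ?r" "get_vec n 7 \<sigma>3 = alg E (?r + (u + v))" "get_vec n 8 \<sigma>3 = u"
      using \<sigma>1 uv by (simp_all add: \<sigma>3_def \<sigma>2_def get_put_vec)
    have ans3: "answer n \<sigma>3 (\<sigma>3 21 0 div N) = answer n \<sigma> (\<sigma> 21 0 div N)"
      by (simp add: answer_def sameD[OF s3'])
    \<comment> \<open>If the verdict is right, rejection leaves \<open>\<rho>\<close> to pay exactly
      when the candidate is wrong, and acceptance costs nothing. A wrong verdict is charged 1, which
      dominates either outcome because \<open>\<rho>\<close> is at most 1.\<close>
    have last: "run E attempt_tail \<sigma>5 (L * ccost attempt_tail) ?Q ?g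
        (ennreal (\<rho> * of_bool (y ?r \<noteq> M *\<^sub>v u)) + of_bool ((\<sigma>5 12 0 \<noteq> 0) \<noteq> (y ?r = M *\<^sub>v u)))"
      if \<sigma>4: "bdd B \<sigma>4" "same {3, 9} \<sigma>3 \<sigma>4" "get_vec n 9 \<sigma>4 = y ?r"
        and \<sigma>5: "bdd B \<sigma>5" "same {12} \<sigma>4 \<sigma>5" "\<sigma>5 12 0 \<le> 1" for \<sigma>4 \<sigma>5
    proof (rule run_straight[where B = B])
      have s4: "same {3, 4, 5, 6, 7, 8, 9} \<sigma> \<sigma>4"
        by (rule same_trans[OF s3' \<sigma>4(2)]) auto
      have s5: "same {3, 4, 5, 6, 7, 8, 9, 12} \<sigma> \<sigma>5"
        by (rule same_trans[OF s4 \<sigma>5(2)]) auto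
      have det: "det attempt_tail \<sigma>5 = put 21 0 (Suc (\<sigma> 21 0)) (put 22 0 (\<sigma>5 12 0) \<sigma>5)"
        by (simp add: attempt_tail_def put_def sameD[OF s5])
      have "N * \<sigma> 13 0 \<le> N * D" using standing by (simp add: standing_def)
      then have c': "Suc (\<sigma> 21 0) \<le> B" using c B_ge by linarith
      show "det_bdd B attempt_tail \<sigma>5"
        using \<sigma>5(3) B_ge c' by (simp add: attempt_tail_def put_def sameD[OF s5])
      show "small B attempt_tail" using B_ge by (simp add: attempt_tail_def)
      show "?Q (det attempt_tail \<sigma>5)" if "bdd B (det attempt_tail \<sigma>5)"
        using that \<sigma>5(3) s5 unfolding det by (auto simp: put_def same_def)
      have y5: "get_vec n 9 (det attempt_tail \<sigma>5) = y ?r"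
        unfolding det \<sigma>4(3)[symmetric] using sameD[OF \<sigma>5(2), of 9] by (intro get_vec_cong) (simp add: put_def)
      show "?g (det attempt_tail \<sigma>5) \<le> ennreal (\<rho> * of_bool (y ?r \<noteq> M *\<^sub>v u)) + of_bool ((\<sigma>5 12 0 \<noteq> 0) \<noteq> (y ?r = M *\<^sub>v u))"
        unfolding y5 using \<rho> by (auto simp: det put_def)
    qed (use \<sigma>5 B_ge in \<open>simp_all add: attempt_tail_def\<close>)
    have G: "G ?r = ennreal (\<rho> * of_bool (y ?r \<noteq> M *\<^sub>v u)) + ennreal \<eta>"
      using \<rho> by (simp add: G_def add.commute flip: ennreal_plus)
    have verify: "run E (Seq Vc attempt_tail) \<sigma>4 (tv + L * ccost attempt_tail) ?Q ?g (G ?r)"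
      if \<sigma>4: "bdd B \<sigma>4" "same {3, 9} \<sigma>3 \<sigma>4" "get_vec n 9 \<sigma>4 = y ?r" for \<sigma>4
      unfolding G
    proof (rule run_Seq[OF run_add[OF verifier]])
      have "standing \<sigma>4" using standing_same[OF SI3 \<sigma>4(2,1)] by simp
      then show "\<sigma>4 0 0 = n" "\<sigma>4 18 0 = einv" "bdd B \<sigma>4" by (simp_all add: standing_def)
      have "get_vec n 8 \<sigma>4 = u"
        using sameD[OF \<sigma>4(2), of 8] v3(3) by (simp add: get_vec_def)
      then show "ennreal (\<rho> * of_bool (y ?r \<noteq> M *\<^sub>v u)) + of_bool ((\<sigma>' 12 0 \<noteq> 0) \<noteq> (y ?r = M *\<^sub>v u))
        \<le> ennreal (\<rho> * of_bool (y ?r \<noteq> M *\<^sub>v u)) + of_bool ((\<sigma>' 12 0 \<noteq> 0) \<noteq> (get_vec n 9 \<sigma>4 = M *\<^sub>v get_vec n 8 \<sigma>4))" for \<sigma>'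
        using \<sigma>4(3) by simp
    qed (use last[OF \<sigma>4] in blast)
    have "run E (Seq (for_dim 3 combine_body) (Seq Vc attempt_tail)) \<sigma>3
       ((n * (L * ccost combine_body + L * 28) + L * 20) + (tv + L * ccost attempt_tail)) ?Q ?g (G ?r)"
    proof (rule run_Seq_sure[OF combine_run])
      show "bdd B \<sigma>3" "\<sigma>3 0 0 = n" "\<sigma>3 19 0 = N" using SI3 by (simp_all add: standing_def)
    qed (rule verify, auto simp: v3 ans3 y_def)
    then have 3: "run E (Seq (Do (CallAlg 6 7)) (Seq (for_dim 3 combine_body) (Seq Vc attempt_tail))) \<sigma>2
       (alg_cost E + ((n * (L * ccost combine_body + L * 28) + L * 20) + (tv + L * ccost attempt_tail))) ?Q ?g (G ?r)"
      unfolding \<sigma>3_def by (rule run_CallAlg)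
    then show ?thesis
      unfolding \<sigma>2_def by (rule run_CallAlg)
  qed
  have avg: "ennreal (1 / 2 ^ n) * (\<Sum>r \<in> carrier_vec n. G r) \<le> ennreal (\<eta> + \<rho> * (1 - q))"
  proof -
    let ?V = "carrier_vec n :: bit vec set"
    have "(\<Sum>r\<in>?V. of_bool (y r \<noteq> M *\<^sub>v u)) \<le> (1 - q) * 2 ^ n"
    proof -
      have "(\<Sum>r\<in>?V. of_bool (y r \<noteq> M *\<^sub>v u)) = (\<Sum>r\<in>?V. 1 - of_bool (y r = M *\<^sub>v u) :: real)"
        by (intro sum.cong) auto
      also have "\<dots> = 2 ^ n - real (card {r \<in> ?V. y r = M *\<^sub>v u})"
        using finite_carrier_vec by (simp add: sum_subtractf card_carrier_vec Int_def of_bool_def sum.If_cases)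
      also have "\<dots> \<le> 2 ^ n - q * 2 ^ n"
      proof (cases "q = 0")
        case False
        with q have q': "answer n \<sigma> (\<sigma> 21 0 div N) = M *\<^sub>v v" "q * 2 ^ n \<le> card {r \<in> A. r + (u + v) \<in> A}" by auto
        have "y r = M *\<^sub>v u" if r: "r \<in> A" "r + (u + v) \<in> A" for r
        proof -
          have rc: "r \<in> ?V" using r by (simp add: A_def)
          have bits: "a + (a + (b + c)) + c = b" for a b c :: bit by (cases a; cases b; cases c) simp_all
          have "y r = M *\<^sub>v r + (M *\<^sub>v r + (M *\<^sub>v u + M *\<^sub>v v)) + M *\<^sub>v v"
            using r rc uv by (simp add: y_def A_def q' mult_add_distrib_mat_vec[OF M(1)])
          also have "\<dots> = M *\<^sub>v u"
            using M(1) rc uv by (intro eq_vecI) (simp_all add: bits del: add_bit_eq_xor)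
          finally show ?thesis .
        qed
        then have "card {r \<in> A. r + (u + v) \<in> A} \<le> card {r \<in> ?V. y r = M *\<^sub>v u}"
          by (intro card_mono) (auto simp: finite_carrier_vec A_def)
        then show ?thesis using q' by linarith
      qed simp
      finally show ?thesis by (simp add: algebra_simps)
    qed
    then have "(1 / 2 ^ n) * (\<Sum>r\<in>?V. \<eta> + \<rho> * of_bool (y r \<noteq> M *\<^sub>v u))
        \<le> (1 / 2 ^ n) * (2 ^ n * \<eta> + \<rho> * ((1 - q) * 2 ^ n))"
      using \<rho> by (intro mult_left_mono) (auto simp: sum.distrib card_carrier_vec simp flip: sum_distrib_left intro!: mult_left_mono)
    also have "\<dots> = \<eta> + \<rho> * (1 - q)" by (simp add: field_simps)
    finally have "ennreal ((1 / 2 ^ n) * (\<Sum>r\<in>?V. \<eta> + \<rho> * of_bool (y r \<noteq> M *\<^sub>v u))) \<le> ennreal (\<eta> + \<rho> * (1 - q))"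
      by (rule ennreal_leI)
    then show ?thesis
      using \<rho> unfolding G_def by (subst sum_ennreal) (auto simp flip: ennreal_mult')
  qed
  show ?thesis
    unfolding attempt_def t_attempt_def
    by (rule run_mono[OF run_Seq[OF sample_run[OF standing, of G] rest]])
      (use avg in \<open>auto simp: u_def v_def\<close>)
qed

end

section \<open>Probing one prefix against the whole list\<close>

definition probe_init :: com where
  "probe_init = Seq (assign 22 (Const 0)) (assign 21 (Const 0))"

text \<open>A product of truncated differences serves as a conjunction: no success so far, and
  trials left.\<close>

definition probe_test :: exp where
  "probe_test = Mul (Sub (Const 1) (scalar 22)) (Sub (Mul (scalar 19) (scalar 13)) (scalar 21))"

definition probe :: "com \<Rightarrow> com" where
  "probe Vc = Seq probe_init (While probe_test (attempt Vc))"

definition test_size :: "exp \<Rightarrow> nat" where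
  "test_size e = 1 + (esize e)\<^sup>2"

context reduction
begin

lemma test_cost: "bdd B \<sigma> \<Longrightarrow> small_exp B e \<Longrightarrow> 1 + val_cost \<sigma> e \<le> L * test_size e"
  using val_cost_le[of B \<sigma> e] bit_length_ge_1[of B] B_ge by (simp add: test_size_def algebra_simps)

text \<open>Given a correct stored answer for \<open>prefix x h\<close>, this makes a single trial
  succeed with probability at least \<open>1 / (2 * k ^ 2)\<close>, up to verifier errors.\<close>

definition overlapping :: "nat \<Rightarrow> nat \<Rightarrow> bool" where
  "overlapping m h \<longleftrightarrow> 2 ^ n \<le> 2 * real k ^ 2 * card {r \<in> A. r + (prefix x m + prefix x h) \<in> A}"

definition answers_ok :: "store \<Rightarrow> bool" where
  "answers_ok \<sigma> \<longleftrightarrow> (\<forall>j<\<sigma> 13 0. answer n \<sigma> j = M *\<^sub>v prefix x (\<sigma> 10 j))"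

text \<open>A union bound over all verdicts of a full probe, plus the chance that \<open>N\<close>
  trials against one overlapping entry all miss.\<close>

definition p_test :: real where
  "p_test = real (N * D) * \<eta> + (1 - 1 / (2 * real k ^ 2)) ^ N"

definition t_probe :: nat where
  "t_probe = L * ccost probe_init + (N * D * (L * test_size probe_test + t_attempt) + L * test_size probe_test)"

text \<open>\<open>U\<close> merges two claims. If it holds, the list entry \<open>js\<close>
  overlaps and a rejection counts as failure; if not, only the acceptance of a wrong answer does.
  One fixed \<open>js\<close> suffices: trials against other entries can end the probe early, but
  they spoil it only through a verdict error that is already paid for.\<close>

lemma probe_aux:
  assumes standing: "standing \<sigma>"
    and U: "U \<Longrightarrow> answer n \<sigma> js = M *\<^sub>v prefix x (\<sigma> 10 js) \<and> overlapping (\<sigma> 16 0) (\<sigma> 10 js) \<and> js < \<sigma> 13 0"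
  shows "run E (probe Vc) \<sigma> t_probe
     (\<lambda>\<sigma>'. bdd B \<sigma>' \<and> same {3, 4, 5, 6, 7, 8, 9, 12, 21, 22} \<sigma> \<sigma>')
     (\<lambda>\<sigma>'. of_bool (if \<sigma>' 22 0 \<noteq> 0 then get_vec n 9 \<sigma>' \<noteq> M *\<^sub>v prefix x (\<sigma> 16 0) else U))
     (ennreal p_test)"
proof -
  define J where "J = \<sigma> 13 0"
  have J: "J \<le> D" using standing by (simp add: J_def standing_def)
  define q0 where "q0 = 1 / (2 * real k ^ 2)"
  have "2 * real k ^ 2 \<ge> 1" using k by (simp add: power2_eq_square mult_ge1_I)
  then have q0: "0 \<le> q0" "q0 \<le> 1" by (auto simp: q0_def divide_le_eq_1)
  \<comment> \<open>Trials against \<open>js\<close> occupy the counter values from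
    \<open>js * N\<close> up to but excluding \<open>Suc js * N\<close>. The minimum with
    \<open>N\<close> caps the number still to come before that block is reached, and truncated
    subtraction makes it 0 afterwards.\<close>
  define \<rho> where "\<rho> c = (if U then (1 - q0) ^ min N (Suc js * N - c) else 0)" for c
  have \<rho>: "0 \<le> \<rho> c" "\<rho> c \<le> 1" for c using q0 by (auto simp: \<rho>_def intro: power_le_one)
  let ?S = "{3, 4, 5, 6, 7, 8, 9, 12, 21, 22} :: nat set"
  let ?u = "prefix x (\<sigma> 16 0)"
  define I where "I \<sigma>' \<longleftrightarrow> bdd B \<sigma>' \<and> same ?S \<sigma> \<sigma>' \<and> \<sigma>' 22 0 \<le> 1 \<and> \<sigma>' 21 0 \<le> N * J" for \<sigma>'
  \<comment> \<open>a union bound over the future verifier errors, plus the probability that all remaining trials with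
    prefix \<open>js\<close> miss\<close>
  define f where "f \<sigma>' = ennreal ((real (N * J) - real (\<sigma>' 21 0)) * \<eta> +
      (if \<sigma>' 22 0 = 0 then \<rho> (\<sigma>' 21 0) else of_bool (get_vec n 9 \<sigma>' \<noteq> M *\<^sub>v ?u)))" for \<sigma>'
  define v where "v \<sigma>' = (if \<sigma>' 22 0 = 0 then N * J - \<sigma>' 21 0 else 0)" for \<sigma>' :: store
  have step: "run E (attempt Vc) \<sigma>1 t_attempt (\<lambda>\<sigma>'. I \<sigma>' \<and> v \<sigma>' < v \<sigma>1) f (f \<sigma>1)"
    if I: "I \<sigma>1" and t: "val \<sigma>1 probe_test \<noteq> 0" for \<sigma>1
  proof -
    have s1: "same ?S \<sigma> \<sigma>1" using I by (simp add: I_def)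
    have SI1: "standing \<sigma>1" by (rule standing_same[OF standing s1]) (use I in \<open>auto simp: I_def\<close>)
    have J1: "\<sigma>1 13 0 = J" by (simp add: J_def sameD[OF s1])
    have found: "\<sigma>1 22 0 = 0" and c: "\<sigma>1 21 0 < N * J"
      using t SI1 by (auto simp: probe_test_def standing_def J1)
    define c where "c = \<sigma>1 21 0"
    define q where "q = (if U \<and> c div N = js then q0 else 0)"
    have uv: "\<sigma>1 16 = \<sigma> 16" "\<sigma>1 10 = \<sigma> 10" "\<And>j. answer n \<sigma>1 j = answer n \<sigma> j"
      by (simp_all add: sameD[OF s1] answer_def)
    have "run E (attempt Vc) \<sigma>1 t_attempt
       (\<lambda>\<sigma>'. bdd B \<sigma>' \<and> same ?S \<sigma>1 \<sigma>' \<and> \<sigma>' 21 0 = Suc (\<sigma>1 21 0) \<and> \<sigma>' 22 0 \<le> 1)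
       (\<lambda>\<sigma>'. ennreal (if \<sigma>' 22 0 = 0 then \<rho> (Suc c) else of_bool (get_vec n 9 \<sigma>' \<noteq> M *\<^sub>v prefix x (\<sigma>1 16 0))))
       (ennreal (\<eta> + \<rho> (Suc c) * (1 - q)))"
    proof (rule attempt_run[OF SI1])
      have "q0 * 2 ^ n \<le> card {r \<in> A. r + (prefix x (\<sigma> 16 0) + prefix x (\<sigma> 10 js)) \<in> A}" if U
        using U[OF that] k by (simp add: overlapping_def q0_def field_simps)
      then show "q = 0 \<or> answer n \<sigma>1 (\<sigma>1 21 0 div N) = M *\<^sub>v prefix x (\<sigma>1 10 (\<sigma>1 21 0 div N)) \<and>
          q * 2 ^ n \<le> card {r \<in> A. r + (prefix x (\<sigma>1 16 0) + prefix x (\<sigma>1 10 (\<sigma>1 21 0 div N))) \<in> A}"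
        using U unfolding uv by (auto simp: q_def c_def)
    qed (use c \<rho> J1 in auto)
    then have "run E (attempt Vc) \<sigma>1 t_attempt
       (\<lambda>\<sigma>'. bdd B \<sigma>' \<and> same ?S \<sigma>1 \<sigma>' \<and> \<sigma>' 21 0 = Suc (\<sigma>1 21 0) \<and> \<sigma>' 22 0 \<le> 1)
       f (ennreal ((real (N * J) - real (Suc c)) * \<eta>) + ennreal (\<eta> + \<rho> (Suc c) * (1 - q)))"
    proof (rule run_add)
      fix \<sigma>' assume *: "bdd B \<sigma>' \<and> same ?S \<sigma>1 \<sigma>' \<and> \<sigma>' 21 0 = Suc (\<sigma>1 21 0) \<and> \<sigma>' 22 0 \<le> 1"
      have "0 \<le> real (N * J) - real (Suc c)" using c by (simp add: c_def flip: of_nat_mult)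
      then show "f \<sigma>' \<le> ennreal ((real (N * J) - real (Suc c)) * \<eta>) +
          ennreal (if \<sigma>' 22 0 = 0 then \<rho> (Suc c) else of_bool (get_vec n 9 \<sigma>' \<noteq> M *\<^sub>v prefix x (\<sigma>1 16 0)))"
        using * \<rho>(1) by (subst ennreal_plus[symmetric]) (auto simp: f_def uv c_def)
    qed
    then show ?thesis
    proof (rule run_mono)
      \<comment> \<open>Inside the block of \<open>js\<close> the exponent drops by one, and the
        lost factor is the miss probability \<open>1 - q\<close>; elsewhere \<open>q\<close> is 0
        and the exponent does not change.\<close>
      have "\<rho> (Suc c) * (1 - q) \<le> \<rho> c"
      proof (cases "U \<and> c div N = js")
        case True
        have N1: "N \<ge> 1" by (rule params)
        have "c < Suc js * N" using True dividend_less_div_times[of N c] N1 by auto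
        moreover have "js * N \<le> c" using True times_div_less_eq_dividend[of N c] by (auto simp: mult.commute)
        ultimately have "min N (Suc js * N - c) = Suc (min N (Suc js * N - Suc c))" by auto
        then show ?thesis using True by (simp add: \<rho>_def q_def mult.commute)
      next
        case False
        have "min N (Suc js * N - c) \<le> min N (Suc js * N - Suc c)" if U
        proof -
          have ne: "c div N \<noteq> js" using False that by simp
          show ?thesis
          proof (cases "c div N < js")
            case True
            have "c < Suc (c div N) * N" using dividend_less_div_times[of N c] params(1) by (simp add: add.commute)
            also have "\<dots> \<le> js * N" using True by (intro mult_le_mono1) simp
            finally show ?thesis by simp
          next
            case False
            then have "Suc js * N \<le> (c div N) * N" using ne by (intro mult_le_mono1) simp
            also have "\<dots> \<le> c" by simp
            finally show ?thesis by simp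
          qed
        qed
        then have "\<rho> (Suc c) \<le> \<rho> c"
          using q0 unfolding \<rho>_def by (auto intro!: power_decreasing)
        then show ?thesis unfolding q_def if_not_P[OF False] by simp
      qed
      then have h1: "(real (N * J) - real (Suc c)) * \<eta> + (\<eta> + \<rho> (Suc c) * (1 - q)) \<le> (real (N * J) - real c) * \<eta> + \<rho> c"
        by (simp add: algebra_simps add_divide_distrib)
      have h2: "0 \<le> (real (N * J) - real (Suc c)) * \<eta>" using c by (simp add: c_def flip: of_nat_mult)
      have h3: "0 \<le> \<eta> + \<rho> (Suc c) * (1 - q)" using \<rho> q0 by (auto simp: q_def)
      have "f \<sigma>1 = ennreal ((real (N * J) - real c) * \<eta> + \<rho> c)" using found by (simp add: f_def c_def)
      then show "ennreal ((real (N * J) - real (Suc c)) * \<eta>) + ennreal (\<eta> + \<rho> (Suc c) * (1 - q)) \<le> f \<sigma>1"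
        unfolding ennreal_plus[OF h2 h3, symmetric] by (simp only: ennreal_leI[OF h1])
      fix \<sigma>' assume *: "bdd B \<sigma>' \<and> same ?S \<sigma>1 \<sigma>' \<and> \<sigma>' 21 0 = Suc (\<sigma>1 21 0) \<and> \<sigma>' 22 0 \<le> 1"
      then show "I \<sigma>' \<and> v \<sigma>' < v \<sigma>1"
        using c found same_trans[OF s1, of ?S \<sigma>' ?S] by (auto simp: I_def v_def)
    qed simp_all
  qed
  have cost: "1 + val_cost \<sigma>1 probe_test \<le> L * test_size probe_test" if "I \<sigma>1" for \<sigma>1
    by (rule test_cost) (use that B_ge in \<open>simp_all add: I_def probe_test_def\<close>)
  have loop: "run E (While probe_test (attempt Vc)) \<sigma>1 (N * D * (L * test_size probe_test + t_attempt) + L * test_size probe_test)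
     (\<lambda>\<sigma>'. bdd B \<sigma>' \<and> same ?S \<sigma> \<sigma>')
     (\<lambda>\<sigma>'. of_bool (if \<sigma>' 22 0 \<noteq> 0 then get_vec n 9 \<sigma>' \<noteq> M *\<^sub>v ?u else U)) (f \<sigma>1)"
    if I1: "I \<sigma>1" for \<sigma>1
  proof (rule run_mono[OF run_While[where I = I and v = v and f = f and \<sigma> = \<sigma>1, OF step cost I1]])
    have "v \<sigma>1 \<le> N * D" using J by (auto simp: v_def intro: order_trans[OF diff_le_self])
    then show "v \<sigma>1 * (L * test_size probe_test + t_attempt) + L * test_size probe_test
      \<le> N * D * (L * test_size probe_test + t_attempt) + L * test_size probe_test"
      by (intro add_right_mono mult_le_mono1)
    fix \<sigma>' assume *: "I \<sigma>' \<and> val \<sigma>' probe_test = 0"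
    then show "bdd B \<sigma>' \<and> same ?S \<sigma> \<sigma>'" by (simp add: I_def)
    have SI': "standing \<sigma>'" by (rule standing_same[OF standing, of ?S]) (use * in \<open>auto simp: I_def\<close>)
    have J': "\<sigma>' 13 0 = J" using * by (simp add: J_def I_def sameD[of ?S \<sigma> \<sigma>'])
    have c: "\<sigma>' 21 0 \<le> N * J" "\<sigma>' 22 0 \<le> 1" using * by (auto simp: I_def)
    have nn: "0 \<le> (real (N * J) - real (\<sigma>' 21 0)) * \<eta>" using c by (simp flip: of_nat_mult)
    show "of_bool (if \<sigma>' 22 0 \<noteq> 0 then get_vec n 9 \<sigma>' \<noteq> M *\<^sub>v ?u else U) \<le> f \<sigma>'"
    proof (cases "\<sigma>' 22 0 = 0")
      case True
      then have cN: "\<sigma>' 21 0 = N * J" using * c SI' J' by (auto simp: probe_test_def standing_def)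
      \<comment> \<open>All trials against \<open>js\<close> are over, so the exponent is 0 and
        \<open>\<rho>\<close> equals 1, which pays for the failure.\<close>
      have "Suc js * N \<le> J * N" if U using U[OF that] by (intro mult_le_mono1) (simp add: J_def)
      then show ?thesis using True cN by (auto simp: f_def \<rho>_def mult.commute)
    next
      case False
      then show ?thesis using nn by (auto simp: f_def simp flip: ennreal_1 intro!: ennreal_leI)
    qed
  qed simp_all
  show ?thesis
    unfolding probe_def t_probe_def
  proof (rule run_Seq)
    show "run E probe_init \<sigma> (L * ccost probe_init)
      (\<lambda>\<sigma>1. I \<sigma>1 \<and> f \<sigma>1 \<le> ennreal p_test) (\<lambda>\<sigma>1. ennreal p_test) (ennreal p_test)"
    proof (rule run_straight[where B = B])
      assume b: "bdd B (det probe_init \<sigma>)"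
      have "\<rho> 0 \<le> (1 - q0) ^ N" using q0 by (auto simp: \<rho>_def)
      moreover have "real (N * J) * \<eta> \<le> real (N * D) * \<eta>"
        using J by (intro mult_right_mono of_nat_mono mult_le_mono) auto
      ultimately have "real (N * J) * \<eta> + \<rho> 0 \<le> p_test" unfolding p_test_def q0_def[symmetric] by linarith
      then show "I (det probe_init \<sigma>) \<and> f (det probe_init \<sigma>) \<le> ennreal p_test"
        using b by (auto simp: I_def f_def probe_init_def put_def same_def intro!: ennreal_leI)
    qed (use standing B_ge in \<open>simp_all add: probe_init_def standing_def\<close>)
  next
    fix \<sigma>1 assume "I \<sigma>1 \<and> f \<sigma>1 \<le> ennreal p_test"
    then show "run E (While probe_test (attempt Vc)) \<sigma>1
        (N * D * (L * test_size probe_test + t_attempt) + L * test_size probe_test)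
        (\<lambda>\<sigma>'. bdd B \<sigma>' \<and> same ?S \<sigma> \<sigma>')
        (\<lambda>\<sigma>'. of_bool (if \<sigma>' 22 0 \<noteq> 0 then get_vec n 9 \<sigma>' \<noteq> M *\<^sub>v ?u else U)) (ennreal p_test)"
      by (intro run_mono[OF loop[of \<sigma>1] order_refl]) auto
  qed
qed

text \<open>The trivial bound 1 for a list with wrong answers keeps the estimate total, so that
  correctness can stay out of the loop invariants.\<close>

lemma probe_run:
  assumes standing: "standing \<sigma>"
  shows "run E (probe Vc) \<sigma> t_probe
     (\<lambda>\<sigma>'. bdd B \<sigma>' \<and> same {3, 4, 5, 6, 7, 8, 9, 12, 21, 22} \<sigma> \<sigma>')
     (\<lambda>\<sigma>'. of_bool (if \<sigma>' 22 0 \<noteq> 0 then get_vec n 9 \<sigma>' \<noteq> M *\<^sub>v prefix x (\<sigma> 16 0)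
        else \<exists>j<\<sigma> 13 0. overlapping (\<sigma> 16 0) (\<sigma> 10 j))) (if answers_ok \<sigma> then ennreal p_test else 1)"
proof (cases "answers_ok \<sigma>")
  case True
  show ?thesis
  proof (cases "\<exists>j<\<sigma> 13 0. overlapping (\<sigma> 16 0) (\<sigma> 10 j)")
    case ex: True
    then obtain js where js: "js < \<sigma> 13 0" "overlapping (\<sigma> 16 0) (\<sigma> 10 js)" by blast
    have ex': "(\<exists>j<\<sigma> 13 0. overlapping (\<sigma> 16 0) (\<sigma> 10 j)) \<longleftrightarrow> True" using ex by simp
    show ?thesis
      unfolding ex' using probe_aux[OF standing, of True js] js True by (simp add: answers_ok_def)
  next
    case False
    then have ex': "(\<exists>j<\<sigma> 13 0. overlapping (\<sigma> 16 0) (\<sigma> 10 j)) \<longleftrightarrow> False" by simp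
    show ?thesis unfolding ex' using probe_aux[OF standing, of False 0] True by simp
  qed
next
  case False
  show ?thesis
    using run_bound[OF probe_aux[OF standing, of False 0]] False by simp
qed

end

section \<open>Binary search over prefix lengths\<close>

definition search_init :: com where
  "search_init = Seq (assign 14 (Const 0)) (Seq (Do (Fresh 2)) (assign 15 (Add (scalar 0) (Const 1))))"

definition search_test :: exp where
  "search_test = Sub (Sub (scalar 15) (scalar 14)) (Const 1)"

definition midpoint :: com where
  "midpoint = assign 16 (Div (Add (scalar 14) (scalar 15)) (Const 2))"

definition copy_body :: com where
  "copy_body = Do (Assign 2 (scalar 3) (Get 9 (scalar 3)))"

definition move :: com where
  "move = Cond (scalar 22) (Seq (assign 14 (scalar 16)) (for_dim 3 copy_body)) (assign 15 (scalar 16))"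

definition search :: "com \<Rightarrow> com" where
  "search Vc = Seq search_init (While search_test (Seq midpoint (Seq (probe Vc) move)))"

text \<open>Binary length with value 0 at 0, in contrast to \<open>bit_length\<close>. It drops by
  one at every halving, also in the step from 1 to 0, and therefore counts the steps of the
  search.\<close>

definition bl :: "nat \<Rightarrow> nat" where
  "bl m = (if m = 0 then 0 else bit_length m)"

lemma bl_half: "m > 0 \<Longrightarrow> bl (m div 2) + 1 = bl m"
  by (cases "m = 1") (auto simp: bl_def bit_length_def floor_log_rec[of m] simp del: floor_log_half)

lemma bl_mono: "m \<le> m' \<Longrightarrow> bl m \<le> bl m'"
  by (auto simp: bl_def bit_length_mono)

context reduction
begin

lemma copy_run:
  assumes b: "bdd B \<sigma>" and n0: "\<sigma> 0 0 = n"
  shows "run E (for_dim 3 copy_body) \<sigma> (n * (L * ccost copy_body + L * 28) + L * 20)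
     (\<lambda>\<sigma>'. bdd B \<sigma>' \<and> same {2, 3} \<sigma> \<sigma>' \<and> get_vec n 2 \<sigma>' = get_vec n 9 \<sigma>) (\<lambda>_. 0) 0"
proof -
  define I where "I i \<sigma>' \<longleftrightarrow> same {2, 3} \<sigma> \<sigma>' \<and> (\<forall>l<i. \<sigma>' 2 l = \<sigma> 9 l)" for i and \<sigma>' :: store
  have "run E (for_dim 3 copy_body) \<sigma> (n * (L * ccost copy_body + L * 28) + L * 20)
     (\<lambda>\<sigma>'. bdd B \<sigma>' \<and> \<sigma>' 3 0 = n \<and> \<sigma>' 0 0 = n \<and> I n \<sigma>') (\<lambda>_. 0) 0"
  proof (rule run_for_dim[where B = B and n = n and I = I and f = "\<lambda>_ _. 0", OF _ _ _ _ _ _ _ _ _ order_refl])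
    fix i \<sigma>1
    assume I: "I i \<sigma>1" and b: "bdd B \<sigma>1" and i3: "\<sigma>1 3 0 = i" and n0: "\<sigma>1 0 0 = n"
    have s: "same {2, 3} \<sigma> \<sigma>1" using I by (simp add: I_def)
    show "run E copy_body \<sigma>1 (L * ccost copy_body)
        (\<lambda>\<sigma>'. bdd B \<sigma>' \<and> \<sigma>' 3 0 = i \<and> \<sigma>' 0 0 = n \<and> I (Suc i) (put 3 0 (Suc i) \<sigma>')) (\<lambda>_. 0) 0"
    proof (rule run_straight[where B = B])
      show "det_bdd B copy_body \<sigma>1" using b by (simp add: copy_body_def bdd_def)
      show "bdd B (det copy_body \<sigma>1) \<and> det copy_body \<sigma>1 3 0 = i \<and> det copy_body \<sigma>1 0 0 = n \<and>
            I (Suc i) (put 3 0 (Suc i) (det copy_body \<sigma>1))" if "bdd B (det copy_body \<sigma>1)"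
        using that I i3 n0 s unfolding I_def
        by (auto simp: copy_body_def put_def same_def less_Suc_eq)
    qed (use b B_ge in \<open>simp_all add: copy_body_def\<close>)
  qed (use b n0 B_ge in \<open>auto simp: I_def same_def put_def\<close>)
  then show ?thesis
    by (rule run_mono) (auto simp: I_def get_vec_def intro!: eq_vecI)
qed

definition t_copy :: nat where
  "t_copy = n * (L * ccost copy_body + L * 28) + L * 20"

lemma move_run:
  assumes standing: "standing \<sigma>"
  shows "run E move \<sigma> (L * test_size (scalar 22) + (L * 7 + t_copy))
     (\<lambda>\<sigma>'. bdd B \<sigma>' \<and> same {2, 3, 14, 15} \<sigma> \<sigma>' \<and>
        (if \<sigma> 22 0 \<noteq> 0 then \<sigma>' 14 0 = \<sigma> 16 0 \<and> \<sigma>' 15 0 = \<sigma> 15 0 \<and> get_vec n 2 \<sigma>' = get_vec n 9 \<sigma>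
         else \<sigma>' 14 0 = \<sigma> 14 0 \<and> \<sigma>' 15 0 = \<sigma> 16 0 \<and> get_vec n 2 \<sigma>' = get_vec n 2 \<sigma>)) (\<lambda>_. 0) 0"
    (is "run E move \<sigma> _ ?Q _ _")
  unfolding move_def
proof (rule run_Cond)
  have b: "bdd B \<sigma>" "\<sigma> 0 0 = n" using standing by (simp_all add: standing_def)
  show "1 + val_cost \<sigma> (scalar 22) \<le> L * test_size (scalar 22)"
    by (rule test_cost) (use b B_ge in auto)
  {
    assume nz: "val \<sigma> (scalar 22) \<noteq> 0"
    show "run E (Seq (assign 14 (scalar 16)) (for_dim 3 copy_body)) \<sigma> (L * 7 + t_copy) ?Q (\<lambda>_. 0) 0"
    proof (rule run_Seq_sure)
      show "run E (assign 14 (scalar 16)) \<sigma> (L * 7) (\<lambda>\<sigma>1. bdd B \<sigma>1 \<and> \<sigma>1 = put 14 0 (\<sigma> 16 0) \<sigma>) (\<lambda>_. 0) 0"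
        by (rule run_straight[where B = B]) (use b B_ge in \<open>simp_all add: bdd_def power2_eq_square\<close>)
      fix \<sigma>1 assume *: "bdd B \<sigma>1 \<and> \<sigma>1 = put 14 0 (\<sigma> 16 0) \<sigma>"
      have "run E (for_dim 3 copy_body) \<sigma>1 t_copy
        (\<lambda>\<sigma>'. bdd B \<sigma>' \<and> same {2, 3} \<sigma>1 \<sigma>' \<and> get_vec n 2 \<sigma>' = get_vec n 9 \<sigma>1) (\<lambda>_. 0) 0"
        unfolding t_copy_def by (rule copy_run) (use * b in \<open>auto simp: put_def\<close>)
      then show "run E (for_dim 3 copy_body) \<sigma>1 t_copy ?Q (\<lambda>_. 0) 0"
        by (rule run_mono) (use * nz in \<open>auto simp: put_def same_def get_vec_def\<close>)
    qed
  next
    assume z: "val \<sigma> (scalar 22) = 0"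
    show "run E (assign 15 (scalar 16)) \<sigma> (L * 7 + t_copy) ?Q (\<lambda>_. 0) 0"
      by (rule run_straight[where B = B])
        (use b z B_ge in \<open>auto simp: bdd_def power2_eq_square put_def same_def get_vec_def\<close>)
  }
qed

definition t_search :: nat where
  "t_search = L * ccost search_init + (bit_length n * (L * test_size search_test +
     (L * ccost midpoint + (t_probe + (L * test_size (scalar 22) + (L * 7 + t_copy))))) + L * test_size search_test)"

text \<open>The upper end is either the initial \<open>n + 1\<close>, which is never probed, or a
  length that overlaps with no listed one. Nothing is claimed about lengths between the ends or
  beyond them, so no monotonicity is presupposed.\<close>

definition known :: "store \<Rightarrow> store \<Rightarrow> bool" where
  "known \<sigma> \<sigma>' \<longleftrightarrow> get_vec n 2 \<sigma>' = M *\<^sub>v prefix x (\<sigma>' 14 0) \<and>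
     (\<sigma>' 15 0 = n + 1 \<or> (\<forall>j<\<sigma> 13 0. \<not> overlapping (\<sigma>' 15 0) (\<sigma> 10 j)))"

lemma prefix_0: "prefix x 0 = 0\<^sub>v n"
  by (intro eq_vecI) (simp_all add: prefix_def)

lemma p_test_nonneg: "0 \<le> p_test"
proof -
  have "1 / (2 * real k ^ 2) \<le> 1"
    using mult_mono[of 1 "real k" 1 "real k"] k by (simp add: divide_le_eq_1 power2_eq_square)
  then show ?thesis by (simp add: p_test_def)
qed

text \<open>The potential \<open>p_test * \<beta>\<close> prepays one probe for each remaining
  halving. Either outcome of a sound probe preserves \<open>known\<close>: acceptance supplies a
  correct answer for the new lower end, rejection an upper end without overlaps.\<close>

lemma search_run:
  assumes standing: "standing \<sigma>" and p: "p_test * bit_length n \<le> 1"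
  shows "run E (search Vc) \<sigma> t_search
     (\<lambda>\<sigma>'. bdd B \<sigma>' \<and> same {2, 3, 4, 5, 6, 7, 8, 9, 12, 14, 15, 16, 21, 22} \<sigma> \<sigma>' \<and>
        \<sigma>' 15 0 = \<sigma>' 14 0 + 1 \<and> \<sigma>' 15 0 \<le> n + 1)
     (\<lambda>\<sigma>'. of_bool (\<not> (answers_ok \<sigma> \<and> known \<sigma> \<sigma>'))) (if answers_ok \<sigma> then ennreal (p_test * bit_length n) else 1)"
proof -
  let ?S = "{2, 3, 4, 5, 6, 7, 8, 9, 12, 14, 15, 16, 21, 22} :: nat set"
  define \<beta> where "\<beta> \<sigma>' = bl (\<sigma>' 15 0 - \<sigma>' 14 0 - 1)" for \<sigma>' :: store
  define I where "I \<sigma>' \<longleftrightarrow> bdd B \<sigma>' \<and> same ?S \<sigma> \<sigma>' \<and> \<sigma>' 14 0 < \<sigma>' 15 0 \<and> \<sigma>' 15 0 \<le> n + 1" for \<sigma>'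
  define f where "f \<sigma>' = (if answers_ok \<sigma> \<and> known \<sigma> \<sigma>' then ennreal (p_test * \<beta> \<sigma>') else 1)" for \<sigma>'
  let ?t = "L * ccost midpoint + (t_probe + (L * test_size (scalar 22) + (L * 7 + t_copy)))"
  have \<beta>: "\<beta> \<sigma>' \<le> bit_length n" if "I \<sigma>'" for \<sigma>'
  proof -
    have "\<beta> \<sigma>' \<le> bl n" unfolding \<beta>_def using that by (intro bl_mono) (auto simp: I_def)
    then show ?thesis using dim by (simp add: bl_def)
  qed
  have step: "run E (Seq midpoint (Seq (probe Vc) move)) \<sigma>1 ?t (\<lambda>\<sigma>'. I \<sigma>' \<and> \<beta> \<sigma>' < \<beta> \<sigma>1) f (f \<sigma>1)"
    if I: "I \<sigma>1" and t: "val \<sigma>1 search_test \<noteq> 0" for \<sigma>1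
  proof -
    have s1: "same ?S \<sigma> \<sigma>1" using I by (simp add: I_def)
    have SI1: "standing \<sigma>1" by (rule standing_same[OF standing s1]) (use I in \<open>auto simp: I_def\<close>)
    define lo where "lo = \<sigma>1 14 0"
    define hi where "hi = \<sigma>1 15 0"
    define mid where "mid = (lo + hi) div 2"
    have gap: "lo + 1 < hi" "hi \<le> n + 1" using t I by (auto simp: search_test_def I_def lo_def hi_def)
    then have mid: "lo < mid" "mid < hi" by (auto simp: mid_def)
    have half: "bl (mid - lo - 1) + 1 \<le> \<beta> \<sigma>1" "bl (hi - mid - 1) + 1 \<le> \<beta> \<sigma>1"
    proof -
      \<comment> \<open>The measure counts the lengths strictly between the ends; removing the
        midpoint leaves at most half of them on either side.\<close>
      have "bl (mid - lo - 1) \<le> bl ((hi - lo - 1) div 2)" "bl (hi - mid - 1) \<le> bl ((hi - lo - 1) div 2)"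
        using gap unfolding mid_def by (intro bl_mono; linarith)+
      then show "bl (mid - lo - 1) + 1 \<le> \<beta> \<sigma>1" "bl (hi - mid - 1) + 1 \<le> \<beta> \<sigma>1"
        using bl_half[of "hi - lo - 1"] gap by (simp_all add: \<beta>_def lo_def hi_def)
    qed
    define \<sigma>2 where "\<sigma>2 = put 16 0 mid \<sigma>1"
    have first: "run E midpoint \<sigma>1 (L * ccost midpoint) (\<lambda>\<sigma>'. bdd B \<sigma>' \<and> \<sigma>' = \<sigma>2) (\<lambda>_. 0) 0"
      by (rule run_straight[where B = B])
        (use SI1 B_ge gap mid in \<open>auto simp: midpoint_def standing_def \<sigma>2_def mid_def lo_def hi_def\<close>)
    have second: "run E (Seq (probe Vc) move) \<sigma>2 (t_probe + (L * test_size (scalar 22) + (L * 7 + t_copy)))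
        (\<lambda>\<sigma>'. I \<sigma>' \<and> \<beta> \<sigma>' < \<beta> \<sigma>1) f (f \<sigma>1)" if b2: "bdd B \<sigma>2"
    proof -
      have s2: "same ?S \<sigma> \<sigma>2" using s1 by (auto simp: \<sigma>2_def same_def put_def)
      have SI2: "standing \<sigma>2" by (rule standing_same[OF standing s2 b2]) simp
      have list2: "answers_ok \<sigma>2 = answers_ok \<sigma>" "\<sigma>2 13 0 = \<sigma> 13 0" "\<sigma>2 10 = \<sigma> 10"
        by (simp_all add: answers_ok_def answer_def sameD[OF s2])
      have m2: "\<sigma>2 16 0 = mid" "\<sigma>2 14 0 = lo" "\<sigma>2 15 0 = hi" by (simp_all add: \<sigma>2_def put_def lo_def hi_def)
      let ?bad = "\<lambda>\<sigma>3. if \<sigma>3 22 0 \<noteq> 0 then get_vec n 9 \<sigma>3 \<noteq> M *\<^sub>v prefix x mid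
          else \<exists>j<\<sigma> 13 0. overlapping mid (\<sigma> 10 j)"
      let ?P = "\<lambda>\<sigma>3. bdd B \<sigma>3 \<and> same {3, 4, 5, 6, 7, 8, 9, 12, 21, 22} \<sigma>2 \<sigma>3"
      have probe: "run E (probe Vc) \<sigma>2 t_probe ?P
          (\<lambda>\<sigma>3. of_bool (?bad \<sigma>3)) (if answers_ok \<sigma> then ennreal p_test else 1)"
        using probe_run[OF SI2] unfolding list2 m2 .
      \<comment> \<open>One of the prepaid probes is spent here, and a bad one forfeits the whole
        potential.\<close>
      define F where "F \<sigma>3 = (if answers_ok \<sigma> \<and> known \<sigma> \<sigma>2 \<and> \<not> ?bad \<sigma>3 then ennreal (p_test * (real (\<beta> \<sigma>1) - 1)) else 1)" for \<sigma>3
      have known2: "known \<sigma> \<sigma>2 = known \<sigma> \<sigma>1"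
        by (simp add: known_def \<sigma>2_def put_def get_vec_def)
      have \<beta>1: "real (\<beta> \<sigma>1) \<ge> 1" using half by simp
      have probe': "run E (probe Vc) \<sigma>2 t_probe ?P F (f \<sigma>1)"
      proof (cases "answers_ok \<sigma> \<and> known \<sigma> \<sigma>1")
        case True
        have "run E (probe Vc) \<sigma>2 t_probe ?P F (ennreal (p_test * (real (\<beta> \<sigma>1) - 1)) + ennreal p_test)"
          using True probe by (intro run_add[where g = "\<lambda>\<sigma>3. of_bool (?bad \<sigma>3)"]) (auto simp: F_def known2)
        also have "ennreal (p_test * (real (\<beta> \<sigma>1) - 1)) + ennreal p_test = f \<sigma>1"
          using True mult_right_mono[OF \<beta>1 p_test_nonneg] p_test_nonneg
          by (subst ennreal_plus[symmetric]) (auto simp: f_def algebra_simps)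
        finally show ?thesis .
      next
        case False
        then show ?thesis by (intro run_bound[OF probe]) (auto simp: F_def f_def known2)
      qed
      show ?thesis
      proof (rule run_Seq[OF probe'])
        fix \<sigma>3 assume P: "?P \<sigma>3"
        then have s23: "same {3, 4, 5, 6, 7, 8, 9, 12, 21, 22} \<sigma>2 \<sigma>3" and b3: "bdd B \<sigma>3" by auto
        have s3: "same ?S \<sigma> \<sigma>3" by (rule same_trans[OF s2 s23]) auto
        have SI3: "standing \<sigma>3" by (rule standing_same[OF standing s3 b3]) simp
        have m3: "\<sigma>3 16 0 = mid" "\<sigma>3 14 0 = lo" "\<sigma>3 15 0 = hi" "get_vec n 2 \<sigma>3 = get_vec n 2 \<sigma>2"
          by (simp_all add: sameD[OF s23] m2 get_vec_def)
        show "run E move \<sigma>3 (L * test_size (scalar 22) + (L * 7 + t_copy)) (\<lambda>\<sigma>'. I \<sigma>' \<and> \<beta> \<sigma>' < \<beta> \<sigma>1) f (F \<sigma>3)"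
        proof (rule run_mono[OF run_bound[OF move_run[OF SI3], of f "F \<sigma>3"]])
          fix \<sigma>4
          assume Q: "bdd B \<sigma>4 \<and> same {2, 3, 14, 15} \<sigma>3 \<sigma>4 \<and>
            (if \<sigma>3 22 0 \<noteq> 0 then \<sigma>4 14 0 = \<sigma>3 16 0 \<and> \<sigma>4 15 0 = \<sigma>3 15 0 \<and> get_vec n 2 \<sigma>4 = get_vec n 9 \<sigma>3
             else \<sigma>4 14 0 = \<sigma>3 14 0 \<and> \<sigma>4 15 0 = \<sigma>3 16 0 \<and> get_vec n 2 \<sigma>4 = get_vec n 2 \<sigma>3)"
          have s4: "same ?S \<sigma> \<sigma>4" by (rule same_trans[OF s3, of "{2, 3, 14, 15}"]) (use Q in auto)
          have \<beta>4: "\<beta> \<sigma>4 + 1 \<le> \<beta> \<sigma>1" unfolding \<beta>_def[of \<sigma>4] using Q m3 half by (auto split: if_splits)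
          show I4: "I \<sigma>4 \<and> \<beta> \<sigma>4 < \<beta> \<sigma>1"
            using Q s4 m3 mid gap \<beta>4 by (auto simp: I_def split: if_splits)
          \<comment> \<open>The trivial bound after a failure has to dominate the potential; this is
            where \<open>p_test * bit_length n\<close> being at most 1 enters.\<close>
          have "f \<sigma>4 \<le> 1"
          proof -
            have "p_test * \<beta> \<sigma>4 \<le> p_test * bit_length n"
              using \<beta>[of \<sigma>4] I4 p_test_nonneg by (intro mult_left_mono) auto
            then have "ennreal (p_test * \<beta> \<sigma>4) \<le> ennreal 1" using p by (intro ennreal_leI) linarith
            then show ?thesis by (simp add: f_def)
          qed
          moreover have "f \<sigma>4 \<le> ennreal (p_test * (real (\<beta> \<sigma>1) - 1))"
            if "answers_ok \<sigma>" "known \<sigma> \<sigma>2" "\<not> ?bad \<sigma>3"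
          proof -
            have "known \<sigma> \<sigma>4" using that Q m3 m2 by (auto simp: known_def split: if_splits)
            moreover have "p_test * \<beta> \<sigma>4 \<le> p_test * (real (\<beta> \<sigma>1) - 1)"
              using \<beta>4 p_test_nonneg by (intro mult_left_mono) auto
            ultimately show ?thesis using that by (auto simp: f_def intro!: ennreal_leI)
          qed
          ultimately show "f \<sigma>4 \<le> F \<sigma>3" by (simp add: F_def)
        qed auto
      qed
    qed
    show ?thesis by (rule run_Seq_sure[OF first]) (use second in auto)
  qed
  have cost: "1 + val_cost \<sigma>1 search_test \<le> L * test_size search_test" if "I \<sigma>1" for \<sigma>1
    by (rule test_cost) (use that B_ge in \<open>simp_all add: I_def search_test_def\<close>)
  show ?thesis
    unfolding search_def t_search_def
  proof (rule run_Seq)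
    let ?b = "if answers_ok \<sigma> then ennreal (p_test * bit_length n) else 1"
    show "run E search_init \<sigma> (L * ccost search_init) (\<lambda>\<sigma>1. I \<sigma>1 \<and> f \<sigma>1 \<le> ?b) (\<lambda>_. ?b) ?b"
    proof (rule run_straight[where B = B])
      let ?\<sigma> = "det search_init \<sigma>"
      have n0: "\<sigma> 0 0 = n" using standing by (simp add: standing_def)
      have v: "?\<sigma> 14 0 = 0" "?\<sigma> 15 0 = n + 1" "?\<sigma> 2 = (\<lambda>_. 0)"
        using n0 by (simp_all add: search_init_def put_def)
      have "get_vec n 2 ?\<sigma> = M *\<^sub>v prefix x (?\<sigma> 14 0)"
        using M(1) by (auto simp: v prefix_0 get_vec_def intro!: eq_vecI)
      then have "known \<sigma> ?\<sigma>" using v by (simp add: known_def)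
      moreover have "\<beta> ?\<sigma> = bit_length n" using v dim by (simp add: \<beta>_def bl_def)
      moreover assume "bdd B ?\<sigma>"
      ultimately show "I ?\<sigma> \<and> f ?\<sigma> \<le> ?b"
        using v n0 by (auto simp: I_def f_def same_def search_init_def put_def)
    qed (use standing B_ge in \<open>simp_all add: search_init_def standing_def put_def\<close>)
    fix \<sigma>1 assume I1: "I \<sigma>1 \<and> f \<sigma>1 \<le> ?b"
    show "run E (While search_test (Seq midpoint (Seq (probe Vc) move))) \<sigma>1
       (bit_length n * (L * test_size search_test + ?t) + L * test_size search_test)
       (\<lambda>\<sigma>'. bdd B \<sigma>' \<and> same ?S \<sigma> \<sigma>' \<and> \<sigma>' 15 0 = \<sigma>' 14 0 + 1 \<and> \<sigma>' 15 0 \<le> n + 1)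
       (\<lambda>\<sigma>'. of_bool (\<not> (answers_ok \<sigma> \<and> known \<sigma> \<sigma>'))) ?b"
    proof (rule run_mono[OF run_While[where I = I and v = \<beta> and f = f and \<sigma> = \<sigma>1, OF step cost]])
      show "I \<sigma>1" "f \<sigma>1 \<le> ?b" using I1 by auto
      show "\<beta> \<sigma>1 * (L * test_size search_test + ?t) + L * test_size search_test
        \<le> bit_length n * (L * test_size search_test + ?t) + L * test_size search_test"
        using \<beta>[of \<sigma>1] I1 by (intro add_right_mono mult_le_mono1) auto
    qed (auto simp: I_def search_test_def f_def)
  qed
qed

end

section \<open>Extending the list by one coordinate\<close>

definition append_store :: com where
  "append_store =
     (Seq (Do (Assign 2 (scalar 3) (parity_exp (Add (Get 2 (scalar 3)) (Mul (scalar 17) (Get 1 (scalar 14)))))))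
       (Do (Assign 11 (Add (Mul (scalar 13) (scalar 0)) (scalar 3)) (Get 2 (scalar 3)))))"

definition append_tail :: com where
  "append_tail = Seq (Do (Assign 10 (scalar 13) (scalar 15))) (assign 13 (Add (scalar 13) (Const 1)))"

definition advance :: "com \<Rightarrow> com \<Rightarrow> com" where
  "advance Vc Rc = Seq (search Vc) (Seq (for_dim 3 (Seq Rc append_store)) append_tail)"

definition count_bits :: com where
  "count_bits = Seq (assign 24 (scalar 0)) (While (scalar 24)
     (Seq (assign 24 (Div (scalar 24) (Const 2))) (assign 23 (Add (scalar 23) (Const 1)))))"

definition set_params :: com where
  "set_params = Seq (assign 20 (Add (Mul (Const 2) (Get 0 (Const 1))) (Const 1)))
     (Seq (assign 19 (Mul (Mul (Const 24) (Mul (Mul (Get 0 (Const 1)) (Get 0 (Const 1))) (Get 0 (Const 1)))) (scalar 23)))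
     (Seq (assign 18 (Mul (Mul (Mul (Mul (Const 12) (Get 0 (Const 1))) (scalar 23)) (scalar 19)) (scalar 20)))
       (assign 13 (Const 1))))"

definition advance_test :: exp where
  "advance_test = Mul (Sub (Add (scalar 0) (Const 1)) (scalar 15)) (Sub (scalar 20) (scalar 13))"

definition reduce :: "com \<Rightarrow> com \<Rightarrow> com" where
  "reduce Vc Rc = Seq count_bits (Seq set_params (While advance_test (advance Vc Rc)))"

context reduction
begin

text \<open>The case \<open>lo = n\<close> is included so that the sentinel length needs no special
  treatment: entries and cells outside the range count as 0, and extending the full vector changes
  nothing.\<close>

lemma prefix_Suc:
  assumes "lo \<le> n" "l < n"
  shows "(M *\<^sub>v prefix x (Suc lo)) $ l = (M *\<^sub>v prefix x lo) $ l + entry E l lo * of_nat (x_cells lo)"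
proof -
  have Ml: "(M *\<^sub>v prefix x m) $ l = (\<Sum>i<n. M $$ (l, i) * (if i < m then x $ i else 0))" for m
    using M(1) assms(2) by (simp add: scalar_prod_def prefix_def atLeast0LessThan)
  show ?thesis
  proof (cases "lo < n")
    case True
    have "(\<Sum>i<n. M $$ (l, i) * (if i < Suc lo then x $ i else 0))
        = (\<Sum>i<n. M $$ (l, i) * (if i < lo then x $ i else 0) + (if i = lo then M $$ (l, lo) * x $ lo else 0))"
      by (intro sum.cong) (auto simp: less_Suc_eq simp del: add_bit_eq_xor)
    also have "\<dots> = (\<Sum>i<n. M $$ (l, i) * (if i < lo then x $ i else 0)) + M $$ (l, lo) * x $ lo"
      using True by (simp add: sum.distrib del: add_bit_eq_xor)
    finally show ?thesis
      unfolding Ml using True assms by (simp add: entry_def dim M(2) x_cells_def del: add_bit_eq_xor)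
  next
    case False
    then have "(\<Sum>i<n. M $$ (l, i) * (if i < Suc lo then x $ i else 0)) = (\<Sum>i<n. M $$ (l, i) * (if i < lo then x $ i else 0))"
      by (intro sum.cong) auto
    then show ?thesis unfolding Ml using False by (simp add: x_cells_def)
  qed
qed

definition t_append :: nat where
  "t_append = n * ((tr + L * ccost append_store) + L * 28) + L * 20"

lemma append_run:
  assumes standing: "standing \<sigma>" and lo: "\<sigma> 14 0 \<le> n"
  shows "run E (for_dim 3 (Seq Rc append_store)) \<sigma> t_append
     (\<lambda>\<sigma>'. bdd B \<sigma>' \<and> same {2, 3, 11, 17} \<sigma> \<sigma>' \<and> (\<forall>j<\<sigma> 13 0. answer n \<sigma>' j = answer n \<sigma> j) \<and>
        answer n \<sigma>' (\<sigma> 13 0) = get_vec n 2 \<sigma>' \<and>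
        (get_vec n 2 \<sigma> = M *\<^sub>v prefix x (\<sigma> 14 0) \<longrightarrow> get_vec n 2 \<sigma>' = M *\<^sub>v prefix x (Suc (\<sigma> 14 0)))) (\<lambda>_. 0) 0"
proof -
  define J where "J = \<sigma> 13 0"
  define e where "e l = \<sigma> 2 l + bit_nat (entry E l (\<sigma> 14 0)) * x_cells (\<sigma> 14 0)" for l
  \<comment> \<open>Array 2 is updated in place, so its coordinates from \<open>i\<close> on must
    still carry the old answer.\<close>
  define I where "I i \<sigma>' \<longleftrightarrow> same {2, 3, 11, 17} \<sigma> \<sigma>' \<and>
     (\<forall>l<i. \<sigma>' 2 l = e l mod 2 \<and> \<sigma>' 11 (J * n + l) = e l mod 2) \<and> (\<forall>l\<ge>i. \<sigma>' 2 l = \<sigma> 2 l) \<and> (\<forall>a<J*n. \<sigma>' 11 a = \<sigma> 11 a)"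
    for i and \<sigma>' :: store
  have "run E (for_dim 3 (Seq Rc append_store)) \<sigma> t_append
     (\<lambda>\<sigma>'. bdd B \<sigma>' \<and> \<sigma>' 3 0 = n \<and> \<sigma>' 0 0 = n \<and> I n \<sigma>') (\<lambda>_. 0) 0"
    unfolding t_append_def
  proof (rule run_for_dim[where B = B and n = n and I = I and f = "\<lambda>_ _. 0", OF _ _ _ _ _ _ _ _ _ order_refl])
    fix i \<sigma>1
    assume i: "i < n" and I: "I i \<sigma>1" and b: "bdd B \<sigma>1" and i3: "\<sigma>1 3 0 = i" and n0: "\<sigma>1 0 0 = n"
    have s1: "same {2, 3, 11, 17} \<sigma> \<sigma>1" using I by (simp add: I_def)
    have v1: "\<sigma>1 14 = \<sigma> 14" "\<sigma>1 1 = x_cells" "\<sigma>1 13 0 = J" using standing by (simp_all add: sameD[OF s1] standing_def J_def)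
    show "run E (Seq Rc append_store) \<sigma>1 (tr + L * ccost append_store)
        (\<lambda>\<sigma>'. bdd B \<sigma>' \<and> \<sigma>' 3 0 = i \<and> \<sigma>' 0 0 = n \<and> I (Suc i) (put 3 0 (Suc i) \<sigma>')) (\<lambda>_. 0) 0"
    proof (rule run_Seq_sure[OF reader])
      show "\<sigma>1 0 0 = n" "\<sigma>1 3 0 < n" "\<sigma>1 14 0 \<le> n" "bdd B \<sigma>1" using b i i3 n0 lo v1 by auto
      fix \<sigma>2 assume *: "bdd B \<sigma>2 \<and> same {17} \<sigma>1 \<sigma>2 \<and> \<sigma>2 17 0 = bit_nat (entry E (\<sigma>1 3 0) (\<sigma>1 14 0))"
      then have s2: "same {17} \<sigma>1 \<sigma>2" and b2: "bdd B \<sigma>2" by auto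
      have v2: "\<sigma>2 3 0 = i" "\<sigma>2 0 0 = n" "\<sigma>2 13 0 = J" "\<sigma>2 2 i = \<sigma> 2 i" "\<sigma>2 14 0 = \<sigma> 14 0" "\<sigma>2 1 = x_cells"
        "\<sigma>2 17 0 = bit_nat (entry E i (\<sigma> 14 0))"
        using I * i3 n0 v1 by (simp_all add: sameD[OF s2] I_def)
      have det: "det append_store \<sigma>2 = put 11 (J * n + i) (e i mod 2) (put 2 i (e i mod 2) \<sigma>2)"
        unfolding append_store_def det.simps val_parity
        by (simp add: v2 v2(6)[unfolded One_nat_def] put_def e_def)
      have "e i mod 2 < 2" by simp
      then have m2: "e i mod 2 \<le> B" using B_ge by linarith
      show "run E append_store \<sigma>2 (L * ccost append_store)
        (\<lambda>\<sigma>'. bdd B \<sigma>' \<and> \<sigma>' 3 0 = i \<and> \<sigma>' 0 0 = n \<and> I (Suc i) (put 3 0 (Suc i) \<sigma>')) (\<lambda>_. 0) 0"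
      proof (rule run_straight[where B = B])
        have "det_bdd B append_store \<sigma>2 \<longleftrightarrow> e i mod 2 \<le> B"
          unfolding append_store_def det_bdd.simps det.simps val_parity
          by (simp add: v2 v2(6)[unfolded One_nat_def] put_def e_def)
        then show "det_bdd B append_store \<sigma>2" using m2 by simp
        have "same {2, 3, 11, 17} \<sigma> \<sigma>2" by (rule same_trans[OF s1 s2]) auto
        moreover have "\<sigma>2 2 = \<sigma>1 2" "\<sigma>2 11 = \<sigma>1 11" by (simp_all add: sameD[OF s2])
        ultimately show "bdd B (det append_store \<sigma>2) \<and> det append_store \<sigma>2 3 0 = i \<and> det append_store \<sigma>2 0 0 = n \<and>
            I (Suc i) (put 3 0 (Suc i) (det append_store \<sigma>2))" if "bdd B (det append_store \<sigma>2)"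
          using that I v2 unfolding det I_def
          by (auto simp: put_def same_def less_Suc_eq)
      qed (use b2 B_ge in \<open>simp_all add: append_store_def\<close>)
    qed
  qed (use standing B_ge in \<open>auto simp: I_def standing_def same_def put_def J_def\<close>)
  then show ?thesis
  proof (rule run_mono)
    fix \<sigma>' assume *: "bdd B \<sigma>' \<and> \<sigma>' 3 0 = n \<and> \<sigma>' 0 0 = n \<and> I n \<sigma>'"
    have "answer n \<sigma>' j = answer n \<sigma> j" if "j < J" for j
    proof -
      have "j * n + l < J * n" if "l < n" for l
      proof -
        have "j * n + l < Suc j * n" using that by simp
        also have "\<dots> \<le> J * n" using \<open>j < J\<close> by (intro mult_le_mono1) simp
        finally show ?thesis .
      qed
      then show ?thesis using * by (auto simp: answer_def I_def intro!: eq_vecI)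
    qed
    moreover have "answer n \<sigma>' J = get_vec n 2 \<sigma>'"
      using * by (auto simp: answer_def get_vec_def I_def intro!: eq_vecI)
    moreover have "get_vec n 2 \<sigma>' = M *\<^sub>v prefix x (Suc (\<sigma> 14 0))" if k: "get_vec n 2 \<sigma> = M *\<^sub>v prefix x (\<sigma> 14 0)"
    proof (rule eq_vecI)
      fix l assume "l < dim_vec (M *\<^sub>v prefix x (Suc (\<sigma> 14 0)))"
      then have l: "l < n" using M(1) by simp
      have "get_vec n 2 \<sigma>' $ l = of_nat (e l mod 2)" using * l by (simp add: get_vec_def I_def)
      also have "\<dots> = of_nat (e l)" by (rule of_nat_mod_2_bit)
      also have "\<dots> = of_nat (\<sigma> 2 l) + entry E l (\<sigma> 14 0) * of_nat (x_cells (\<sigma> 14 0))"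
        by (simp add: e_def del: add_bit_eq_xor)
      also have "of_nat (\<sigma> 2 l) = get_vec n 2 \<sigma> $ l" using l by (simp add: get_vec_def)
      finally show "get_vec n 2 \<sigma>' $ l = (M *\<^sub>v prefix x (Suc (\<sigma> 14 0))) $ l"
        unfolding prefix_Suc[OF lo l] k .
    qed (use M(1) in \<open>simp add: get_vec_def\<close>)
    ultimately show "bdd B \<sigma>' \<and> same {2, 3, 11, 17} \<sigma> \<sigma>' \<and> (\<forall>j<\<sigma> 13 0. answer n \<sigma>' j = answer n \<sigma> j) \<and>
        answer n \<sigma>' (\<sigma> 13 0) = get_vec n 2 \<sigma>' \<and>
        (get_vec n 2 \<sigma> = M *\<^sub>v prefix x (\<sigma> 14 0) \<longrightarrow> get_vec n 2 \<sigma>' = M *\<^sub>v prefix x (Suc (\<sigma> 14 0)))"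
      using * by (simp add: I_def J_def)
  qed simp_all
qed

text \<open>The length \<open>n + 1\<close> marks the end of the computation. Before that,
  separation is stated for ordered pairs, each prefix against its predecessors, because this is what
  a failed probe delivers and what \<open>few_separated_translates\<close> consumes.\<close>

definition good :: "store \<Rightarrow> bool" where
  "good \<sigma> \<longleftrightarrow> answers_ok \<sigma> \<and> (if \<sigma> 15 0 = n + 1 then get_vec n 2 \<sigma> = M *\<^sub>v x
     else \<forall>i j. i < j \<longrightarrow> j < \<sigma> 13 0 \<longrightarrow> \<not> overlapping (\<sigma> 10 j) (\<sigma> 10 i))"

definition t_advance :: nat where
  "t_advance = t_search + (t_append + L * ccost append_tail)"

lemma prefix_full: "prefix x (n + 1) = x"
  by (intro eq_vecI) (simp_all add: prefix_def)

lemma advance_run: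
  assumes standing: "standing \<sigma>" and p: "p_test * bit_length n \<le> 1" and J: "\<sigma> 13 0 < D" and hi: "\<sigma> 15 0 \<noteq> n + 1"
  shows "run E (advance Vc Rc) \<sigma> t_advance (\<lambda>\<sigma>'. standing \<sigma>' \<and> \<sigma>' 13 0 = Suc (\<sigma> 13 0) \<and> \<sigma>' 15 0 \<le> n + 1)
     (\<lambda>\<sigma>'. of_bool (\<not> good \<sigma>')) (if good \<sigma> then ennreal (p_test * bit_length n) else 1)"
proof -
  let ?S = "{2, 3, 4, 5, 6, 7, 8, 9, 12, 14, 15, 16, 21, 22} :: nat set"
  \<comment> \<open>Charging only the loss of \<open>good\<close> reduces the failure of a round to
    that of its search, since the extension by a column is deterministic. A state that is not
    \<open>good\<close> is treated separately by the trivial bound.\<close>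
  have "run E (advance Vc Rc) \<sigma> t_advance (\<lambda>\<sigma>'. standing \<sigma>' \<and> \<sigma>' 13 0 = Suc (\<sigma> 13 0) \<and> \<sigma>' 15 0 \<le> n + 1)
     (\<lambda>\<sigma>'. of_bool (good \<sigma> \<and> \<not> good \<sigma>')) (if answers_ok \<sigma> then ennreal (p_test * bit_length n) else 1)"
    unfolding advance_def t_advance_def
  proof (rule run_Seq[OF search_run[OF standing p]])
    fix \<sigma>1
    assume *: "bdd B \<sigma>1 \<and> same ?S \<sigma> \<sigma>1 \<and> \<sigma>1 15 0 = \<sigma>1 14 0 + 1 \<and> \<sigma>1 15 0 \<le> n + 1"
    then have s1: "same ?S \<sigma> \<sigma>1" by simp
    have SI1: "standing \<sigma>1" by (rule standing_same[OF standing s1]) (use * in auto)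
    have v1: "\<sigma>1 13 = \<sigma> 13" "\<sigma>1 10 = \<sigma> 10" "\<sigma>1 11 = \<sigma> 11" by (simp_all add: sameD[OF s1])
    have lo: "\<sigma>1 14 0 \<le> n" using * by auto
    show "run E (Seq (for_dim 3 (Seq Rc append_store)) append_tail) \<sigma>1 (t_append + L * ccost append_tail)
        (\<lambda>\<sigma>'. standing \<sigma>' \<and> \<sigma>' 13 0 = Suc (\<sigma> 13 0) \<and> \<sigma>' 15 0 \<le> n + 1)
        (\<lambda>\<sigma>'. of_bool (good \<sigma> \<and> \<not> good \<sigma>')) (of_bool (\<not> (answers_ok \<sigma> \<and> known \<sigma> \<sigma>1)))"
    proof (rule run_Seq_sure[OF append_run[OF SI1 lo]])
      fix \<sigma>2
      assume Q: "bdd B \<sigma>2 \<and> same {2, 3, 11, 17} \<sigma>1 \<sigma>2 \<and> (\<forall>j<\<sigma>1 13 0. answer n \<sigma>2 j = answer n \<sigma>1 j) \<and>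
        answer n \<sigma>2 (\<sigma>1 13 0) = get_vec n 2 \<sigma>2 \<and>
        (get_vec n 2 \<sigma>1 = M *\<^sub>v prefix x (\<sigma>1 14 0) \<longrightarrow> get_vec n 2 \<sigma>2 = M *\<^sub>v prefix x (Suc (\<sigma>1 14 0)))"
      then have s2: "same {2, 3, 11, 17} \<sigma>1 \<sigma>2" and b2: "bdd B \<sigma>2" by auto
      have SI2: "standing \<sigma>2" by (rule standing_same[OF SI1 s2 b2]) simp
      have v2: "\<sigma>2 13 = \<sigma> 13" "\<sigma>2 10 = \<sigma> 10" "\<sigma>2 15 = \<sigma>1 15" by (simp_all add: sameD[OF s2] v1)
      have ans: "answer n \<sigma>2 j = answer n \<sigma> j" if "j < \<sigma> 13 0" for j
        using Q that by (simp add: v1 answer_def)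
      define \<sigma>3 where "\<sigma>3 = put 13 0 (Suc (\<sigma> 13 0)) (put 10 (\<sigma> 13 0) (\<sigma>1 15 0) \<sigma>2)"
      have det: "det append_tail \<sigma>2 = \<sigma>3"
        by (simp add: append_tail_def \<sigma>3_def put_def v2)
      have good3: "good \<sigma>3" if good: "good \<sigma>" and known: "known \<sigma> \<sigma>1"
      proof -
        have v3: "\<sigma>3 13 0 = Suc (\<sigma> 13 0)" "\<sigma>3 15 0 = \<sigma>1 15 0" "get_vec n 2 \<sigma>3 = get_vec n 2 \<sigma>2"
          "\<And>j. answer n \<sigma>3 j = answer n \<sigma>2 j" "\<And>j. \<sigma>3 10 j = (if j = \<sigma> 13 0 then \<sigma>1 15 0 else \<sigma> 10 j)"
          by (simp_all add: \<sigma>3_def put_def v2 get_vec_def answer_def)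
        have cur: "get_vec n 2 \<sigma>2 = M *\<^sub>v prefix x (\<sigma>1 15 0)"
          using known Q * by (simp add: known_def)
        have "answer n \<sigma>2 (\<sigma> 13 0) = M *\<^sub>v prefix x (\<sigma>1 15 0)"
          using Q cur by (simp add: v1)
        then have "answers_ok \<sigma>3"
          using good ans by (auto simp: answers_ok_def good_def v3 less_Suc_eq)
        moreover have "get_vec n 2 \<sigma>3 = M *\<^sub>v x" if "\<sigma>3 15 0 = n + 1"
          using that cur prefix_full by (simp add: v3)
        moreover have "\<not> overlapping (\<sigma>3 10 j) (\<sigma>3 10 i)" if "\<sigma>3 15 0 \<noteq> n + 1" "i < j" "j < \<sigma>3 13 0" for i j
          using that good known hi unfolding v3 by (auto simp: good_def known_def less_Suc_eq)
        ultimately show ?thesis by (auto simp: good_def)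
      qed
      show "run E append_tail \<sigma>2 (L * ccost append_tail)
        (\<lambda>\<sigma>'. standing \<sigma>' \<and> \<sigma>' 13 0 = Suc (\<sigma> 13 0) \<and> \<sigma>' 15 0 \<le> n + 1)
        (\<lambda>\<sigma>'. of_bool (good \<sigma> \<and> \<not> good \<sigma>')) (of_bool (\<not> (answers_ok \<sigma> \<and> known \<sigma> \<sigma>1)))"
      proof (rule run_straight[where B = B], unfold det)
        have "\<sigma>1 15 0 \<le> B" "Suc (\<sigma> 13 0) \<le> B" using * J B_ge by auto
        then show "det_bdd B append_tail \<sigma>2" by (simp add: append_tail_def put_def v2)
        show "standing \<sigma>3 \<and> \<sigma>3 13 0 = Suc (\<sigma> 13 0) \<and> \<sigma>3 15 0 \<le> n + 1" if "bdd B \<sigma>3"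
          using that SI2 J * by (auto simp: standing_def \<sigma>3_def put_def v2)
        show "of_bool (good \<sigma> \<and> \<not> good \<sigma>3) \<le> (of_bool (\<not> (answers_ok \<sigma> \<and> known \<sigma> \<sigma>1)) :: ennreal)"
          using good3 by (auto simp: good_def)
      qed (use b2 B_ge in \<open>simp_all add: append_tail_def\<close>)
    qed
  qed
  then show ?thesis
  proof (cases "good \<sigma>")
    case True
    then have "answers_ok \<sigma>" by (simp add: good_def)
    with True \<open>run E (advance Vc Rc) \<sigma> _ _ _ _\<close> show ?thesis by simp
  next
    case False
    show ?thesis
      using run_bound[OF \<open>run E (advance Vc Rc) \<sigma> _ _ _ _\<close>, of "\<lambda>\<sigma>'. of_bool (\<not> good \<sigma>')" 1] False by simp
  qed
qed

section \<open>Parameters and the failure budget\<close>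

definition t_count :: nat where
  "t_count = L * 13 + (bit_length n * (L * test_size (scalar 24) + L * 50) + L * test_size (scalar 24))"

lemma bit_length_le_B: "bit_length n \<le> B"
proof -
  have "bit_length n = 1 * 1 * bit_length n * 1 * 1" by simp
  also have "\<dots> \<le> 12 * k * bit_length n * N * D"
    using k params(1) D by (intro mult_le_mono) auto
  also have "\<dots> \<le> einv" by (rule params(7))
  finally show ?thesis using B by simp
qed

lemma count_bits_run:
  assumes b: "bdd B \<sigma>" and n0: "\<sigma> 0 0 = n" and z: "\<sigma> 23 0 = 0"
  shows "run E count_bits \<sigma> t_count (\<lambda>\<sigma>'. bdd B \<sigma>' \<and> same {23, 24} \<sigma> \<sigma>' \<and> \<sigma>' 23 0 = bit_length n) (\<lambda>_. 0) 0"
  unfolding count_bits_def t_count_def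
proof (rule run_Seq_sure)
  define I where "I \<sigma>' \<longleftrightarrow> bdd B \<sigma>' \<and> same {23, 24} \<sigma> \<sigma>' \<and> bl (\<sigma>' 24 0) + \<sigma>' 23 0 = bit_length n" for \<sigma>'
  show "run E (assign 24 (scalar 0)) \<sigma> (L * 13) I (\<lambda>_. 0) 0"
  proof (rule run_straight[where B = B])
    show "I (det (assign 24 (scalar 0)) \<sigma>)" if "bdd B (det (assign 24 (scalar 0)) \<sigma>)"
      using that n0 z dim by (simp add: I_def put_def same_def bl_def)
  qed (use b n0 B_ge in \<open>auto simp: power2_eq_square\<close>)
  fix \<sigma>1 assume I1: "I \<sigma>1"
  let ?body = "Seq (assign 24 (Div (scalar 24) (Const 2))) (assign 23 (Add (scalar 23) (Const 1)))"
  have step: "run E ?body \<sigma>2 (L * 50) (\<lambda>\<sigma>'. I \<sigma>' \<and> bl (\<sigma>' 24 0) < bl (\<sigma>2 24 0)) (\<lambda>_. 0) 0"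
    if I: "I \<sigma>2" and nz: "val \<sigma>2 (scalar 24) \<noteq> 0" for \<sigma>2
  proof (rule run_straight[where B = B])
    have h: "bl (\<sigma>2 24 0 div 2) + 1 = bl (\<sigma>2 24 0)" using nz by (intro bl_half) simp
    have "\<sigma>2 24 0 \<le> B" using I by (simp add: I_def bdd_def)
    moreover have "Suc (\<sigma>2 23 0) \<le> B" using h I bit_length_le_B by (simp add: I_def)
    ultimately show "det_bdd B ?body \<sigma>2" by (simp add: put_def)
    show "I (det ?body \<sigma>2) \<and> bl (det ?body \<sigma>2 24 0) < bl (\<sigma>2 24 0)" if "bdd B (det ?body \<sigma>2)"
      using that I h by (auto simp: I_def put_def same_def)
  qed (use I B_ge in \<open>auto simp: I_def power2_eq_square\<close>)
  have cost: "1 + val_cost \<sigma>2 (scalar 24) \<le> L * test_size (scalar 24)" if "I \<sigma>2" for \<sigma>2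
    by (rule test_cost) (use that B_ge in \<open>simp_all add: I_def\<close>)
  show "run E (While (scalar 24) ?body) \<sigma>1 (bit_length n * (L * test_size (scalar 24) + L * 50) + L * test_size (scalar 24))
     (\<lambda>\<sigma>'. bdd B \<sigma>' \<and> same {23, 24} \<sigma> \<sigma>' \<and> \<sigma>' 23 0 = bit_length n) (\<lambda>_. 0) 0"
  proof (rule run_mono[OF run_While[where I = I and v = "\<lambda>\<sigma>. bl (\<sigma> 24 0)" and f = "\<lambda>_. 0", OF step cost I1]])
    have "bl (\<sigma>1 24 0) \<le> bit_length n" using I1 by (simp add: I_def)
    then show "bl (\<sigma>1 24 0) * (L * test_size (scalar 24) + L * 50) + L * test_size (scalar 24)
      \<le> bit_length n * (L * test_size (scalar 24) + L * 50) + L * test_size (scalar 24)"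
      by (intro add_right_mono mult_le_mono1)
  qed (auto simp: I_def bl_def)
qed

lemma set_params_run:
  assumes b: "bdd B \<sigma>" and v: "\<sigma> 0 0 = n" "\<sigma> 0 1 = k" "\<sigma> 1 = x_cells" "\<sigma> 23 0 = bit_length n"
  shows "run E set_params \<sigma> (L * ccost set_params)
    (\<lambda>\<sigma>'. standing \<sigma>' \<and> \<sigma>' 13 0 = 1 \<and> same {13, 18, 19, 20} \<sigma> \<sigma>') (\<lambda>_. 0) 0"
proof (rule run_straight[where B = B])
  have N': "24 * (k * k * k) * bit_length n = N" by (simp add: N power3_eq_cube)
  have k1: "\<sigma> 0 (Suc 0) = k" using v by simp
  have D1: "1 \<le> D" using D by simp
  have det: "det set_params \<sigma> = put 13 0 1 (put 18 0 einv (put 19 0 N (put 20 0 D \<sigma>)))"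
    by (simp add: set_params_def put_def v k1 N' einv D N[symmetric])
  show "det_bdd B set_params \<sigma>"
    using B_ge params B by (simp add: set_params_def put_def v k1 N' einv[symmetric] D[simplified, symmetric])
  show "standing (det set_params \<sigma>) \<and> det set_params \<sigma> 13 0 = 1 \<and> same {13, 18, 19, 20} \<sigma> (det set_params \<sigma>)"
    if "bdd B (det set_params \<sigma>)"
    using that v k1 D1 unfolding det by (simp add: standing_def put_def same_def)
qed (use b B_ge in \<open>simp_all add: set_params_def\<close>)

text \<open>Both parameters are tuned to \<open>m = 12 * k * bit_length n\<close>. Taking
  \<open>einv = m * N * D\<close> makes the verdict errors of a probe add up to
  \<open>1 / m\<close>, and \<open>N / (2 * k ^ 2) = m\<close> makes the miss probability at most
  \<open>exp (- m)\<close>, again at most \<open>1 / m\<close>. The sum \<open>2 / m\<close>, times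
  \<open>2 * k * bit_length n\<close> probes, is 1/3.\<close>

lemma p_test_small: "p_test * bit_length n * (2 * real k) \<le> 1 / 3"
proof -
  define m where "m = 12 * real k * real (bit_length n)"
  have W: "bit_length n \<ge> 1" by (rule bit_length_ge_1)
  have m: "m > 0" using k W by (simp add: m_def)
  have "N * D > 0" using params(1) D by simp
  then have ND: "real (N * D) > 0" by (simp only: of_nat_0_less_iff)
  have "real einv = m * real (N * D)" by (simp add: einv m_def)
  moreover have "P * (1 / (m * P)) = 1 / m" if "P > 0" for P using that m by simp
  ultimately have 1: "real (N * D) * \<eta> = 1 / m" using ND by (simp only:)
  define q where "q = 1 / (2 * real k ^ 2)"
  have "q \<le> 1" using mult_mono[of 1 "real k" 1 "real k"] k by (simp add: q_def divide_le_eq_1 power2_eq_square)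
  then have "(1 - q) ^ N \<le> exp (- q) ^ N" using exp_ge_add_one_self[of "- q"] by (intro power_mono) auto
  also have "\<dots> = exp (- (real N * q))" by (simp flip: exp_of_nat_mult)
  also have "real N * q = m" using k by (simp add: N q_def m_def field_simps power2_eq_square power3_eq_cube)
  also have "exp (- m) \<le> 1 / m"
  proof -
    have "m \<le> exp m" using exp_ge_add_one_self[of m] by linarith
    then show ?thesis using m by (simp add: exp_minus field_simps)
  qed
  finally have "p_test \<le> 1 / m + 1 / m" unfolding p_test_def 1 q_def[symmetric] by simp
  then have "p_test * (bit_length n * (2 * real k)) \<le> (2 / m) * (bit_length n * (2 * real k))"
    by (intro mult_right_mono) auto
  also have "\<dots> = 1 / 3" using k W by (simp add: m_def field_simps)
  finally show ?thesis by (simp add: algebra_simps)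
qed

lemma p_test_le_1: "p_test * bit_length n \<le> 1"
proof -
  have "p_test * bit_length n * 1 \<le> p_test * bit_length n * (2 * real k)"
    using p_test_nonneg k by (intro mult_left_mono) auto
  then show ?thesis using p_test_small by linarith
qed

definition t_total :: nat where
  "t_total = t_count + (L * ccost set_params +
     (D * (L * test_size advance_test + t_advance) + L * test_size advance_test))"

lemma few_rounds:
  assumes "good \<sigma>" "\<sigma> 15 0 \<noteq> n + 1"
  shows "\<sigma> 13 0 \<le> 2 * k"
proof (rule few_separated_translates[where v = "\<lambda>j. prefix x (\<sigma> 10 j)"])
  show "A \<subseteq> carrier_vec n" "2 ^ n \<le> real (card A) * real k" using dense by (auto simp: A_def)
  show "1 \<le> k" using k by simp
  fix i j assume "i < j" "j < \<sigma> 13 0"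
  then have "\<not> overlapping (\<sigma> 10 j) (\<sigma> 10 i)" using assms by (simp add: good_def)
  then show "2 * (real k)\<^sup>2 * real (card {r \<in> A. r + (prefix x (\<sigma> 10 j) + prefix x (\<sigma> 10 i)) \<in> A}) < 2 ^ n"
    by (simp add: overlapping_def)
qed simp

text \<open>The potential prepays one search per remaining round. The list starts with one entry and
  is cut off at \<open>D = 2 * k + 1\<close>, which leaves at most \<open>2 * k\<close> rounds and
  an initial potential of at most 1/3.\<close>

lemma main_loop_run:
  assumes "standing \<sigma>" "good \<sigma>" "\<sigma> 15 0 \<le> n + 1"
  shows "run E (While advance_test (advance Vc Rc)) \<sigma> (D * (L * test_size advance_test + t_advance) + L * test_size advance_test)
     (\<lambda>_. True) (\<lambda>\<sigma>'. of_bool (get_vec n 2 \<sigma>' \<noteq> M *\<^sub>v x)) (ennreal (1 / 3))"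
proof -
  define p where "p = p_test * bit_length n"
  have p: "0 \<le> p" "p * (2 * real k) \<le> 1 / 3" using p_test_nonneg p_test_small by (simp_all add: p_def)
  define I where "I \<sigma> \<longleftrightarrow> standing \<sigma> \<and> \<sigma> 15 0 \<le> n + 1" for \<sigma>
  define f where "f \<sigma> = (if good \<sigma> then ennreal (p * (real D - real (\<sigma> 13 0))) else 1)" for \<sigma>
  have f13: "f \<sigma> \<le> ennreal (1 / 3)" if "good \<sigma>" "I \<sigma>" for \<sigma>
  proof -
    have "1 \<le> \<sigma> 13 0" using that by (simp add: I_def standing_def)
    moreover have "real D = 2 * real k + 1" by (simp add: D)
    ultimately have "p * (real D - real (\<sigma> 13 0)) \<le> p * (2 * real k)"
      using p by (intro mult_left_mono) auto
    then show ?thesis using that p(2) by (auto simp: f_def intro!: ennreal_leI)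
  qed
  have f1: "f \<sigma> \<le> 1" if "I \<sigma>" for \<sigma>
  proof (cases "good \<sigma>")
    case True
    have "f \<sigma> \<le> ennreal (1 / 3)" by (rule f13[OF True that])
    also have "\<dots> \<le> ennreal 1" by (rule ennreal_leI) simp
    finally show ?thesis by simp
  qed (simp add: f_def)
  have step: "run E (advance Vc Rc) \<sigma>1 t_advance (\<lambda>\<sigma>'. I \<sigma>' \<and> D - \<sigma>' 13 0 < D - \<sigma>1 13 0) f (f \<sigma>1)"
    if I1: "I \<sigma>1" and t: "val \<sigma>1 advance_test \<noteq> 0" for \<sigma>1
  proof -
    have SI1: "standing \<sigma>1" using I1 by (simp add: I_def)
    have J: "\<sigma>1 13 0 < D" and hi: "\<sigma>1 15 0 \<noteq> n + 1" using SI1 t by (auto simp: advance_test_def standing_def)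
    note run = advance_run[OF SI1 p_test_le_1 J hi]
    have "run E (advance Vc Rc) \<sigma>1 t_advance (\<lambda>\<sigma>'. standing \<sigma>' \<and> \<sigma>' 13 0 = Suc (\<sigma>1 13 0) \<and> \<sigma>' 15 0 \<le> n + 1) f (f \<sigma>1)"
    proof (cases "good \<sigma>1")
      case True
      have nn: "0 \<le> p * (real D - real (Suc (\<sigma>1 13 0)))" using p J by simp
      have "run E (advance Vc Rc) \<sigma>1 t_advance (\<lambda>\<sigma>'. standing \<sigma>' \<and> \<sigma>' 13 0 = Suc (\<sigma>1 13 0) \<and> \<sigma>' 15 0 \<le> n + 1) f
         (ennreal (p * (real D - real (Suc (\<sigma>1 13 0)))) + ennreal p)"
        using run True unfolding p_def[symmetric]
        by (intro run_add[where g = "\<lambda>\<sigma>'. of_bool (\<not> good \<sigma>')"]) (auto simp: f_def)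
      also have "ennreal (p * (real D - real (Suc (\<sigma>1 13 0)))) + ennreal p = f \<sigma>1"
        using True by (subst ennreal_plus[OF nn p(1), symmetric]) (simp add: f_def algebra_simps)
      finally show ?thesis .
    next
      case False
      then show ?thesis by (intro run_bound[OF run]) (auto simp: f_def[of \<sigma>1] I_def intro!: f1)
    qed
    then show ?thesis by (rule run_mono) (use J in \<open>auto simp: I_def\<close>)
  qed
  have cost: "1 + val_cost \<sigma>1 advance_test \<le> L * test_size advance_test" if "I \<sigma>1" for \<sigma>1
    by (rule test_cost) (use that B_ge in \<open>simp_all add: I_def standing_def advance_test_def\<close>)
  have I: "I \<sigma>" using assms by (simp add: I_def)
  show ?thesis
  proof (rule run_mono[OF run_While[where I = I and v = "\<lambda>\<sigma>. D - \<sigma> 13 0" and f = f, OF step cost I]])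
    show "f \<sigma> \<le> ennreal (1 / 3)" by (rule f13[OF assms(2) I])
    show "(D - \<sigma> 13 0) * (L * test_size advance_test + t_advance) + L * test_size advance_test
      \<le> D * (L * test_size advance_test + t_advance) + L * test_size advance_test"
      by (intro add_right_mono mult_le_mono1) simp
    fix \<sigma>' assume *: "I \<sigma>' \<and> val \<sigma>' advance_test = 0"
    \<comment> \<open>A \<open>good\<close> state cannot stop by exhausting the rounds: it would
      hold \<open>2 * k + 1\<close> separated prefixes, one more than possible.\<close>
    have "get_vec n 2 \<sigma>' = M *\<^sub>v x" if g: "good \<sigma>'"
    proof (cases "\<sigma>' 15 0 = n + 1")
      case True
      then show ?thesis using g by (simp add: good_def)
    next
      case False
      then have "\<sigma>' 13 0 = D" using * by (auto simp: advance_test_def I_def standing_def)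
      then show ?thesis using few_rounds[OF g False] D by simp
    qed
    then show "of_bool (get_vec n 2 \<sigma>' \<noteq> M *\<^sub>v x) \<le> f \<sigma>'" by (auto simp: f_def)
  qed simp_all
qed

theorem reduce_run:
  "run E (reduce Vc Rc) (input_store n k [x]) t_total (\<lambda>_. True)
     (\<lambda>\<sigma>'. of_bool (get_vec n 2 \<sigma>' \<noteq> M *\<^sub>v x)) (ennreal (1 / 3))"
  unfolding reduce_def t_total_def
proof (rule run_Seq_sure[OF count_bits_run])
  let ?\<sigma> = "input_store n k [x]"
  have "k \<le> B" "n \<le> B" "1 \<le> B" using params(6) B by auto
  then show "bdd B ?\<sigma>" by (auto simp: bdd_def input_store_def bit_nat_def)
  show "?\<sigma> 0 0 = n" "?\<sigma> 23 0 = 0" by (simp_all add: input_store_def)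
  fix \<sigma>1 assume 1: "bdd B \<sigma>1 \<and> same {23, 24} ?\<sigma> \<sigma>1 \<and> \<sigma>1 23 0 = bit_length n"
  then have s1: "same {23, 24} ?\<sigma> \<sigma>1" by simp
  show "run E (Seq set_params (While advance_test (advance Vc Rc))) \<sigma>1
     (L * ccost set_params + (D * (L * test_size advance_test + t_advance) + L * test_size advance_test))
     (\<lambda>_. True) (\<lambda>\<sigma>'. of_bool (get_vec n 2 \<sigma>' \<noteq> M *\<^sub>v x)) (ennreal (1 / 3))"
  proof (rule run_Seq_sure[OF set_params_run])
    show "bdd B \<sigma>1" "\<sigma>1 0 0 = n" "\<sigma>1 0 1 = k" "\<sigma>1 1 = x_cells" "\<sigma>1 23 0 = bit_length n"
      using 1 by (auto simp: sameD[OF s1] input_store_def x_cells_def)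
    fix \<sigma>2 assume 2: "standing \<sigma>2 \<and> \<sigma>2 13 0 = 1 \<and> same {13, 18, 19, 20} \<sigma>1 \<sigma>2"
    then have s2: "same {13, 18, 19, 20} \<sigma>1 \<sigma>2" by simp
    have z: "\<sigma>2 10 = (\<lambda>_. 0)" "\<sigma>2 11 = (\<lambda>_. 0)" "\<sigma>2 15 = (\<lambda>_. 0)"
      by (simp_all add: sameD[OF s2] sameD[OF s1] input_store_def fun_eq_iff)
    \<comment> \<open>The first list entry is the empty prefix. Its length 0 and its zero answer are
      already present in untouched memory, so only the list size has to be set.\<close>
    have "answer n \<sigma>2 0 = M *\<^sub>v prefix x 0"
      using M(1) by (auto simp: prefix_0 answer_def z intro!: eq_vecI)
    then have "good \<sigma>2" using 2 by (simp add: good_def answers_ok_def z)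
    then show "run E (While advance_test (advance Vc Rc)) \<sigma>2
     (D * (L * test_size advance_test + t_advance) + L * test_size advance_test)
     (\<lambda>_. True) (\<lambda>\<sigma>'. of_bool (get_vec n 2 \<sigma>' \<noteq> M *\<^sub>v x)) (ennreal (1 / 3))"
      by (intro main_loop_run) (use 2 in \<open>auto simp: z\<close>)
  qed
qed

end

section \<open>Running time and the classical reduction\<close>

context reduction
begin

definition Ln :: nat where "Ln = L * n"

lemma L_le_Ln: "L \<le> Ln"
  using dim mult_le_mono2[of 1 n L] by (simp add: Ln_def)

lemma loop_cost_le:
  assumes "c + 48 \<le> C" "Ln \<le> X"
  shows "n * (L * c + L * 28) + L * 20 \<le> C * X"
proof -
  have "n * (L * c + L * 28) + L * 20 = (c + 28) * Ln + 20 * L" by (simp add: Ln_def algebra_simps)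
  also have "\<dots> \<le> (c + 28) * Ln + 20 * Ln" using L_le_Ln by (intro add_mono mult_le_mono) auto
  also have "\<dots> = (c + 48) * Ln" by (simp add: add_mult_distrib)
  also have "\<dots> \<le> C * X" using assms by (rule mult_le_mono)
  finally show ?thesis .
qed

text \<open>\<open>X\<close> collects what one trial pays for: passes over vectors of length
  \<open>n\<close> at \<open>L\<close> per cell, the solver, and the verifier. The numerical factors
  are generous roundings of syntactic sizes.\<close>

lemma t_attempt_le:
  assumes X: "Ln + alg_cost E + tv \<le> X"
  shows "t_attempt \<le> 4000 * X"
proof -
  have LX: "Ln \<le> X" "L \<le> X" "alg_cost E \<le> X" "tv \<le> X" using X L_le_Ln by linarith+
  have "5 + ccost sample_tail + 48 \<le> 1700" by (simp add: sample_tail_def power2_eq_square)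
  note 1 = loop_cost_le[OF this LX(1)]
  have "ccost combine_body + 48 \<le> 1700" by (simp add: combine_body_def power2_eq_square)
  note 2 = loop_cost_le[OF this LX(1)]
  have "ccost attempt_tail \<le> 50" by (simp add: attempt_tail_def power2_eq_square)
  with LX(2) have 3: "L * ccost attempt_tail \<le> X * 50" by (rule mult_le_mono)
  have "t_attempt \<le> 1700 * X + (X + (X + (1700 * X + (X + X * 50))))"
    unfolding t_attempt_def by (intro add_mono 1 2 3 LX)
  then show ?thesis by simp
qed

lemma t_probe_le:
  assumes X: "Ln + alg_cost E + tv \<le> X"
  shows "t_probe \<le> 5000 * (N * D * X)"
proof -
  have L: "L \<le> X" using X L_le_Ln by linarith
  have "N * D \<ge> 1" using params(1) D by simp
  then have "1 * X \<le> N * D * X" by (intro mult_le_mono1)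
  then have LX: "L \<le> N * D * X" using L by linarith
  have "N * D * (L * test_size probe_test + t_attempt) \<le> N * D * (X * test_size probe_test + 4000 * X)"
    using L t_attempt_le[OF X] by (intro mult_le_mono2 add_mono mult_le_mono1)
  then show ?thesis
    using LX by (simp add: t_probe_def probe_init_def probe_test_def test_size_def power2_eq_square algebra_simps)
qed

lemma t_search_le:
  assumes X: "Ln + alg_cost E + tv \<le> X"
  shows "t_search \<le> 8000 * (bit_length n * (N * D * X))"
proof -
  define Y where "Y = N * D * X"
  have "N * D \<ge> 1" using params(1) D by simp
  then have "1 * X \<le> Y" unfolding Y_def by (intro mult_le_mono1)
  then have XY: "X \<le> Y" by simp
  have L: "L \<le> Y" "Ln \<le> Y" using X XY L_le_Ln by linarith+
  have "1 * Y \<le> bit_length n * Y" using bit_length_ge_1 by (intro mult_le_mono1)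
  then have LY: "L \<le> bit_length n * Y" using L by linarith
  have "ccost copy_body + 48 \<le> 100" by (simp add: copy_body_def power2_eq_square)
  from loop_cost_le[OF this L(2)] have "t_copy \<le> 100 * Y" unfolding t_copy_def .
  then have "L * test_size search_test + (L * ccost midpoint + (t_probe + (L * test_size (scalar 22) + (L * 7 + t_copy)))) \<le> 5600 * Y"
    using L t_probe_le[OF X] unfolding Y_def[symmetric]
    by (simp add: search_test_def midpoint_def test_size_def power2_eq_square)
  then have "bit_length n * (L * test_size search_test + (L * ccost midpoint + (t_probe + (L * test_size (scalar 22) + (L * 7 + t_copy)))))
      \<le> bit_length n * (5600 * Y)"
    by (rule mult_le_mono2)
  then show ?thesis
    using LY unfolding t_search_def Y_def[symmetric]
    by (simp add: search_init_def search_test_def test_size_def power2_eq_square algebra_simps)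
qed

text \<open>The product mirrors the nested loops: at most \<open>D\<close> rounds,
  \<open>bit_length n\<close> probes in each, \<open>N * D\<close> trials in each of these. Reading
  a column happens only once per round, so putting \<open>n * tr\<close> into \<open>X\<close>
  overpays for it.\<close>

lemma t_total_le:
  assumes X: "Ln + alg_cost E + tv + n * tr \<le> X"
  shows "t_total \<le> 20000 * (D * (bit_length n * (N * D * X)))"
proof -
  define Z where "Z = bit_length n * (N * D * X)"
  have W: "bit_length n \<ge> 1" by (rule bit_length_ge_1)
  have "N * D \<ge> 1" using params(1) D by simp
  then have "1 * (1 * X) \<le> Z" unfolding Z_def using W by (intro mult_le_mono) auto
  then have XZ: "X \<le> Z" by simp
  have L: "L \<le> X" "Ln \<le> X" "n * tr \<le> X" "L \<le> Z" using X XZ L_le_Ln by linarith+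
  have "ccost append_store + 48 \<le> 900" by (simp add: append_store_def power2_eq_square)
  note append = loop_cost_le[OF this L(2)]
  have "t_append = n * tr + (n * (L * ccost append_store + L * 28) + L * 20)"
    by (simp add: t_append_def distrib_left)
  also have "\<dots> \<le> X + 900 * X" by (intro add_mono L append)
  finally have "t_append \<le> 1000 * Z" using XZ by simp
  then have "L * test_size advance_test + t_advance \<le> 10000 * Z"
    using t_search_le[of X] X L(4) unfolding Z_def[symmetric]
    by (simp add: t_advance_def advance_test_def append_tail_def test_size_def power2_eq_square)
  then have 1: "D * (L * test_size advance_test + t_advance) \<le> D * (10000 * Z)" by (rule mult_le_mono2)
  have "1 * Z \<le> D * Z" using D by (intro mult_le_mono1) simp
  then have DZ: "Z \<le> D * Z" by (simp only: mult_1)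
  have LD: "L \<le> D * Z" by (rule order_trans[OF L(4) DZ])
  have "bit_length n * (1 * 1 * X) \<le> Z" unfolding Z_def using params(1) D by (intro mult_le_mono) auto
  then have "bit_length n * X \<le> Z" by simp
  from order_trans[OF mult_le_mono2[OF L(1)] this] have "bit_length n * L \<le> Z" .
  then have "bit_length n * L \<le> D * Z" by (rule order_trans[OF _ DZ])
  then have 2: "t_count + L * ccost set_params + L * test_size advance_test \<le> 5000 * (D * Z)"
    using LD by (simp add: t_count_def set_params_def advance_test_def test_size_def power2_eq_square algebra_simps)
  have "t_total = D * (L * test_size advance_test + t_advance) + (t_count + L * ccost set_params + L * test_size advance_test)"
    by (simp only: t_total_def add_ac)
  also have "\<dots> \<le> D * (10000 * Z) + 5000 * (D * Z)" by (intro add_mono 1 2)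
  also have "\<dots> \<le> 20000 * (D * Z)" by simp
  finally show ?thesis unfolding Z_def .
qed

end

section \<open>Asymptotic bounds and the classical instance\<close>

lemma succeeds_withinI:
  assumes r: "run E c (input_store (mdim E) k vs) t (\<lambda>_. True) (\<lambda>\<sigma>. of_bool (\<not> P \<sigma>)) (ennreal p)"
    and t: "real t \<le> t'" and p: "0 \<le> p"
  shows "succeeds_within E c k vs t' (1 - p) P"
proof -
  obtain \<mu> where \<mu>: "big_step E c \<lparr>store = input_store (mdim E) k vs, qmem = zero_ket, elapsed = 0\<rparr> \<mu>"
    "\<And>s. s \<in> set_pmf \<mu> \<Longrightarrow> elapsed s \<le> 0 + t"
    "(\<integral>\<^sup>+ s. of_bool (\<not> P (store s)) \<partial>measure_pmf \<mu>) \<le> ennreal p"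
    by (rule run_fromE[OF runD[OF r, where \<psi> = zero_ket], where e = 0]) blast
  have "(\<integral>\<^sup>+ s. of_bool (\<not> P (store s)) \<partial>measure_pmf \<mu>) = emeasure (measure_pmf \<mu>) {s. \<not> P (store s)}"
  proof -
    have "of_bool (\<not> P (store s)) = (indicator {s. \<not> P (store s)} s :: ennreal)" for s :: state by simp
    then show ?thesis by (simp only:) (rule nn_integral_indicator, simp)
  qed
  then have "measure_pmf.prob \<mu> {s. \<not> P (store s)} \<le> p"
    using \<mu>(3) p by (simp add: measure_pmf.emeasure_eq_measure)
  moreover have "measure_pmf.prob \<mu> {s. \<not> P (store s)} = 1 - measure_pmf.prob \<mu> {s. P (store s)}"
    by (subst measure_pmf.prob_compl[symmetric]) (auto intro!: arg_cong[of _ _ "measure_pmf.prob \<mu>"])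
  moreover have "real (elapsed s) \<le> t'" if "s \<in> set_pmf \<mu>" for s
    using \<mu>(2)[OF that] t by simp
  ultimately show ?thesis using \<mu>(1) unfolding succeeds_within_def by (intro exI[of _ \<mu>]) auto
qed

lemma uses_reduce: "uses (reduce Vc Rc) \<subseteq> {Solver} \<union> uses Vc \<union> uses Rc"
  by (auto simp: reduce_def count_bits_def set_params_def advance_def search_def search_init_def midpoint_def
    probe_def probe_init_def attempt_def sample_def sample_tail_def combine_body_def attempt_tail_def
    for_dim_def move_def copy_body_def append_store_def append_tail_def)

lemma bit_length_le_log: "k \<ge> 1 \<Longrightarrow> real (bit_length k) \<le> log 2 (real k) + 1"
proof -
  assume k: "k \<ge> 1"
  then have "2 ^ floor_log k \<le> k" by (simp add: floor_log_exp2_le)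
  then have "(2::real) ^ floor_log k \<le> real k" by (metis of_nat_le_iff of_nat_numeral of_nat_power)
  then have "real (floor_log k) \<le> log 2 (real k)" using k by (simp add: le_log_of_power)
  then show ?thesis by (simp add: bit_length_def)
qed

lemma bit_length_le_self: "n \<ge> 1 \<Longrightarrow> bit_length n \<le> n"
proof -
  assume n: "n \<ge> 1"
  have "n < 2 ^ n" by (rule less_exp)
  then show ?thesis using n by (rule bit_length_le)
qed

text \<open>Since \<open>l\<close> is at least 1, additive constants disappear in multiples of
  \<open>l\<close>. The factor 21 arises because the bit length of \<open>einv + n + 2\<close> is at
  most \<open>16 + 5 * log 2 (1 / \<epsilon>) + 2 * log 2 n\<close>. The last bound is for the
  argument of the logarithm in the verifier's running time at error \<open>1 / einv\<close>.\<close>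

lemma parameter_bounds:
  fixes n k N D einv :: nat and \<epsilon> :: real
  assumes n: "n \<ge> 1" and \<epsilon>: "0 < \<epsilon>" "\<epsilon> \<le> 1 / 2" and k: "k = nat \<lceil>1 / \<epsilon>\<rceil>"
    and D: "D = 2 * k + 1" and N: "N = 24 * k ^ 3 * bit_length n"
    and einv: "einv = 12 * k * bit_length n * N * D"
  defines "l \<equiv> log 2 (real n / \<epsilon>)"
  shows "k \<ge> 2" "1 \<le> \<epsilon> * real k" "1 \<le> l"
    "real (D * (bit_length n * (N * D))) \<le> 864 * (2 / \<epsilon>) ^ 5 * l ^ 2"
    "real (bit_length (einv + n + 2)) \<le> 21 * l"
    "log 2 (real n * real einv) \<le> 21 * l"
proof -
  have e2: "1 / \<epsilon> \<ge> 2" using \<epsilon> by (simp add: field_simps)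
  have kge: "real k \<ge> 1 / \<epsilon>" using k e2 by linarith
  then show "k \<ge> 2" using e2 by linarith
  have kle: "real k \<le> 2 / \<epsilon>" using k e2 by (simp add: field_simps) linarith
  show "1 \<le> \<epsilon> * real k" using kge \<epsilon> by (simp add: field_simps)
  have llog: "l = log 2 (real n) + log 2 (1 / \<epsilon>)"
    using n \<epsilon> by (simp add: l_def log_divide)
  have ln0: "log 2 (real n) \<ge> 0" using n by simp
  have le1: "log 2 (1 / \<epsilon>) \<ge> 1" using e2 \<epsilon> by (simp add: le_log_iff)
  show l1: "1 \<le> l" using llog ln0 le1 by linarith
  have W: "real (bit_length n) \<le> 2 * l" using bit_length_le_log[OF n] llog ln0 le1 by linarith
  have k5: "k ^ 5 = k * k ^ 3 * k" by (simp add: eval_nat_numeral)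
  have D3: "D \<le> 3 * k" using D \<open>k \<ge> 2\<close> by simp
  have "D * (bit_length n * (N * D)) \<le> (3 * k) * (bit_length n * (N * (3 * k)))"
    using D3 by (intro mult_le_mono) auto
  also have "\<dots> = 216 * (k * k ^ 3 * k) * (bit_length n * bit_length n)" unfolding N by (simp only: mult_ac)
  also have "\<dots> = 216 * k ^ 5 * bit_length n ^ 2" by (simp only: k5 power2_eq_square)
  finally have "real (D * (bit_length n * (N * D))) \<le> real (216 * k ^ 5 * bit_length n ^ 2)"
    by (simp only: of_nat_le_iff)
  also have "\<dots> = 216 * real k ^ 5 * real (bit_length n) ^ 2" by simp
  also have "\<dots> \<le> 216 * (2 / \<epsilon>) ^ 5 * (2 * l) ^ 2"
    using kle W \<epsilon> by (intro mult_mono power_mono) auto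
  finally show "real (D * (bit_length n * (N * D))) \<le> 864 * (2 / \<epsilon>) ^ 5 * l ^ 2"
    by (simp add: power_mult_distrib)
  have k5_pos: "k ^ 5 \<ge> 1" using \<open>k \<ge> 2\<close> by simp
  have "einv \<le> 12 * k * bit_length n * N * (3 * k)" unfolding einv using D3 by (intro mult_le_mono) auto
  also have "\<dots> = 864 * (k * k ^ 3 * k) * (bit_length n * bit_length n)" unfolding N by (simp only: mult_ac)
  also have "\<dots> = 864 * k ^ 5 * bit_length n ^ 2" by (simp only: k5 power2_eq_square)
  also have "\<dots> \<le> 864 * k ^ 5 * n ^ 2"
    using bit_length_le_self[OF n] by (intro mult_le_mono power_mono) auto
  finally have einv_le: "einv \<le> 864 * k ^ 5 * n ^ 2" .
  have "1 * n \<le> k ^ 5 * n ^ 2" using k5_pos n by (intro mult_le_mono) (auto simp: power2_eq_square)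
  moreover have "1 * 1 \<le> k ^ 5 * n ^ 2" using k5_pos n by (intro mult_le_mono) auto
  \<comment> \<open>The leading factor 864 leaves room for \<open>n + 2\<close> below 1024, a power
    of two with logarithm 10.\<close>
  ultimately have "einv + n + 2 \<le> 1024 * k ^ 5 * n ^ 2" using einv_le by linarith
  then have "real (einv + n + 2) \<le> real (1024 * k ^ 5 * n ^ 2)" by (simp only: of_nat_le_iff)
  then have Ble: "real (einv + n + 2) \<le> 1024 * real k ^ 5 * real n ^ 2" by simp
  have logk: "log 2 (real k) \<le> 1 + log 2 (1 / \<epsilon>)"
  proof -
    have "log 2 (real k) \<le> log 2 (2 * (1 / \<epsilon>))" using kle \<open>k \<ge> 2\<close> \<epsilon> by (subst log_le_cancel_iff) auto
    also have "\<dots> = 1 + log 2 (1 / \<epsilon>)" using \<epsilon> by (subst log_mult) auto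
    finally show ?thesis .
  qed
  have logB: "log 2 (1024 * real k ^ 5 * real n ^ j) = 10 + 5 * log 2 (real k) + j * log 2 (real n)" for j
  proof -
    have "log 2 (1024::real) = log 2 (2 ^ 10)" by simp
    also have "\<dots> = 10" by (subst log_nat_power) auto
    finally have "log 2 (1024::real) = 10" .
    then show ?thesis using \<open>k \<ge> 2\<close> n by (simp add: log_mult log_nat_power)
  qed
  have "real (bit_length (einv + n + 2)) \<le> log 2 (real (einv + n + 2)) + 1" by (rule bit_length_le_log) simp
  also have "log 2 (real (einv + n + 2)) \<le> log 2 (1024 * real k ^ 5 * real n ^ 2)"
    by (rule log_mono[OF _ _ Ble]) simp_all
  finally show "real (bit_length (einv + n + 2)) \<le> 21 * l"
    using logB[of 2] logk llog ln0 le1 by simp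
  have "bit_length n \<ge> 1" by (rule bit_length_ge_1)
  then have "0 < einv" using \<open>k \<ge> 2\<close> by (simp only: einv D N nat_0_less_mult_iff) auto
  then have epos: "einv \<ge> 1" by simp
  have "real einv \<le> 1024 * real k ^ 5 * real n ^ 2" using Ble by linarith
  then have "real n * real einv \<le> 1024 * real k ^ 5 * real n ^ 3"
    using mult_left_mono[of "real einv" "1024 * real k ^ 5 * real n ^ 2" "real n"]
    by (simp add: power3_eq_cube power2_eq_square mult_ac del: mult_le_cancel_left)
  then have "log 2 (real n * real einv) \<le> log 2 (1024 * real k ^ 5 * real n ^ 3)"
    using epos n by (intro log_mono) auto
  then show "log 2 (real n * real einv) \<le> 21 * l"
    using logB[of 3] logk llog ln0 le1 by simp
qed

text \<open>The actual dependence on \<open>2 / \<epsilon>\<close> is a fifth power. Because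
  \<open>log 2 (1 / \<epsilon>)\<close> is at least 1, any \<open>C\<close> of at least 5 puts it
  below the quasi-polynomial form.\<close>

lemma absorb_polynomial:
  fixes \<epsilon> l Z c C :: real
  assumes \<epsilon>: "0 < \<epsilon>" "\<epsilon> \<le> 1 / 2" and l: "1 \<le> l" and Z: "0 \<le> Z"
    and C: "0 \<le> c" "c \<le> C" "5 \<le> C" "b \<le> C"
  shows "c * (2 / \<epsilon>) ^ 5 * l powr b * Z \<le> C * (2 / \<epsilon>) powr (C * log 2 (1 / \<epsilon>)) * l powr C * Z"
proof -
  have e: "2 / \<epsilon> \<ge> 1" "1 / \<epsilon> \<ge> 2" using \<epsilon> by (simp_all add: field_simps)
  have "log 2 (1 / \<epsilon>) \<ge> 1" using e \<epsilon> by (simp add: le_log_iff)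
  then have "C * 1 \<le> C * log 2 (1 / \<epsilon>)" using C by (intro mult_left_mono) auto
  then have "5 \<le> C * log 2 (1 / \<epsilon>)" using C by linarith
  then have "(2 / \<epsilon>) powr 5 \<le> (2 / \<epsilon>) powr (C * log 2 (1 / \<epsilon>))" using e by (intro powr_mono) auto
  moreover have "(2 / \<epsilon>) powr 5 = (2 / \<epsilon>) ^ 5" using \<epsilon> powr_realpow[of "2 / \<epsilon>" 5] by simp
  ultimately have "(2 / \<epsilon>) ^ 5 \<le> (2 / \<epsilon>) powr (C * log 2 (1 / \<epsilon>))" by simp
  moreover have "l powr b \<le> l powr C" using l C by (intro powr_mono) auto
  ultimately show ?thesis using C Z \<epsilon> by (intro mult_mono mult_nonneg_nonneg) auto
qed

lemma dense_answers:
  fixes M :: "bit mat" and \<O> :: "bit vec \<Rightarrow> bit vec" and k :: nat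
  assumes "measure_pmf.prob (pmf_of_set (carrier_vec n)) {z. \<O> z = M *\<^sub>v z} \<ge> \<epsilon>" "1 \<le> \<epsilon> * real k" "0 < \<epsilon>"
  shows "2 ^ n \<le> real (card {z \<in> carrier_vec n. \<O> z = M *\<^sub>v z}) * real k"
proof -
  have "(carrier_vec n :: bit vec set) \<noteq> {}" using zero_carrier_vec by blast
  then have "measure_pmf.prob (pmf_of_set (carrier_vec n)) {z. \<O> z = M *\<^sub>v z}
      = real (card {z \<in> carrier_vec n. \<O> z = M *\<^sub>v z}) / 2 ^ n"
    by (simp add: measure_pmf_of_set finite_carrier_vec card_carrier_vec Int_def)
  then have "\<epsilon> \<le> real (card {z \<in> carrier_vec n. \<O> z = M *\<^sub>v z}) / 2 ^ n"
    using assms(1) by simp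
  then have "\<epsilon> * 2 ^ n \<le> real (card {z \<in> carrier_vec n. \<O> z = M *\<^sub>v z})"
    by (simp add: pos_le_divide_eq)
  then have "(\<epsilon> * 2 ^ n) * real k \<le> real (card {z \<in> carrier_vec n. \<O> z = M *\<^sub>v z}) * real k"
    by (intro mult_right_mono) auto
  moreover have "1 * 2 ^ n \<le> (\<epsilon> * real k) * 2 ^ n" using assms(2) by (intro mult_right_mono) auto
  moreover have "(\<epsilon> * real k) * 2 ^ n = (\<epsilon> * 2 ^ n) * real k" by simp
  ultimately show ?thesis by linarith
qed

definition classical_verifier :: com where
  "classical_verifier = Do (CallVer 8 9 12)"

definition classical_reader :: com where
  "classical_reader = Do (Read 17 (Const 0) (scalar 3) (scalar 14))"

lemma classical_reduction:
  fixes M :: "bit mat"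
  defines "C \<equiv> (10 ^ 12 :: real)"
  assumes n: "n \<ge> 1" and \<epsilon>: "0 < \<epsilon>" "\<epsilon> \<le> 1 / 2" and M: "M \<in> carrier_mat n n"
    and \<O>: "\<O> \<in> carrier_vec n \<rightarrow> carrier_vec n"
    and dense: "measure_pmf.prob (pmf_of_set (carrier_vec n)) {z. \<O> z = M *\<^sub>v z} \<ge> \<epsilon>"
    and \<V>: "\<forall>z \<in> carrier_vec n. \<forall>y \<in> carrier_vec n. \<V> z y \<longleftrightarrow> y = M *\<^sub>v z"
    and T: "T \<ge> n" and x: "x \<in> carrier_vec n"
  shows "succeeds_within
      \<lparr>mdim = n, matr = M, alg = \<O>, ver = \<V>, alg_cost = T, ver_cost = S\<rparr>
      (reduce classical_verifier classical_reader) (nat \<lceil>1 / \<epsilon>\<rceil>) [x]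
      (C * (2 / \<epsilon>) powr (C * log 2 (1 / \<epsilon>)) * log 2 (real n / \<epsilon>) powr C * (real T + real S))
      (2 / 3) (\<lambda>\<sigma>. get_vec n 2 \<sigma> = M *\<^sub>v x)"
proof -
  let ?E = "\<lparr>mdim = n, matr = M, alg = \<O>, ver = \<V>, alg_cost = T, ver_cost = S\<rparr>"
  define k where "k = nat \<lceil>1 / \<epsilon>\<rceil>"
  define D where "D = 2 * k + 1"
  define N where "N = 24 * k ^ 3 * bit_length n"
  define einv where "einv = 12 * k * bit_length n * N * D"
  define B where "B = einv + n + 2"
  define l where "l = log 2 (real n / \<epsilon>)"
  note bounds = parameter_bounds[OF n \<epsilon> k_def D_def N_def einv_def, folded l_def B_def]
  interpret reduction ?E n k D N einv B S "bit_length B * 10" M x classical_verifier classical_reader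
  proof
    show "2 ^ n \<le> real (card {z \<in> carrier_vec n. alg ?E z = M *\<^sub>v z}) * real k"
      using dense_answers[OF dense bounds(2) \<epsilon>(1)] by simp
    fix \<sigma> :: store
    assume b: "bdd B \<sigma>"
    {
      show "run ?E classical_verifier \<sigma> S (\<lambda>\<sigma>'. bdd B \<sigma>' \<and> same {12} \<sigma> \<sigma>' \<and> \<sigma>' 12 0 \<le> 1)
        (\<lambda>\<sigma>'. of_bool ((\<sigma>' 12 0 \<noteq> 0) \<noteq> (get_vec n 9 \<sigma> = M *\<^sub>v get_vec n 8 \<sigma>))) (ennreal (1 / einv))"
        unfolding classical_verifier_def
      proof (rule run_Do[where \<psi>' = id and \<sigma>' = "put 12 0 (of_bool (\<V> (get_vec n 8 \<sigma>) (get_vec n 9 \<sigma>))) \<sigma>"])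
        have "\<V> (get_vec n 8 \<sigma>) (get_vec n 9 \<sigma>) \<longleftrightarrow> get_vec n 9 \<sigma> = M *\<^sub>v get_vec n 8 \<sigma>"
          using \<V> by (simp add: get_vec_def)
        then show "of_bool ((put 12 0 (of_bool (\<V> (get_vec n 8 \<sigma>) (get_vec n 9 \<sigma>))) \<sigma> 12 0 \<noteq> 0) \<noteq> (get_vec n 9 \<sigma> = M *\<^sub>v get_vec n 8 \<sigma>))
          \<le> ennreal (1 / einv)" by (simp add: put_def)
      qed (use b in \<open>auto simp: put_def same_def bdd_def B_def\<close>)
    }
    {
      assume *: "\<sigma> 3 0 < n" "\<sigma> 14 0 \<le> n"
      show "run ?E classical_reader \<sigma> (bit_length B * 10) (\<lambda>\<sigma>'. bdd B \<sigma>' \<and> same {17} \<sigma> \<sigma>' \<and>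
          \<sigma>' 17 0 = bit_nat (entry ?E (\<sigma> 3 0) (\<sigma> 14 0))) (\<lambda>_. 0) 0"
        unfolding classical_reader_def
      proof (rule run_Do[where \<psi>' = id and \<sigma>' = "put 17 0 (bit_nat (entry ?E (\<sigma> 3 0) (\<sigma> 14 0))) \<sigma>"])
        have "val_cost \<sigma> (Const 0) \<le> bit_length B * 1" "val_cost \<sigma> (scalar 3) \<le> bit_length B * 4"
          "val_cost \<sigma> (scalar 14) \<le> bit_length B * 4"
          using val_cost_le[OF b, of "Const 0"] val_cost_le[OF b, of "scalar 3"] val_cost_le[OF b, of "scalar 14"]
          by (simp_all add: B_def power2_eq_square)
        then show "instr_cost ?E (Read 17 (Const 0) (scalar 3) (scalar 14)) \<sigma> \<le> bit_length B * 10"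
          using bit_length_ge_1[of B] by simp
      qed (use b in \<open>auto simp: put_def same_def bdd_def B_def bit_nat_def\<close>)
    }
  qed (use n M x \<O> bounds in \<open>auto simp: D_def N_def einv_def B_def\<close>)
  define X where "X = bit_length B * n + T + S + n * (bit_length B * 10)"
  have l1: "1 \<le> l" by (rule bounds(3))
  have "real t_total \<le> 20000 * (real (D * (bit_length n * (N * D))) * real X)"
  proof -
    have "t_total \<le> 20000 * (D * (bit_length n * (N * D)) * X)"
      using t_total_le[of X] by (simp add: X_def Ln_def mult.assoc)
    then have "real t_total \<le> real (20000 * (D * (bit_length n * (N * D)) * X))" by (simp only: of_nat_le_iff)
    then show ?thesis by (simp only: of_nat_mult of_nat_numeral)
  qed
  also have "\<dots> \<le> 20000 * ((864 * (2 / \<epsilon>) ^ 5 * l ^ 2) * (232 * l * (real T + real S)))"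
  proof (intro mult_left_mono mult_mono)
    \<comment> \<open>Here \<open>T \<ge> n\<close> turns the cost of handling vectors into a
      multiple of the solver's cost: 11 such terms give 231, and the two calls add 1.\<close>
    have "real (bit_length B) * real n \<le> (21 * l) * real T" using bounds(5) T l1 by (intro mult_mono) auto
    moreover have "1 * (real T + real S) \<le> l * (real T + real S)" using l1 by (intro mult_right_mono) auto
    moreover have "0 \<le> l * real S" using l1 by simp
    ultimately show "real X \<le> 232 * l * (real T + real S)" by (simp add: X_def algebra_simps)
  qed (use bounds(4) \<epsilon> l1 in auto)
  \<comment> \<open>Two factors \<open>l\<close> come from the number of trials and one from the bit
    length of \<open>B\<close>. The numerical product is about \<open>4 * 10 ^ 9\<close>, far below
    \<open>C\<close>.\<close>
  also have "\<dots> = (20000 * 864 * 232) * (2 / \<epsilon>) ^ 5 * l powr 3 * (real T + real S)"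
    using l1 powr_realpow[of l 3] by (simp add: power3_eq_cube power2_eq_square)
  also have "\<dots> \<le> C * (2 / \<epsilon>) powr (C * log 2 (1 / \<epsilon>)) * l powr C * (real T + real S)"
    by (rule absorb_polynomial[OF \<epsilon> l1]) (simp_all add: C_def)
  finally have "real t_total \<le> C * (2 / \<epsilon>) powr (C * log 2 (1 / \<epsilon>)) * l powr C * (real T + real S)" .
  then show ?thesis
    using succeeds_withinI[of ?E "reduce classical_verifier classical_reader" k "[x]" t_total "\<lambda>\<sigma>. get_vec n 2 \<sigma> = M *\<^sub>v x" "1 / 3"] reduce_run
    by (simp add: k_def l_def)
qed

section \<open>Reading a matrix entry coherently\<close>

text \<open>Reading an entry never errs, so the zero potential suffices, whereas the postcondition
  has to see the quantum memory.\<close>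

abbreviation runq :: "env \<Rightarrow> com \<Rightarrow> store \<Rightarrow> qstate \<Rightarrow> nat \<Rightarrow> (store \<Rightarrow> qstate \<Rightarrow> bool) \<Rightarrow> bool" where
  "runq E c \<sigma> \<psi> t Q \<equiv> run_from E c \<sigma> \<psi> t Q (\<lambda>_. 0) 0"

lemmas runq_Seq = run_from_Seq[where f = "\<lambda>_. 0" and g = "\<lambda>_. 0"]
lemmas runq_While = run_from_While[where f = "\<lambda>_. 0"]

lemma runq_mono:
  assumes "runq E c \<sigma> \<psi> t Q" "t \<le> t'" "\<And>\<sigma>' \<psi>'. Q \<sigma>' \<psi>' \<Longrightarrow> Q' \<sigma>' \<psi>'"
  shows "runq E c \<sigma> \<psi> t' Q'"
  by (rule run_from_mono[OF assms(1,2), of 0]) (use assms(3) in auto)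

lemma runq_Do:
  assumes "effect E i \<sigma> \<psi> = return_pmf (\<sigma>', \<psi>')" "instr_cost E i \<sigma> \<le> t" "Q \<sigma>' \<psi>'"
  shows "runq E (Do i) \<sigma> \<psi> t Q"
  by (rule run_from_Do[OF assms(1,2)]) (use assms(3) in simp_all)

lemma runq_assign:
  assumes "bdd B \<sigma>" "B \<ge> 2" "small_exp B f" "Q (put a 0 (val \<sigma> f) \<sigma>) \<psi>"
  shows "runq E (assign a f) \<sigma> \<psi> (bit_length B * (2 + (esize f)\<^sup>2)) Q"
proof (rule runq_Do)
  have "val_cost \<sigma> (Const 0) \<le> bit_length B * 1" using val_cost_le[OF assms(1,2), of "Const 0"] by simp
  then show "instr_cost E (Assign a (Const 0) f) \<sigma> \<le> bit_length B * (2 + (esize f)\<^sup>2)"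
    using val_cost_le[OF assms(1-3)] bit_length_ge_1[of B] by (simp add: algebra_simps)
qed (use assms(4) in auto)

definition ket :: "nat \<Rightarrow> qstate" where
  "ket m k = (if k = m then 1 else 0)"

lemma zero_ket_eq: "zero_ket = ket 0"
  by (simp add: zero_ket_def ket_def fun_eq_iff)

lemma flip_bit_flip_bit: "flip_bit q (flip_bit q k) = (k :: nat)"
  by (rule bit_eqI) (auto simp: bit_flip_bit_iff)

lemma gate_X_ket: "gate_X q (ket m) = ket (flip_bit q m)"
  using flip_bit_flip_bit by (auto simp: gate_X_def ket_def fun_eq_iff)

text \<open>One step of loading a number into a block of qubits: the lowest bit of \<open>u\<close>
  decides about a NOT gate on qubit \<open>p\<close>, and the other bits start one place higher.
  With exclusive or this holds for every label \<open>m\<close>, whatever the block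
  contains.\<close>

lemma xor_push_bit_step:
  "Bit_Operations.xor m (push_bit p u) =
     Bit_Operations.xor (if odd u then flip_bit p m else m) (push_bit (Suc p) (u div 2))" for m p u :: nat
proof (rule bit_eqI)
  fix k
  have "bit (push_bit p u) k \<longleftrightarrow> k = p \<and> odd u \<or> bit (push_bit (Suc p) (u div 2)) k"
  proof (cases k p rule: linorder_cases)
    case greater
    then have "k - p = Suc (k - Suc p)" by simp
    then have "bit u (k - p) = bit (u div 2) (k - Suc p)" by (simp only: bit_Suc)
    then show ?thesis using greater by (simp add: bit_push_bit_iff del: push_bit_Suc)
  qed (auto simp: bit_push_bit_iff bit_0 simp del: push_bit_Suc)
  moreover have "\<not> bit (push_bit (Suc p) (u div 2)) p" by (simp add: bit_push_bit_iff del: push_bit_Suc)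
  ultimately show "bit (Bit_Operations.xor m (push_bit p u)) k =
      bit (Bit_Operations.xor (if odd u then flip_bit p m else m) (push_bit (Suc p) (u div 2))) k"
    by (auto simp: bit_xor_iff bit_flip_bit_iff simp del: push_bit_Suc)
qed

definition load_body :: "exp \<Rightarrow> com" where
  "load_body e = Seq (Cond (parity_exp (scalar 30)) (Do (QX (Add (scalar 31) e))) Skip)
     (Seq (assign 30 (Div (scalar 30) (Const 2))) (assign 31 (Add (scalar 31) (Const 1))))"

definition load :: "nat \<Rightarrow> exp \<Rightarrow> com" where
  "load a e = Seq (assign 30 (scalar a)) (Seq (assign 31 (Const 0)) (While (scalar 30) (load_body e)))"

definition t_load :: "nat \<Rightarrow> nat \<Rightarrow> exp \<Rightarrow> nat" where
  "t_load l w e = l * 6 + (l * 3 + (w * (l * 5 + (l * 200 + (l * (1 + (2 + esize e)\<^sup>2) + l * 22))) + l * 5))"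

text \<open>The invariant says that the current label, combined with the bits not yet loaded, is the
  intended final label. The offset \<open>e\<close> may depend only on the dimension, because the
  loop changes the scratch arrays.\<close>

lemma load_run:
  assumes b: "bdd B \<sigma>" and B: "n + 2 \<le> B" "3 \<le> B" and n0: "\<sigma> 0 0 = n" and a: "a < 30" "\<sigma> a 0 \<le> n" and n1: "n \<ge> 1"
    and e: "small_exp B e" "\<And>\<sigma>. \<sigma> 0 0 = n \<Longrightarrow> val \<sigma> e = s"
  shows "runq E (load a e) \<sigma> (ket m) (t_load (bit_length B) (bit_length n) e)
    (\<lambda>\<sigma>' \<psi>'. bdd B \<sigma>' \<and> same {} \<sigma> \<sigma>' \<and> \<psi>' = ket (Bit_Operations.xor m (push_bit s (\<sigma> a 0))))"
proof -
  let ?L = "bit_length B"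
  define u where "u = \<sigma> a 0"
  define I where "I \<sigma>' \<psi> \<longleftrightarrow> bdd B \<sigma>' \<and> same {} \<sigma> \<sigma>' \<and> \<sigma>' 31 0 + bl (\<sigma>' 30 0) \<le> bl u \<and>
      (\<exists>m'. \<psi> = ket m' \<and> Bit_Operations.xor m' (push_bit (\<sigma>' 31 0 + s) (\<sigma>' 30 0)) = Bit_Operations.xor m (push_bit s u))" for \<sigma>' \<psi>
  have "bl u \<le> bl n" using a by (simp add: bl_mono u_def)
  then have ub: "bl u \<le> bit_length n" using n1 by (simp add: bl_def)
  also have "\<dots> \<le> n" using n1 by (rule bit_length_le_self)
  finally have un: "bl u \<le> n" .
  have step: "runq E (load_body e) \<sigma>1 \<psi> (?L * 200 + (?L * (1 + (2 + esize e)\<^sup>2) + ?L * 22))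
     (\<lambda>\<sigma>' \<psi>'. I \<sigma>' \<psi>' \<and> bl (\<sigma>' 30 0) < bl (\<sigma>1 30 0))"
    if I: "I \<sigma>1 \<psi>" and nz: "val \<sigma>1 (scalar 30) \<noteq> 0" for \<sigma>1 \<psi>
  proof -
    have b1: "bdd B \<sigma>1" and s1: "same {} \<sigma> \<sigma>1" using I by (auto simp: I_def)
    obtain m' where m': "\<psi> = ket m'"
      "Bit_Operations.xor m' (push_bit (\<sigma>1 31 0 + s) (\<sigma>1 30 0)) = Bit_Operations.xor m (push_bit s u)"
      using I by (auto simp: I_def)
    define m2 where "m2 = (if odd (\<sigma>1 30 0) then flip_bit (\<sigma>1 31 0 + s) m' else m')"
    have es: "val \<sigma>1 e = s" using e(2)[of \<sigma>1] n0 by (simp add: sameD[OF s1])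
    have half: "bl (\<sigma>1 30 0 div 2) + 1 = bl (\<sigma>1 30 0)" using nz by (intro bl_half) simp
    have first: "runq E (Cond (parity_exp (scalar 30)) (Do (QX (Add (scalar 31) e))) Skip) \<sigma>1 \<psi>
        (?L * 200 + ?L * (1 + (2 + esize e)\<^sup>2)) (\<lambda>\<sigma>' \<psi>'. \<sigma>' = \<sigma>1 \<and> \<psi>' = ket m2)"
    proof (rule run_from_Cond)
      show "1 + val_cost \<sigma>1 (parity_exp (scalar 30)) \<le> ?L * 200"
        using val_cost_le[OF b1, of "parity_exp (scalar 30)"] B bit_length_ge_1[of B] by (simp add: power2_eq_square)
      show "runq E (Do (QX (Add (scalar 31) e))) \<sigma>1 \<psi> (?L * (1 + (2 + esize e)\<^sup>2)) (\<lambda>\<sigma>' \<psi>'. \<sigma>' = \<sigma>1 \<and> \<psi>' = ket m2)"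
        if "val \<sigma>1 (parity_exp (scalar 30)) \<noteq> 0"
      proof (rule runq_Do)
        show "effect E (QX (Add (scalar 31) e)) \<sigma>1 \<psi> = return_pmf (\<sigma>1, gate_X (\<sigma>1 31 0 + s) (ket m'))"
          by (simp add: m' es)
        have "odd (\<sigma>1 30 0)" using that by (simp add: minus_mult_div_eq_mod odd_iff_mod_2_eq_one)
        then show "\<sigma>1 = \<sigma>1 \<and> gate_X (\<sigma>1 31 0 + s) (ket m') = ket m2" by (simp add: gate_X_ket m2_def)
        show "instr_cost E (QX (Add (scalar 31) e)) \<sigma>1 \<le> ?L * (1 + (2 + esize e)\<^sup>2)"
          using val_cost_le[OF b1, of "Add (scalar 31) e"] e(1) B bit_length_ge_1[of B]
          by (simp add: algebra_simps del: val_cost.simps)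
      qed
      show "runq E Skip \<sigma>1 \<psi> (?L * (1 + (2 + esize e)\<^sup>2)) (\<lambda>\<sigma>' \<psi>'. \<sigma>' = \<sigma>1 \<and> \<psi>' = ket m2)"
        if "val \<sigma>1 (parity_exp (scalar 30)) = 0"
      proof (rule runq_mono[OF run_from_Skip[where Q = "\<lambda>\<sigma>' \<psi>'. \<sigma>' = \<sigma>1 \<and> \<psi>' = ket m2"]])
        have "even (\<sigma>1 30 0)" using that by (simp add: minus_mult_div_eq_mod even_iff_mod_2_eq_zero)
        then show "\<sigma>1 = \<sigma>1 \<and> \<psi> = ket m2" by (simp add: m' m2_def)
      qed simp_all
    qed
    define \<sigma>2 where "\<sigma>2 = put 30 0 (\<sigma>1 30 0 div 2) \<sigma>1"
    define \<sigma>3 where "\<sigma>3 = put 31 0 (\<sigma>1 31 0 + 1) \<sigma>2"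
    have "\<sigma>1 30 0 \<le> B" using b1 by (simp add: bdd_def)
    then have b2: "bdd B \<sigma>2" unfolding \<sigma>2_def by (intro bdd_put b1) simp
    have "\<sigma>1 31 0 + 1 \<le> bl u" using I half by (auto simp: I_def)
    then have b3: "bdd B \<sigma>3" unfolding \<sigma>3_def using un B by (intro bdd_put b2) simp
    have I3: "I \<sigma>3 (ket m2)"
      unfolding I_def
    proof (intro conjI exI[of _ m2])
      show "same {} \<sigma> \<sigma>3" using s1 by (simp add: \<sigma>3_def \<sigma>2_def same_def put_def)
      show "\<sigma>3 31 0 + bl (\<sigma>3 30 0) \<le> bl u" using I half by (auto simp: I_def \<sigma>3_def \<sigma>2_def put_def)
      show "Bit_Operations.xor m2 (push_bit (\<sigma>3 31 0 + s) (\<sigma>3 30 0)) = Bit_Operations.xor m (push_bit s u)"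
        using xor_push_bit_step[of m' "\<sigma>1 31 0 + s" "\<sigma>1 30 0"] m'(2)
        by (simp add: \<sigma>3_def \<sigma>2_def put_def m2_def)
    qed (use b3 in auto)
    have last: "runq E (Seq (assign 30 (Div (scalar 30) (Const 2))) (assign 31 (Add (scalar 31) (Const 1)))) \<sigma>1 (ket m2)
      (?L * (2 + (esize (Div (scalar 30) (Const 2)))\<^sup>2) + ?L * (2 + (esize (Add (scalar 31) (Const 1)))\<^sup>2))
      (\<lambda>\<sigma>' \<psi>'. I \<sigma>' \<psi>' \<and> bl (\<sigma>' 30 0) < bl (\<sigma>1 30 0))"
    proof (rule runq_Seq[OF runq_assign[where B = B and Q = "\<lambda>\<sigma> \<psi>. \<sigma> = \<sigma>2 \<and> \<psi> = ket m2"]])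
      fix \<sigma>' \<psi>' assume "\<sigma>' = \<sigma>2 \<and> \<psi>' = ket m2"
      moreover have "put 31 0 (val \<sigma>2 (Add (scalar 31) (Const 1))) \<sigma>2 = \<sigma>3"
        by (simp add: \<sigma>3_def \<sigma>2_def put_def)
      moreover have "bl (\<sigma>3 30 0) < bl (\<sigma>1 30 0)" using half by (simp add: \<sigma>3_def \<sigma>2_def put_def)
      ultimately show "runq E (assign 31 (Add (scalar 31) (Const 1))) \<sigma>' \<psi>' (?L * (2 + (esize (Add (scalar 31) (Const 1)))\<^sup>2))
         (\<lambda>\<sigma>' \<psi>'. I \<sigma>' \<psi>' \<and> bl (\<sigma>' 30 0) < bl (\<sigma>1 30 0))"
        using b2 B I3 by (intro runq_assign) auto
    qed (use b1 B in \<open>auto simp: \<sigma>2_def\<close>)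
    have "runq E (load_body e) \<sigma>1 \<psi> ((?L * 200 + ?L * (1 + (2 + esize e)\<^sup>2)) +
       (?L * (2 + (esize (Div (scalar 30) (Const 2)))\<^sup>2) + ?L * (2 + (esize (Add (scalar 31) (Const 1)))\<^sup>2)))
       (\<lambda>\<sigma>' \<psi>'. I \<sigma>' \<psi>' \<and> bl (\<sigma>' 30 0) < bl (\<sigma>1 30 0))"
      unfolding load_body_def by (rule runq_Seq[OF first]) (use last in blast)
    then show ?thesis by (rule runq_mono) (simp_all add: power2_eq_square)
  qed
  have cost: "1 + val_cost \<sigma>1 (scalar 30) \<le> ?L * 5" if "I \<sigma>1 \<psi>" for \<sigma>1 \<psi>
    using val_cost_le[of B \<sigma>1 "scalar 30"] that B bit_length_ge_1[of B] by (simp add: I_def power2_eq_square)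
  define \<sigma>1 where "\<sigma>1 = put 30 0 u \<sigma>"
  define \<sigma>2 where "\<sigma>2 = put 31 0 0 \<sigma>1"
  have b12: "bdd B \<sigma>1" "bdd B \<sigma>2" using b a B by (auto simp: \<sigma>1_def \<sigma>2_def u_def intro!: bdd_put)
  have I2: "I \<sigma>2 (ket m)"
    using b12 by (auto simp: I_def \<sigma>1_def \<sigma>2_def put_def same_def)
  have "runq E (load a e) \<sigma> (ket m)
     (?L * (2 + (esize (scalar a))\<^sup>2) + (?L * (2 + (esize (Const 0))\<^sup>2) +
       (bl (\<sigma>2 30 0) * (?L * 5 + (?L * 200 + (?L * (1 + (2 + esize e)\<^sup>2) + ?L * 22))) + ?L * 5)))
     (\<lambda>\<sigma>' \<psi>'. I \<sigma>' \<psi>' \<and> val \<sigma>' (scalar 30) = 0)"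
    unfolding load_def
  proof (rule runq_Seq[OF runq_assign[where B = B and Q = "\<lambda>\<sigma>' \<psi>. \<sigma>' = \<sigma>1 \<and> \<psi> = ket m"]])
    fix \<sigma>' \<psi>' assume *: "\<sigma>' = \<sigma>1 \<and> \<psi>' = ket m"
    show "runq E (Seq (assign 31 (Const 0)) (While (scalar 30) (load_body e))) \<sigma>' \<psi>' (?L * (2 + (esize (Const 0))\<^sup>2) +
       (bl (\<sigma>2 30 0) * (?L * 5 + (?L * 200 + (?L * (1 + (2 + esize e)\<^sup>2) + ?L * 22))) + ?L * 5))
     (\<lambda>\<sigma>' \<psi>'. I \<sigma>' \<psi>' \<and> val \<sigma>' (scalar 30) = 0)"
    proof (rule runq_Seq[OF runq_assign[where B = B and Q = "\<lambda>\<sigma>' \<psi>. \<sigma>' = \<sigma>2 \<and> \<psi> = ket m"]])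
      fix \<sigma>'' \<psi>'' assume **: "\<sigma>'' = \<sigma>2 \<and> \<psi>'' = ket m"
      show "runq E (While (scalar 30) (load_body e)) \<sigma>'' \<psi>''
        (bl (\<sigma>2 30 0) * (?L * 5 + (?L * 200 + (?L * (1 + (2 + esize e)\<^sup>2) + ?L * 22))) + ?L * 5)
        (\<lambda>\<sigma>' \<psi>'. I \<sigma>' \<psi>' \<and> val \<sigma>' (scalar 30) = 0)"
        using runq_While[where I = I and v = "\<lambda>\<sigma>. bl (\<sigma> 30 0)", OF step cost I2] ** by simp
    qed (use * b12 B in \<open>auto simp: \<sigma>2_def\<close>)
  qed (use b a B in \<open>auto simp: \<sigma>1_def u_def\<close>)
  then show ?thesis
  proof (rule runq_mono)
    have "bl (\<sigma>2 30 0) \<le> bit_length n" using ub by (simp add: \<sigma>2_def \<sigma>1_def put_def)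
    then show "?L * (2 + (esize (scalar a))\<^sup>2) + (?L * (2 + (esize (Const 0))\<^sup>2) +
       (bl (\<sigma>2 30 0) * (?L * 5 + (?L * 200 + (?L * (1 + (2 + esize e)\<^sup>2) + ?L * 22))) + ?L * 5))
       \<le> t_load ?L (bit_length n) e"
      unfolding t_load_def by (intro add_mono mult_le_mono) (auto simp: power2_eq_square)
    fix \<sigma>' \<psi>' assume "I \<sigma>' \<psi>' \<and> val \<sigma>' (scalar 30) = 0"
    then show "bdd B \<sigma>' \<and> same {} \<sigma> \<sigma>' \<and> \<psi>' = ket (Bit_Operations.xor m (push_bit s (\<sigma> a 0)))"
      by (auto simp: I_def u_def)
  qed
qed

abbreviation column_exp :: exp where
  "column_exp \<equiv> Add (scalar 0) (Const 1)"

abbreviation target_exp :: exp where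
  "target_exp \<equiv> Add (scalar 0) (Add (scalar 0) (Const 2))"

abbreviation query_entry :: com where
  "query_entry \<equiv> Do (QQuery (Const 0) column_exp target_exp)"

abbreviation measure_target :: com where
  "measure_target \<equiv> Do (QMeasure 17 (Const 0) target_exp)"

text \<open>The row index is loaded into the qubits from \<open>0\<close> on, the column index into those from \<open>n + 1\<close> on;
  both blocks are shorter than \<open>n + 1\<close>, so that qubit \<open>2 n + 2\<close> is free for the entry.\<close>

definition quantum_reader :: com where
  "quantum_reader = Seq (Do QFresh) (Seq (load 3 (Const 0)) (Seq (load 14 column_exp)
     (Seq query_entry measure_target)))"

lemma bit_less_power: "bit (i::nat) q \<Longrightarrow> i < 2 ^ w \<Longrightarrow> q < w"
  by (metis bit_take_bit_iff take_bit_nat_eq_self)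

text \<open>The target qubit lies outside both address blocks, so flipping it does not change the
  entry addressed. Hence the unitary is composition with an involution \<open>g\<close> on labels
  and maps basis states to basis states. The second claim says that the target is 0 beforehand, so
  that afterwards it shows the entry itself.\<close>

lemma query_unitary_ket:
  assumes i: "i < 2 ^ w" and j: "j < 2 ^ w" and w: "w = bit_length (mdim E)" "w \<le> q" "q + w \<le> t"
  defines "m \<equiv> Bit_Operations.xor (Bit_Operations.xor 0 (push_bit 0 i)) (push_bit q j)"
  shows "query_unitary E 0 q t (ket m) = ket (if entry E i j = 1 then flip_bit t m else m)"
    and "\<not> bit m t"
proof -
  define c where "c k \<longleftrightarrow> entry E (take_bit w k) (take_bit w (drop_bit q k)) = 1" for k
  define g where "g k = (if c k then flip_bit t k else k)" for k
  have t: "t \<notin> {0..<0 + w} \<union> {q..<q + w}" using w by auto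
  have c_flip: "c (flip_bit t k) = c k" for k
  proof -
    have "take_bit w (flip_bit t k) = take_bit w k" "take_bit w (drop_bit q (flip_bit t k)) = take_bit w (drop_bit q k)"
      using w(2,3) by (auto intro!: bit_eqI simp: bit_take_bit_iff bit_drop_bit_eq bit_flip_bit_iff)
    then show ?thesis by (simp add: c_def)
  qed
  have g_g: "g (g k) = k" for k by (simp add: g_def c_flip flip_bit_flip_bit)
  have "query_unitary E 0 q t \<psi> k = \<psi> (g k)" for \<psi> k
    using t by (simp add: query_unitary_def g_def c_def Let_def w(1))
  then have "query_unitary E 0 q t (ket m) = ket (g m)"
    using g_g by (auto simp: ket_def fun_eq_iff)
  moreover have "take_bit w m = i"
    using i w bit_less_power[of i] unfolding m_def
    by (intro bit_eqI) (auto simp: bit_take_bit_iff bit_xor_iff bit_push_bit_iff)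
  moreover have "take_bit w (drop_bit q m) = j"
    using i j w bit_less_power[of i _ w] bit_less_power[of j _ w] unfolding m_def
    by (intro bit_eqI) (fastforce simp: bit_take_bit_iff bit_xor_iff bit_push_bit_iff bit_drop_bit_eq)
  ultimately show "query_unitary E 0 q t (ket m) = ket (if entry E i j = 1 then flip_bit t m else m)"
    by (simp add: g_def c_def)
  show "\<not> bit m t"
    using i j w bit_less_power[of i t w] bit_less_power[of j "t - q" w] unfolding m_def
    by (auto simp: bit_xor_iff bit_push_bit_iff)
qed

lemma outcome_prob_ket: "outcome_prob q b (ket m) = of_bool (bit m q = b)"
proof -
  have "{k. ket m k \<noteq> 0 \<and> bit k q = b} = (if bit m q = b then {m} else {})"
    by (auto simp: ket_def)
  then show ?thesis by (simp add: outcome_prob_def ket_def)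
qed

lemma bernoulli_of_bool: "bernoulli_pmf (of_bool b) = return_pmf b"
proof (rule pmf_eqI)
  show "pmf (bernoulli_pmf (of_bool b)) i = pmf (return_pmf b) i" for i
    by (cases b; cases i) simp_all
qed

definition t_reader :: "nat \<Rightarrow> nat \<Rightarrow> nat" where
  "t_reader l w = 1 + (t_load l w (Const 0) + (t_load l w column_exp + (l * 40 + l * 40)))"

text \<open>The memory remains a basis state throughout and the measurement is therefore
  deterministic. The coherent reader thus meets the same error-free specification as a classical
  read.\<close>

lemma quantum_reader_run:
  assumes b: "bdd B \<sigma>" and B: "n + 2 \<le> B" "3 \<le> B" and n0: "\<sigma> 0 0 = n" "mdim E = n" "n \<ge> 1"
    and ij: "\<sigma> 3 0 \<le> n" "\<sigma> 14 0 \<le> n"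
  shows "run E quantum_reader \<sigma> (t_reader (bit_length B) (bit_length n))
    (\<lambda>\<sigma>'. bdd B \<sigma>' \<and> same {17} \<sigma> \<sigma>' \<and> \<sigma>' 17 0 = bit_nat (entry E (\<sigma> 3 0) (\<sigma> 14 0))) (\<lambda>_. 0) 0"
unfolding run_def
proof
  fix \<psi>
  let ?L = "bit_length B"
  let ?i = "\<sigma> 3 0" and ?j = "\<sigma> 14 0" and ?t = "n + (n + 2)"
  let ?m1 = "Bit_Operations.xor 0 (push_bit 0 ?i)"
  let ?m2 = "Bit_Operations.xor ?m1 (push_bit (n + 1) ?j)"
  let ?m3 = "if entry E ?i ?j = 1 then flip_bit ?t ?m2 else ?m2"
  let ?Q = "\<lambda>\<sigma>' (_ :: qstate). bdd B \<sigma>' \<and> same {17} \<sigma> \<sigma>' \<and> \<sigma>' 17 0 = bit_nat (entry E ?i ?j)"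
  have n_lt: "n < 2 ^ bit_length n" by (rule power_floor_log_less)
  have wn: "bit_length n \<le> n" using n0(3) by (rule bit_length_le_self)
  have lt: "?i < 2 ^ bit_length n" "?j < 2 ^ bit_length n" using ij n_lt by (auto intro: le_less_trans)
  have w: "bit_length n = bit_length (mdim E)" "bit_length n \<le> n + 1" "n + 1 + bit_length n \<le> ?t"
    using wn n0(2) by auto
  note unit = query_unitary_ket[OF lt w]
  have t3: "bit ?m3 ?t \<longleftrightarrow> entry E ?i ?j = 1" using unit(2) by (simp add: bit_flip_bit_iff)
  have measure: "runq E measure_target \<sigma>1 (ket ?m3) (?L * 40) ?Q"
    if 1: "bdd B \<sigma>1" "same {} \<sigma> \<sigma>1" for \<sigma>1
  proof (rule runq_Do)
    have z: "\<sigma>1 0 0 = n" by (simp add: sameD[OF 1(2)] n0)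
    show "effect E (QMeasure 17 (Const 0) target_exp) \<sigma>1 (ket ?m3)
      = return_pmf (put 17 0 (of_bool (bit ?m3 ?t)) \<sigma>1, post_measurement ?t (bit ?m3 ?t) (ket ?m3))"
      by (simp only: effect.simps val.simps z outcome_prob_ket simp_thms bernoulli_of_bool map_return_pmf)
    show "?Q (put 17 0 (of_bool (bit ?m3 ?t)) \<sigma>1) (post_measurement ?t (bit ?m3 ?t) (ket ?m3))"
    proof (intro conjI)
      show "bdd B (put 17 0 (of_bool (bit ?m3 ?t)) \<sigma>1)" using 1 B by (intro bdd_put) auto
    qed (unfold t3, use 1 in \<open>auto simp: bit_nat_def put_def same_def\<close>)
    have "val_cost \<sigma>1 (Const 0) \<le> ?L * 1" "val_cost \<sigma>1 target_exp \<le> ?L * 25"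
      using val_cost_le[OF 1(1), of "Const 0"] val_cost_le[OF 1(1), of target_exp] B
      by (simp_all add: power2_eq_square del: val_cost.simps)
    then show "instr_cost E (QMeasure 17 (Const 0) target_exp) \<sigma>1 \<le> ?L * 40"
      using bit_length_ge_1[of B] by (simp del: val_cost.simps)
  qed
  have query: "runq E query_entry \<sigma>1 (ket ?m2)
     (?L * 40) (\<lambda>\<sigma>' \<psi>'. \<sigma>' = \<sigma>1 \<and> \<psi>' = ket ?m3)" if 1: "bdd B \<sigma>1" "same {} \<sigma> \<sigma>1" for \<sigma>1
  proof (rule runq_Do)
    have z: "\<sigma>1 0 0 = n" by (simp add: sameD[OF 1(2)] n0)
    show "effect E (QQuery (Const 0) column_exp target_exp) \<sigma>1 (ket ?m2)
      = return_pmf (\<sigma>1, ket ?m3)" by (simp only: effect.simps val.simps z unit)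
    have "val_cost \<sigma>1 (Const 0) \<le> ?L * 1" "val_cost \<sigma>1 target_exp \<le> ?L * 25"
      "val_cost \<sigma>1 column_exp \<le> ?L * 9"
      using val_cost_le[OF 1(1), of "Const 0"] val_cost_le[OF 1(1), of target_exp]
        val_cost_le[OF 1(1), of column_exp] B
      by (simp_all add: power2_eq_square del: val_cost.simps)
    then show "instr_cost E (QQuery (Const 0) column_exp target_exp) \<sigma>1 \<le> ?L * 40"
      using bit_length_ge_1[of B] by (simp del: val_cost.simps)
  qed simp
  show "runq E quantum_reader \<sigma> \<psi> (t_reader ?L (bit_length n)) ?Q"
    unfolding quantum_reader_def t_reader_def
  proof (rule runq_Seq)
    show "runq E (Do QFresh) \<sigma> \<psi> 1 (\<lambda>\<sigma>' \<psi>'. \<sigma>' = \<sigma> \<and> \<psi>' = ket 0)"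
      by (rule runq_Do) (auto simp: zero_ket_eq)
    fix \<sigma>' \<psi>' assume "\<sigma>' = \<sigma> \<and> \<psi>' = ket 0"
    then have eq: "\<sigma>' = \<sigma>" "\<psi>' = ket 0" by auto
    show "runq E (Seq (load 3 (Const 0)) (Seq (load 14 column_exp)
     (Seq query_entry measure_target))) \<sigma>' \<psi>'
       (t_load ?L (bit_length n) (Const 0) + (t_load ?L (bit_length n) column_exp + (?L * 40 + ?L * 40))) ?Q"
      unfolding eq
    proof (rule runq_Seq[OF load_run[where B = B and n = n and s = 0]])
      fix \<sigma>1 \<psi>1 assume 1: "bdd B \<sigma>1 \<and> same {} \<sigma> \<sigma>1 \<and> \<psi>1 = ket ?m1"
      then have s1: "same {} \<sigma> \<sigma>1" by simp
      have v1: "\<sigma>1 14 0 = ?j" "\<sigma>1 0 0 = n" by (simp_all add: sameD[OF s1] n0)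
      have "runq E (Seq (load 14 column_exp)
        (Seq query_entry measure_target)) \<sigma>1 (ket ?m1)
       (t_load ?L (bit_length n) column_exp + (?L * 40 + ?L * 40)) ?Q"
      proof (rule runq_Seq[OF load_run[where B = B and n = n and s = "n + 1"]])
        fix \<sigma>2 \<psi>2 assume 2: "bdd B \<sigma>2 \<and> same {} \<sigma>1 \<sigma>2 \<and> \<psi>2 = ket (Bit_Operations.xor ?m1 (push_bit (n + 1) (\<sigma>1 14 0)))"
        then have s2: "same {} \<sigma> \<sigma>2" using same_trans[OF s1, of "{}" \<sigma>2 "{}"] by simp
        have \<psi>2: "\<psi>2 = ket ?m2" using 2 v1 by simp
        show "runq E (Seq query_entry
          measure_target) \<sigma>2 \<psi>2 (?L * 40 + ?L * 40) ?Q"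
          unfolding \<psi>2
        proof (rule runq_Seq[OF query])
          fix \<sigma>3 \<psi>3 assume "\<sigma>3 = \<sigma>2 \<and> \<psi>3 = ket ?m3"
          then show "runq E measure_target \<sigma>3 \<psi>3 (?L * 40) ?Q"
            using measure 2 s2 by blast
        qed (use 2 s2 in auto)
      qed (use 1 v1 B ij n0 in auto)
      then show "runq E (Seq (load 14 column_exp)
        (Seq query_entry measure_target)) \<sigma>1 \<psi>1
       (t_load ?L (bit_length n) column_exp + (?L * 40 + ?L * 40)) ?Q"
        using 1 by simp
    qed (use b B ij n0 in auto)
  qed
qed

section \<open>Hosting the quantum verifier\<close>

text \<open>The given verifier expects its data in the lowest arrays and may overwrite any array it
  names. Moving all its arrays up by 40 keeps them apart from the caller's. Array names are static
  and not charged, so the running time is unchanged.\<close>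

fun shift_exp :: "exp \<Rightarrow> exp" where
  "shift_exp (Const k) = Const k"
| "shift_exp (Get a e) = Get (a + 40) (shift_exp e)"
| "shift_exp (Add e f) = Add (shift_exp e) (shift_exp f)"
| "shift_exp (Sub e f) = Sub (shift_exp e) (shift_exp f)"
| "shift_exp (Mul e f) = Mul (shift_exp e) (shift_exp f)"
| "shift_exp (Div e f) = Div (shift_exp e) (shift_exp f)"

fun shift_instr :: "instr \<Rightarrow> instr" where
  "shift_instr (Assign a e f) = Assign (a + 40) (shift_exp e) (shift_exp f)"
| "shift_instr (Fresh a) = Fresh (a + 40)"
| "shift_instr (Flip a e) = Flip (a + 40) (shift_exp e)"
| "shift_instr (Read a e i j) = Read (a + 40) (shift_exp e) (shift_exp i) (shift_exp j)"
| "shift_instr (CallAlg a b) = CallAlg (a + 40) (b + 40)"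
| "shift_instr (CallVer a b c) = CallVer (a + 40) (b + 40) (c + 40)"
| "shift_instr QFresh = QFresh"
| "shift_instr (QX e) = QX (shift_exp e)"
| "shift_instr (QH e) = QH (shift_exp e)"
| "shift_instr (QT e) = QT (shift_exp e)"
| "shift_instr (QCNOT e f) = QCNOT (shift_exp e) (shift_exp f)"
| "shift_instr (QQuery e f g) = QQuery (shift_exp e) (shift_exp f) (shift_exp g)"
| "shift_instr (QMeasure a e f) = QMeasure (a + 40) (shift_exp e) (shift_exp f)"

fun shift :: "com \<Rightarrow> com" where
  "shift Skip = Skip"
| "shift (Do i) = Do (shift_instr i)"
| "shift (Seq c d) = Seq (shift c) (shift d)"
| "shift (Cond e c d) = Cond (shift_exp e) (shift c) (shift d)"
| "shift (While e c) = While (shift_exp e) (shift c)"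

fun exp_arrays :: "exp \<Rightarrow> nat set" where
  "exp_arrays (Const k) = {}"
| "exp_arrays (Get a e) = insert a (exp_arrays e)"
| "exp_arrays (Add e f) = exp_arrays e \<union> exp_arrays f"
| "exp_arrays (Sub e f) = exp_arrays e \<union> exp_arrays f"
| "exp_arrays (Mul e f) = exp_arrays e \<union> exp_arrays f"
| "exp_arrays (Div e f) = exp_arrays e \<union> exp_arrays f"

fun instr_arrays :: "instr \<Rightarrow> nat set" where
  "instr_arrays (Assign a e f) = insert a (exp_arrays e \<union> exp_arrays f)"
| "instr_arrays (Fresh a) = {a}"
| "instr_arrays (Flip a e) = insert a (exp_arrays e)"
| "instr_arrays (Read a e i j) = insert a (exp_arrays e \<union> exp_arrays i \<union> exp_arrays j)"
| "instr_arrays (CallAlg a b) = {a, b}"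
| "instr_arrays (CallVer a b c) = {a, b, c}"
| "instr_arrays QFresh = {}"
| "instr_arrays (QX e) = exp_arrays e"
| "instr_arrays (QH e) = exp_arrays e"
| "instr_arrays (QT e) = exp_arrays e"
| "instr_arrays (QCNOT e f) = exp_arrays e \<union> exp_arrays f"
| "instr_arrays (QQuery e f g) = exp_arrays e \<union> exp_arrays f \<union> exp_arrays g"
| "instr_arrays (QMeasure a e f) = insert a (exp_arrays e \<union> exp_arrays f)"

fun arrays :: "com \<Rightarrow> nat set" where
  "arrays Skip = {}"
| "arrays (Do i) = instr_arrays i"
| "arrays (Seq c d) = arrays c \<union> arrays d"
| "arrays (Cond e c d) = exp_arrays e \<union> arrays c \<union> arrays d"
| "arrays (While e c) = exp_arrays e \<union> arrays c"

text \<open>Finiteness lets a fixed prologue clear every array that the hosted program can touch,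
  which makes repeated calls possible.\<close>

lemma finite_arrays: "finite (arrays c)"
proof -
  have e: "finite (exp_arrays e)" for e by (induction e) auto
  have "finite (instr_arrays i)" for i by (cases i) (auto simp: e)
  then show ?thesis by (induction c) (auto simp: e)
qed

lemma uses_shift: "uses (shift c) = uses c"
proof -
  have "instr_uses (shift_instr i) = instr_uses i" for i by (cases i) auto
  then show ?thesis by (induction c) auto
qed

text \<open>A simulation relation between a standalone run and a hosted one: \<open>u\<close> is the
  time already spent by the caller, and \<open>\<sigma>\<close> records the caller's arrays, which
  stay frozen.\<close>

definition embedded :: "nat set \<Rightarrow> store \<Rightarrow> nat \<Rightarrow> state \<Rightarrow> state \<Rightarrow> bool" where
  "embedded S \<sigma> u s t \<longleftrightarrow> (\<forall>a\<in>S. store t (a + 40) = store s a) \<and> (\<forall>a<40. store t a = \<sigma> a) \<and>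
     qmem t = qmem s \<and> elapsed t = u + elapsed s"

lemma val_shift:
  assumes "\<forall>a\<in>S. \<tau> (a + 40) = \<sigma> a" "exp_arrays e \<subseteq> S"
  shows "val \<tau> (shift_exp e) = val \<sigma> e" "val_cost \<tau> (shift_exp e) = val_cost \<sigma> e"
  using assms by (induction e) auto

lemma exec_shift:
  assumes "instr_uses i \<subseteq> {Quantum}" "instr_arrays i \<subseteq> S" "embedded S \<sigma> u s t"
  shows "rel_pmf (embedded S \<sigma> u) (exec E i s) (exec E (shift_instr i) t)"
proof -
  have eq: "\<forall>a\<in>S. store t (a + 40) = store s a" and q: "qmem t = qmem s" "elapsed t = u + elapsed s"
    and old: "\<forall>a<40. store t a = \<sigma> a"
    using assms(3) by (auto simp: embedded_def)
  note v = val_shift[OF eq]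
  show ?thesis
    using assms(1,2) eq q old
    by (cases i)
      (auto simp: exec_def v embedded_def put_def pmf.rel_map intro!: rel_pmf_reflI)
qed

lemma embedded_tick:
  assumes "embedded S \<sigma> u s t" "exp_arrays e \<subseteq> S"
  shows "embedded S \<sigma> u (tick e s) (tick (shift_exp e) t)" "test (shift_exp e) t = test e s"
  using assms val_shift[of S "store t" "store s" e] by (simp_all add: embedded_def tick_def test_def)

text \<open>The hosted continuation must depend on \<open>t\<close> alone, although several states
  \<open>s\<close> may be related to the same \<open>t\<close>. Since the semantics is functional,
  one choice per \<open>t\<close> agrees with the witnesses for all of them.\<close>

lemma rel_pmf_bind_big_step:
  assumes rel: "rel_pmf R \<mu> \<mu>'"
    and ex: "\<And>s t. s \<in> set_pmf \<mu> \<Longrightarrow> R s t \<Longrightarrow> \<exists>\<nu>'. big_step E d t \<nu>' \<and> rel_pmf R' (\<nu> s) \<nu>'"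
  obtains \<nu>' where "\<And>t. t \<in> set_pmf \<mu>' \<Longrightarrow> big_step E d t (\<nu>' t)"
    "rel_pmf R' (bind_pmf \<mu> \<nu>) (bind_pmf \<mu>' \<nu>')"
proof
  define \<nu>' where "\<nu>' t = (SOME \<nu>'. big_step E d t \<nu>')" for t
  have step: "big_step E d t (\<nu>' t) \<and> rel_pmf R' (\<nu> s) (\<nu>' t)" if st: "s \<in> set_pmf \<mu>" "R s t" for s t
  proof -
    obtain \<nu>1 where 1: "big_step E d t \<nu>1" "rel_pmf R' (\<nu> s) \<nu>1" using ex[OF st] by blast
    have "big_step E d t (\<nu>' t)" unfolding \<nu>'_def by (rule someI[of _ \<nu>1]) (rule 1)
    with 1 show ?thesis using big_step_unique by blast
  qed
  show "big_step E d t (\<nu>' t)" if "t \<in> set_pmf \<mu>'" for t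
    using rel_pmf_imp_rel_set[OF rel] that step by (auto simp: rel_set_def)
  have "rel_pmf (\<lambda>s t. R s t \<and> s \<in> set_pmf \<mu>) \<mu> \<mu>'"
    by (rule pmf.rel_mono_strong[OF rel]) auto
  then show "rel_pmf R' (bind_pmf \<mu> \<nu>) (bind_pmf \<mu>' \<nu>')"
    by (rule rel_pmf_bindI) (use step in blast)
qed

lemma big_step_shift:
  assumes "big_step E c s \<mu>" "uses c \<subseteq> {Quantum}" "arrays c \<subseteq> S" "embedded S \<sigma> u s t"
  shows "\<exists>\<mu>'. big_step E (shift c) t \<mu>' \<and> rel_pmf (embedded S \<sigma> u) \<mu> \<mu>'"
  using assms
proof (induction arbitrary: t rule: big_step.induct)
  case (Skip s)
  then show ?case by (intro exI[of _ "return_pmf t"]) (auto intro: big_step.Skip)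
next
  case (Do i s)
  then show ?case by (intro exI[of _ "exec E (shift_instr i) t"]) (auto intro: big_step.Do exec_shift)
next
  case (Seq c s \<mu> d \<nu>)
  obtain \<mu>' where 1: "big_step E (shift c) t \<mu>'" "rel_pmf (embedded S \<sigma> u) \<mu> \<mu>'"
    using Seq.IH(1)[of t] Seq.prems by auto
  obtain \<nu>' where 2: "\<And>t. t \<in> set_pmf \<mu>' \<Longrightarrow> big_step E (shift d) t (\<nu>' t)"
    "rel_pmf (embedded S \<sigma> u) (bind_pmf \<mu> \<nu>) (bind_pmf \<mu>' \<nu>')"
    by (rule rel_pmf_bind_big_step[OF 1(2), of E "shift d" "embedded S \<sigma> u" \<nu>]) (use Seq.IH(2) Seq.prems in auto)
  from big_step.Seq[OF 1(1) 2(1)] 2(2) show ?case by auto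
next
  case (CondTrue e s c \<mu> d)
  note t = embedded_tick[of S \<sigma> u s t e]
  obtain \<mu>' where 1: "big_step E (shift c) (tick (shift_exp e) t) \<mu>'" "rel_pmf (embedded S \<sigma> u) \<mu> \<mu>'"
    using CondTrue.IH[OF _ _ t(1)] CondTrue.prems by auto
  have "big_step E (shift (Cond e c d)) t \<mu>'"
    using 1(1) t(2) CondTrue.prems CondTrue.hyps by (auto intro: big_step.CondTrue)
  with 1(2) show ?case by blast
next
  case (CondFalse e s d \<mu> c)
  note t = embedded_tick[of S \<sigma> u s t e]
  obtain \<mu>' where 1: "big_step E (shift d) (tick (shift_exp e) t) \<mu>'" "rel_pmf (embedded S \<sigma> u) \<mu> \<mu>'"
    using CondFalse.IH[OF _ _ t(1)] CondFalse.prems by auto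
  have "big_step E (shift (Cond e c d)) t \<mu>'"
    using 1(1) t(2) CondFalse.prems CondFalse.hyps by (auto intro: big_step.CondFalse)
  with 1(2) show ?case by blast
next
  case (WhileFalse e s c)
  note t = embedded_tick[of S \<sigma> u s t e]
  have "big_step E (shift (While e c)) t (return_pmf (tick (shift_exp e) t))"
    using t(2) WhileFalse.prems WhileFalse.hyps by (auto intro: big_step.WhileFalse)
  then show ?case using t(1) WhileFalse.prems by (intro exI[of _ "return_pmf (tick (shift_exp e) t)"]) auto
next
  case (WhileTrue e s c \<mu> \<nu>)
  note t = embedded_tick[of S \<sigma> u s t e]
  obtain \<mu>' where 1: "big_step E (shift c) (tick (shift_exp e) t) \<mu>'" "rel_pmf (embedded S \<sigma> u) \<mu> \<mu>'"
    using WhileTrue.IH(1)[OF _ _ t(1)] WhileTrue.prems by auto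
  obtain \<nu>' where 2: "\<And>t. t \<in> set_pmf \<mu>' \<Longrightarrow> big_step E (shift (While e c)) t (\<nu>' t)"
    "rel_pmf (embedded S \<sigma> u) (bind_pmf \<mu> \<nu>) (bind_pmf \<mu>' \<nu>')"
    by (rule rel_pmf_bind_big_step[OF 1(2), of E "shift (While e c)" "embedded S \<sigma> u" \<nu>])
      (use WhileTrue.IH(2) WhileTrue.prems in auto)
  have "test (shift_exp e) t" using t(2) WhileTrue.prems WhileTrue.hyps by auto
  from big_step.WhileTrue[OF this 1(1)] 2 show ?case by auto
qed

section \<open>Growth of cells along a run\<close>

lemma bit_length_val_le: "bit_length (val \<sigma> e) \<le> val_cost \<sigma> e"
  by (cases e) auto

text \<open>Writing a value costs at least its bit length, so no cell can outgrow the elapsed time.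
  Such a bound is needed to charge for reading the verdict, which lies outside the arrays covered by
  \<open>bdd\<close>.\<close>

lemma exec_cells:
  assumes "instr_uses i \<subseteq> {Quantum}" "\<And>a j. bit_length (store s a j) \<le> b + elapsed s" "1 \<le> b" "s' \<in> set_pmf (exec E i s)"
  shows "bit_length (store s' a j) \<le> b + elapsed s'"
proof -
  have one: "bit_length 0 = 1" "bit_length (Suc 0) = 1" by (simp_all add: bit_length_def)
  show ?thesis
    using assms(1,3,4) assms(2)[of a j]
  proof (cases i)
    case (Assign a' e f)
    then show ?thesis
      using assms(4) assms(2)[of a j] bit_length_val_le[of "store s" f] by (auto simp: exec_def put_def)
  qed (auto simp: exec_def put_def one)
qed

lemma tick_cells:
  assumes "\<And>a j. bit_length (store s a j) \<le> b + elapsed s"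
  shows "bit_length (store (tick e s) a j) \<le> b + elapsed (tick e s)"
  using assms[of a j] by (simp add: tick_def)

lemma big_step_cells:
  assumes "big_step E c s \<mu>" "uses c \<subseteq> {Quantum}" "\<And>a j. bit_length (store s a j) \<le> b + elapsed s" "1 \<le> b"
    "s' \<in> set_pmf \<mu>"
  shows "bit_length (store s' a j) \<le> b + elapsed s'"
  using assms
proof (induction arbitrary: s' a j rule: big_step.induct)
  case (Do i s)
  show ?case by (rule exec_cells[OF _ Do.prems(2-4)]) (use Do.prems(1) in simp)
next
  case (Seq c s \<mu> d \<nu>)
  obtain s1 where s1: "s1 \<in> set_pmf \<mu>" "s' \<in> set_pmf (\<nu> s1)" using Seq.prems(4) by auto
  have c: "uses c \<subseteq> {Quantum}" "uses d \<subseteq> {Quantum}" using Seq.prems(1) by auto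
  show ?case
    by (rule Seq.IH(2)[OF s1(1) c(2) Seq.IH(1)[OF c(1) Seq.prems(2,3) s1(1)] Seq.prems(3) s1(2)])
next
  case (CondTrue e s c \<mu> d)
  have c: "uses c \<subseteq> {Quantum}" using CondTrue.prems(1) by auto
  show ?case by (rule CondTrue.IH[OF c tick_cells[OF CondTrue.prems(2)] CondTrue.prems(3,4)])
next
  case (CondFalse e s d \<mu> c)
  have c: "uses d \<subseteq> {Quantum}" using CondFalse.prems(1) by auto
  show ?case by (rule CondFalse.IH[OF c tick_cells[OF CondFalse.prems(2)] CondFalse.prems(3,4)])
next
  case (WhileFalse e s c)
  have "s' = tick e s" using WhileFalse.prems(4) by simp
  then show ?case using tick_cells[OF WhileFalse.prems(2)] by simp
next
  case (WhileTrue e s c \<mu> \<nu>)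
  obtain s1 where s1: "s1 \<in> set_pmf \<mu>" "s' \<in> set_pmf (\<nu> s1)" using WhileTrue.prems(4) by auto
  have c: "uses c \<subseteq> {Quantum}" using WhileTrue.prems(1) by auto
  show ?case
    by (rule WhileTrue.IH(2)[OF s1(1) WhileTrue.prems(1)
        WhileTrue.IH(1)[OF c tick_cells[OF WhileTrue.prems(2)] WhileTrue.prems(3) s1(1)] WhileTrue.prems(3) s1(2)])
next
  case (Skip s)
  then show ?case by simp
qed

text \<open>The set \<open>S\<close> must contain all arrays the program names; the properties
  \<open>P\<close> and \<open>P'\<close> correspond because they look only at these arrays, on which
  both runs agree.\<close>

lemma run_shift:
  assumes c: "uses c \<subseteq> {Quantum}" "arrays c \<subseteq> S"
    and step: "big_step E c \<lparr>store = \<tau>, qmem = zero_ket, elapsed = 0\<rparr> \<mu>"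
    and time: "\<And>s. s \<in> set_pmf \<mu> \<Longrightarrow> elapsed s \<le> t"
    and prob: "measure_pmf.prob \<mu> {s. P (store s)} \<ge> 1 - p" and p: "0 \<le> p"
    and \<sigma>: "\<And>a. a \<in> S \<Longrightarrow> \<sigma> (a + 40) = \<tau> a"
    and P: "\<And>\<tau>' \<sigma>'. (\<And>a. a \<in> S \<Longrightarrow> \<sigma>' (a + 40) = \<tau>' a) \<Longrightarrow> P' \<sigma>' = P \<tau>'"
    and cells: "\<And>a j. bit_length (\<tau> a j) \<le> b" "1 \<le> b"
  shows "run E (Seq (Do QFresh) (shift c)) \<sigma> (1 + t)
    (\<lambda>\<sigma>'. (\<forall>a<40. \<sigma>' a = \<sigma> a) \<and> (\<forall>a\<in>S. \<forall>j. bit_length (\<sigma>' (a + 40) j) \<le> b + t))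
    (\<lambda>\<sigma>'. of_bool (\<not> P' \<sigma>')) (ennreal p)"
  unfolding run_def run_from_def
proof (intro allI)
  fix \<psi> e
  let ?s = "\<lparr>store = \<tau>, qmem = zero_ket, elapsed = 0\<rparr>"
  let ?t = "\<lparr>store = \<sigma>, qmem = zero_ket, elapsed = e + 1\<rparr>"
  have "embedded S \<sigma> (e + 1) ?s ?t" using \<sigma> by (simp add: embedded_def)
  then obtain \<mu>' where \<mu>': "big_step E (shift c) ?t \<mu>'" "rel_pmf (embedded S \<sigma> (e + 1)) \<mu> \<mu>'"
    using big_step_shift[OF step c] by blast
  \<comment> \<open>A coupling of the two final distributions: time and cell bounds follow on its
    support, and the error probability is compared through its marginals.\<close>
  then obtain pq where pq: "\<And>x y. (x, y) \<in> set_pmf pq \<Longrightarrow> embedded S \<sigma> (e + 1) x y"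
    "map_pmf fst pq = \<mu>" "map_pmf snd pq = \<mu>'"
    by (auto elim: rel_pmf.cases)
  have "exec E QFresh \<lparr>store = \<sigma>, qmem = \<psi>, elapsed = e\<rparr> = return_pmf ?t"
    by (simp add: exec_def)
  then have "big_step E (Do QFresh) \<lparr>store = \<sigma>, qmem = \<psi>, elapsed = e\<rparr> (return_pmf ?t)"
    by (metis big_step.Do)
  then have "big_step E (Seq (Do QFresh) (shift c)) \<lparr>store = \<sigma>, qmem = \<psi>, elapsed = e\<rparr> (bind_pmf (return_pmf ?t) (\<lambda>_. \<mu>'))"
    by (rule big_step.Seq) (use \<mu>'(1) in auto)
  then have big: "big_step E (Seq (Do QFresh) (shift c)) \<lparr>store = \<sigma>, qmem = \<psi>, elapsed = e\<rparr> \<mu>'"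
    by (simp add: bind_return_pmf)
  have supp: "((\<forall>a<40. store y a = \<sigma> a) \<and> (\<forall>a\<in>S. \<forall>j. bit_length (store y (a + 40) j) \<le> b + t)) \<and> elapsed y \<le> e + (1 + t)"
    if y: "y \<in> set_pmf \<mu>'" for y
  proof -
    obtain x where x: "(x, y) \<in> set_pmf pq" using y pq(3) by auto
    then have "x \<in> set_pmf \<mu>" using pq(2) by force
    note em = pq(1)[OF x, unfolded embedded_def]
    have "bit_length (store x a j) \<le> b + elapsed x" for a j
      by (rule big_step_cells[OF step c(1) _ cells(2) \<open>x \<in> set_pmf \<mu>\<close>]) (use cells in simp)
    then have "bit_length (store x a j) \<le> b + t" for a j
      using time[OF \<open>x \<in> set_pmf \<mu>\<close>] by (meson add_left_mono order_trans)
    then show ?thesis using em time[OF \<open>x \<in> set_pmf \<mu>\<close>] by simp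
  qed
  have "(\<integral>\<^sup>+ y. of_bool (\<not> P' (store y)) \<partial>measure_pmf \<mu>') = (\<integral>\<^sup>+ z. of_bool (\<not> P' (store (snd z))) \<partial>measure_pmf pq)"
    unfolding pq(3)[symmetric] by simp
  also have "\<dots> \<le> (\<integral>\<^sup>+ z. of_bool (\<not> P (store (fst z))) \<partial>measure_pmf pq)"
  proof (rule nn_integral_pmf_mono)
    fix z assume "z \<in> set_pmf pq"
    then have "embedded S \<sigma> (e + 1) (fst z) (snd z)" using pq(1)[of "fst z" "snd z"] by simp
    then have "P' (store (snd z)) = P (store (fst z))" by (intro P) (simp add: embedded_def)
    then show "of_bool (\<not> P' (store (snd z))) \<le> (of_bool (\<not> P (store (fst z))) :: ennreal)" by simp
  qed
  also have "\<dots> = (\<integral>\<^sup>+ x. of_bool (\<not> P (store x)) \<partial>measure_pmf \<mu>)"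
    unfolding pq(2)[symmetric] by simp
  also have "\<dots> = emeasure (measure_pmf \<mu>) {s. \<not> P (store s)}"
  proof -
    have "of_bool (\<not> P (store s)) = (indicator {s. \<not> P (store s)} s :: ennreal)" for s :: state by simp
    then show ?thesis by (simp only:) (rule nn_integral_indicator, simp)
  qed
  also have "\<dots> \<le> ennreal p"
  proof -
    have "measure_pmf.prob \<mu> {s. \<not> P (store s)} = 1 - measure_pmf.prob \<mu> {s. P (store s)}"
      by (subst measure_pmf.prob_compl[symmetric]) (auto intro!: arg_cong[of _ _ "measure_pmf.prob \<mu>"])
    then show ?thesis using prob by (simp add: measure_pmf.emeasure_eq_measure ennreal_leI)
  qed
  finally show "\<exists>\<mu>. big_step E (Seq (Do QFresh) (shift c)) \<lparr>store = \<sigma>, qmem = \<psi>, elapsed = e\<rparr> \<mu> \<and>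
      (\<forall>s \<in> set_pmf \<mu>. ((\<forall>a<40. store s a = \<sigma> a) \<and> (\<forall>a\<in>S. \<forall>j. bit_length (store s (a + 40) j) \<le> b + t)) \<and>
         elapsed s \<le> e + (1 + t)) \<and>
      (\<integral>\<^sup>+ s. of_bool (\<not> P' (store s)) \<partial>measure_pmf \<mu>) \<le> ennreal p"
    using big supp by blast
qed

section \<open>Calling the hosted verifier\<close>

primrec fresh_arrays :: "nat \<Rightarrow> com" where
  "fresh_arrays 0 = Skip"
| "fresh_arrays (Suc m) = Seq (fresh_arrays m) (Do (Fresh (m + 40)))"

lemma fresh_arrays_run:
  "run E (fresh_arrays m) \<sigma> m (\<lambda>\<sigma>'. (\<forall>a<40. \<sigma>' a = \<sigma> a) \<and> (\<forall>a<m. \<sigma>' (a + 40) = (\<lambda>_. 0))) (\<lambda>_. 0) 0"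
proof (induction m)
  case 0
  then show ?case by (simp add: run_Skip)
next
  case (Suc m)
  have "run E (fresh_arrays (Suc m)) \<sigma> (m + 1)
    (\<lambda>\<sigma>'. (\<forall>a<40. \<sigma>' a = \<sigma> a) \<and> (\<forall>a<Suc m. \<sigma>' (a + 40) = (\<lambda>_. 0))) (\<lambda>_. 0) 0"
    unfolding fresh_arrays.simps
  proof (rule run_Seq_sure[OF Suc])
    fix \<sigma>1 assume *: "(\<forall>a<40. \<sigma>1 a = \<sigma> a) \<and> (\<forall>a<m. \<sigma>1 (a + 40) = (\<lambda>_. 0))"
    show "run E (Do (Fresh (m + 40))) \<sigma>1 1
      (\<lambda>\<sigma>'. (\<forall>a<40. \<sigma>' a = \<sigma> a) \<and> (\<forall>a<Suc m. \<sigma>' (a + 40) = (\<lambda>_. 0))) (\<lambda>_. 0) 0"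
      by (rule run_Do[where \<sigma>' = "\<sigma>1(m + 40 := (\<lambda>_. 0))" and \<psi>' = id]) (use * in \<open>auto simp: less_Suc_eq\<close>)
  qed
  then show ?case by simp
qed

lemma bdd_cong: "(\<And>a. a < 40 \<Longrightarrow> \<sigma>' a = \<sigma> a) \<Longrightarrow> bdd B \<sigma>' = bdd B \<sigma>"
  by (simp add: bdd_def)

lemma bit_nat_of_nat: "bit_nat (of_nat c) = c mod 2"
proof -
  have "(of_nat c :: bit) = of_bool (odd c)" by (induction c) auto
  then show ?thesis by (simp add: bit_nat_def odd_iff_mod_2_eq_one)
qed

text \<open>The reduction may keep unreduced sums in a vector's cells, while
  \<open>input_store\<close> contains bits; the parity makes the copy match it literally.\<close>

definition copy_in_body :: "nat \<Rightarrow> nat \<Rightarrow> com" where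
  "copy_in_body dst src = Do (Assign dst (scalar 30) (parity_exp (Get src (scalar 30))))"

lemma copy_in_run:
  assumes b: "bdd B \<sigma>" and n0: "\<sigma> 0 0 = n" and B: "n + 2 \<le> B" "3 \<le> B" and a: "40 \<le> dst" "src < 30"
    and z: "\<sigma> dst = (\<lambda>_. 0)"
  shows "run E (for_dim 30 (copy_in_body dst src)) \<sigma> (n * (bit_length B * 100 + bit_length B * 28) + bit_length B * 20)
     (\<lambda>\<sigma>'. (\<forall>a. a \<noteq> 30 \<longrightarrow> a \<noteq> dst \<longrightarrow> \<sigma>' a = \<sigma> a) \<and> bdd B \<sigma>' \<and>
        \<sigma>' dst = (\<lambda>i. if i < n then bit_nat (get_vec n src \<sigma> $ i) else 0)) (\<lambda>_. 0) 0"
proof -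
  let ?L = "bit_length B"
  define I where "I j \<sigma>' \<longleftrightarrow> (\<forall>a. a \<noteq> 30 \<longrightarrow> a \<noteq> dst \<longrightarrow> \<sigma>' a = \<sigma> a) \<and>
     \<sigma>' dst = (\<lambda>i. if i < j then \<sigma> src i mod 2 else 0)" for j and \<sigma>' :: store
  have "run E (for_dim 30 (copy_in_body dst src)) \<sigma> (n * (?L * 100 + ?L * 28) + ?L * 20)
     (\<lambda>\<sigma>'. bdd B \<sigma>' \<and> \<sigma>' 30 0 = n \<and> \<sigma>' 0 0 = n \<and> I n \<sigma>') (\<lambda>_. 0) 0"
  proof (rule run_for_dim[where B = B and n = n and I = I and f = "\<lambda>_ _. 0", OF _ _ _ _ _ _ _ _ _ order_refl])
    fix j \<sigma>1
    assume j: "j < n" and I: "I j \<sigma>1" and b1: "bdd B \<sigma>1" and j3: "\<sigma>1 30 0 = j" and n1: "\<sigma>1 0 0 = n"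
    have src: "\<sigma>1 src = \<sigma> src" using I a by (simp add: I_def)
    show "run E (copy_in_body dst src) \<sigma>1 (?L * 100)
        (\<lambda>\<sigma>'. bdd B \<sigma>' \<and> \<sigma>' 30 0 = j \<and> \<sigma>' 0 0 = n \<and> I (Suc j) (put 30 0 (Suc j) \<sigma>')) (\<lambda>_. 0) 0"
      unfolding copy_in_body_def
    proof (rule run_Do[where \<sigma>' = "put dst j (\<sigma> src j mod 2) \<sigma>1" and \<psi>' = id])
      show "effect E (Assign dst (scalar 30) (parity_exp (Get src (scalar 30)))) \<sigma>1 \<psi> =
         return_pmf (put dst j (\<sigma> src j mod 2) \<sigma>1, id \<psi>)" for \<psi>
        by (simp add: j3 src minus_mult_div_eq_mod)
      have "val_cost \<sigma>1 (scalar 30) \<le> ?L * 4" "val_cost \<sigma>1 (parity_exp (Get src (scalar 30))) \<le> ?L * 64"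
        using val_cost_le[OF b1, of "scalar 30"] val_cost_le[OF b1, of "parity_exp (Get src (scalar 30))"] a B
        by (simp_all add: power2_eq_square del: val_cost.simps)
      then show "instr_cost E (Assign dst (scalar 30) (parity_exp (Get src (scalar 30)))) \<sigma>1 \<le> ?L * 100"
        using bit_length_ge_1[of B] by (simp del: val_cost.simps)
      have "bdd B (put dst j (\<sigma> src j mod 2) \<sigma>1) = bdd B \<sigma>1"
        by (rule bdd_cong) (use a in \<open>auto simp: put_def\<close>)
      then show "bdd B (put dst j (\<sigma> src j mod 2) \<sigma>1) \<and> put dst j (\<sigma> src j mod 2) \<sigma>1 30 0 = j \<and>
          put dst j (\<sigma> src j mod 2) \<sigma>1 0 0 = n \<and> I (Suc j) (put 30 0 (Suc j) (put dst j (\<sigma> src j mod 2) \<sigma>1))"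
        using a b1 j3 n1 I by (auto simp: I_def put_def less_Suc_eq fun_eq_iff)
    qed simp_all
  qed (use b n0 B a z in \<open>auto simp: I_def put_def\<close>)
  then show ?thesis
    by (rule run_mono) (auto simp: I_def get_vec_def bit_nat_of_nat fun_eq_iff)
qed

text \<open>The verifier's guarantee concerns one initial store, which is rebuilt before each call:
  remains of earlier calls are erased, and \<open>einv\<close> is entered as the accuracy, since the
  requested error is \<open>1 / einv\<close>. The number \<open>m\<close> depends only on the
  verifier, so the program stays uniform.\<close>

definition prepare :: "nat \<Rightarrow> com" where
  "prepare m = Seq (fresh_arrays m) (Seq (assign 40 (scalar 0)) (Seq (Do (Assign 40 (Const 1) (scalar 18)))
     (Seq (for_dim 30 (copy_in_body 41 8)) (for_dim 30 (copy_in_body 42 9)))))"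

definition t_copy_in :: "nat \<Rightarrow> nat \<Rightarrow> nat" where
  "t_copy_in l n = n * (l * 100 + l * 28) + l * 20"

lemma prepare_run:
  assumes b: "bdd B \<sigma>" and n0: "\<sigma> 0 0 = n" and B: "n + 2 \<le> B" "3 \<le> B" and m: "4 \<le> m"
  shows "run E (prepare m) \<sigma> (m + (bit_length B * 10 + (bit_length B * 10 + (t_copy_in (bit_length B) n + t_copy_in (bit_length B) n))))
     (\<lambda>\<sigma>'. bdd B \<sigma>' \<and> same {} \<sigma> \<sigma>' \<and> (\<forall>a<m. \<sigma>' (a + 40) = input_store n (\<sigma> 18 0) [get_vec n 8 \<sigma>, get_vec n 9 \<sigma>] a)) (\<lambda>_. 0) 0"
  unfolding prepare_def
proof (rule run_Seq_sure[OF fresh_arrays_run])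
  let ?L = "bit_length B"
  let ?Q = "\<lambda>\<sigma>'. bdd B \<sigma>' \<and> same {} \<sigma> \<sigma>' \<and> (\<forall>a<m. \<sigma>' (a + 40) = input_store n (\<sigma> 18 0) [get_vec n 8 \<sigma>, get_vec n 9 \<sigma>] a)"
  fix \<sigma>1 assume 1: "(\<forall>a<40. \<sigma>1 a = \<sigma> a) \<and> (\<forall>a<m. \<sigma>1 (a + 40) = (\<lambda>_. 0))"
  have b1: "bdd B \<sigma>1" using b 1 bdd_cong[of \<sigma>1 \<sigma>] by simp
  define \<sigma>2 where "\<sigma>2 = put 40 0 n \<sigma>1"
  define \<sigma>3 where "\<sigma>3 = put 40 1 (\<sigma> 18 0) \<sigma>2"
  have 2: "\<sigma>2 a = \<sigma> a" "\<sigma>3 a = \<sigma> a" if "a < 40" for a using 1 that by (simp_all add: \<sigma>2_def \<sigma>3_def put_def)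
  have b2: "bdd B \<sigma>2" "bdd B \<sigma>3" using b bdd_cong[of \<sigma>2 \<sigma>] bdd_cong[of \<sigma>3 \<sigma>] 2 by auto
  have fr: "\<sigma>1 40 = (\<lambda>_. 0)" using 1 m by (metis add_0 less_le_trans zero_less_numeral)
  have high: "\<sigma>3 40 = (\<lambda>i. if i = 0 then n else if i = 1 then \<sigma> 18 0 else 0)"
    by (auto simp: \<sigma>3_def \<sigma>2_def put_def fr)
  have zero: "\<sigma>3 (a + 40) = (\<lambda>_. 0)" if "0 < a" "a < m" for a
    using 1 that by (simp add: \<sigma>3_def \<sigma>2_def put_def)
  have cost: "val_cost \<sigma>' (scalar a) \<le> ?L * 4" "val_cost \<sigma>' (Const c) \<le> ?L" if "bdd B \<sigma>'" "a < 40" "c \<le> 1" for \<sigma>' a c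
    using val_cost_le[OF that(1), of "scalar a"] val_cost_le[OF that(1), of "Const c"] that B
    by (simp_all add: power2_eq_square del: val_cost.simps)
  show "run E (Seq (assign 40 (scalar 0)) (Seq (Do (Assign 40 (Const 1) (scalar 18)))
     (Seq (for_dim 30 (copy_in_body 41 8)) (for_dim 30 (copy_in_body 42 9))))) \<sigma>1
     (?L * 10 + (?L * 10 + (t_copy_in ?L n + t_copy_in ?L n))) ?Q (\<lambda>_. 0) 0"
  proof (rule run_Seq_sure)
    show "run E (assign 40 (scalar 0)) \<sigma>1 (?L * 10) (\<lambda>\<sigma>'. \<sigma>' = \<sigma>2) (\<lambda>_. 0) 0"
    proof (rule run_Do[where \<sigma>' = \<sigma>2 and \<psi>' = id])
      show "instr_cost E (Assign 40 (Const 0) (scalar 0)) \<sigma>1 \<le> ?L * 10"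
        using cost[OF b1, of 0 0] bit_length_ge_1[of B] by (simp del: val_cost.simps)
    qed (use 1 n0 in \<open>auto simp: \<sigma>2_def\<close>)
    fix \<sigma>' assume \<sigma>': "\<sigma>' = \<sigma>2"
    show "run E (Seq (Do (Assign 40 (Const 1) (scalar 18)))
       (Seq (for_dim 30 (copy_in_body 41 8)) (for_dim 30 (copy_in_body 42 9)))) \<sigma>'
       (?L * 10 + (t_copy_in ?L n + t_copy_in ?L n)) ?Q (\<lambda>_. 0) 0"
      unfolding \<sigma>'
    proof (rule run_Seq_sure)
      show "run E (Do (Assign 40 (Const 1) (scalar 18))) \<sigma>2 (?L * 10) (\<lambda>\<sigma>'. \<sigma>' = \<sigma>3) (\<lambda>_. 0) 0"
      proof (rule run_Do[where \<sigma>' = \<sigma>3 and \<psi>' = id])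
        show "instr_cost E (Assign 40 (Const 1) (scalar 18)) \<sigma>2 \<le> ?L * 10"
          using cost[OF b2(1), of 18 1] bit_length_ge_1[of B] by (simp del: val_cost.simps)
      qed (use 2 in \<open>auto simp: \<sigma>3_def\<close>)
      fix \<sigma>'' assume \<sigma>'': "\<sigma>'' = \<sigma>3"
      show "run E (Seq (for_dim 30 (copy_in_body 41 8)) (for_dim 30 (copy_in_body 42 9))) \<sigma>''
         (t_copy_in ?L n + t_copy_in ?L n) ?Q (\<lambda>_. 0) 0"
        unfolding \<sigma>'' t_copy_in_def
      proof (rule run_Seq_sure[OF copy_in_run])
        show "\<sigma>3 41 = (\<lambda>_. 0)" using zero[of 1] m by simp
        show "\<sigma>3 0 0 = n" using 2 n0 by simp
        fix \<sigma>4
        assume 4: "(\<forall>a. a \<noteq> 30 \<longrightarrow> a \<noteq> 41 \<longrightarrow> \<sigma>4 a = \<sigma>3 a) \<and> bdd B \<sigma>4 \<and>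
          \<sigma>4 41 = (\<lambda>i. if i < n then bit_nat (get_vec n 8 \<sigma>3 $ i) else 0)"
        show "run E (for_dim 30 (copy_in_body 42 9)) \<sigma>4 (n * (?L * 100 + ?L * 28) + ?L * 20) ?Q (\<lambda>_. 0) 0"
        proof (rule run_mono[OF copy_in_run[where B = B]])
          show "\<sigma>4 42 = (\<lambda>_. 0)" using 4 zero[of 2] m by simp
          show "\<sigma>4 0 0 = n" using 4 2 n0 by simp
          fix \<sigma>5
          assume 5: "(\<forall>a. a \<noteq> 30 \<longrightarrow> a \<noteq> 42 \<longrightarrow> \<sigma>5 a = \<sigma>4 a) \<and> bdd B \<sigma>5 \<and>
            \<sigma>5 42 = (\<lambda>i. if i < n then bit_nat (get_vec n 9 \<sigma>4 $ i) else 0)"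
          have v: "get_vec n 8 \<sigma>3 = get_vec n 8 \<sigma>" "get_vec n 9 \<sigma>4 = get_vec n 9 \<sigma>"
            using 2 4 by (simp_all add: get_vec_def)
          have "\<sigma>5 (a + 40) = input_store n (\<sigma> 18 0) [get_vec n 8 \<sigma>, get_vec n 9 \<sigma>] a" if a: "a < m" for a
          proof -
            consider "a = 0" | "a = 1" | "a = 2" | "a \<ge> 3" by linarith
            then show ?thesis
            proof cases
              case 1 then show ?thesis using 4 5 high by (simp add: input_store_def fun_eq_iff)
            next
              case 2 then show ?thesis using 4 5 v by (simp add: input_store_def fun_eq_iff)
            next
              case 3 then show ?thesis using 4 5 v by (simp add: input_store_def fun_eq_iff)
            next
              case _: 4
              then have "\<sigma>5 (a + 40) = \<sigma>3 (a + 40)" using \<open>_ \<and> bdd B \<sigma>4 \<and> _\<close> 5 by simp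
              then show ?thesis using zero[of a] a \<open>a \<ge> 3\<close> by (simp add: input_store_def fun_eq_iff)
            qed
          qed
          then show "?Q \<sigma>5" using 2 4 5 by (auto simp: same_def)
        qed (use 4 B in auto)
      qed (use b2 B in auto)
    qed
  qed
qed

text \<open>The verdict may be any nonzero number. Normalising it brings the result back under the
  bound \<open>B\<close>, and inspecting it is the one read whose cost is not bounded through
  \<open>bdd\<close>.\<close>

definition conclude :: com where
  "conclude = Cond (scalar 43) (assign 12 (Const 1)) (assign 12 (Const 0))"

lemma conclude_run:
  assumes b: "bdd B \<sigma>" and B: "3 \<le> B" and v: "bit_length (\<sigma> 43 0) \<le> t"
  shows "run E conclude \<sigma> ((2 + t) + bit_length B * 3)
    (\<lambda>\<sigma>'. bdd B \<sigma>' \<and> same {12} \<sigma> \<sigma>' \<and> \<sigma>' 12 0 = of_bool (\<sigma> 43 0 \<noteq> 0)) (\<lambda>_. 0) 0"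
  unfolding conclude_def
proof (rule run_Cond)
  have "bit_length 0 = 1" by (simp add: bit_length_def)
  then show "1 + val_cost \<sigma> (scalar 43) \<le> 2 + t" using v by simp
  show "run E (assign 12 (Const 1)) \<sigma> (bit_length B * 3)
    (\<lambda>\<sigma>'. bdd B \<sigma>' \<and> same {12} \<sigma> \<sigma>' \<and> \<sigma>' 12 0 = of_bool (\<sigma> 43 0 \<noteq> 0)) (\<lambda>_. 0) 0"
    if "val \<sigma> (scalar 43) \<noteq> 0"
    by (rule run_straight[where B = B]) (use that b B in \<open>auto simp: put_def same_def\<close>)
  show "run E (assign 12 (Const 0)) \<sigma> (bit_length B * 3)
    (\<lambda>\<sigma>'. bdd B \<sigma>' \<and> same {12} \<sigma> \<sigma>' \<and> \<sigma>' 12 0 = of_bool (\<sigma> 43 0 \<noteq> 0)) (\<lambda>_. 0) 0"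
    if "val \<sigma> (scalar 43) = 0"
    by (rule run_straight[where B = B]) (use that b B in \<open>auto simp: put_def same_def\<close>)
qed

definition hosted_verifier :: "nat \<Rightarrow> com \<Rightarrow> com" where
  "hosted_verifier m Q = Seq (prepare m) (Seq (Seq (Do QFresh) (shift Q)) conclude)"

definition t_verifier :: "nat \<Rightarrow> nat \<Rightarrow> nat \<Rightarrow> nat \<Rightarrow> nat" where
  "t_verifier m l n t = (m + (l * 10 + (l * 10 + (t_copy_in l n + t_copy_in l n)))) +
     ((1 + t) + ((2 + (l + t)) + l * 3))"

lemma hosted_verifier_run:
  assumes b: "bdd B \<sigma>" and n0: "\<sigma> 0 0 = n" "mdim E = n" and B: "n + 2 \<le> B" "3 \<le> B" and m: "4 \<le> m"
    and Q: "uses Q \<subseteq> {Quantum}" "arrays Q \<subseteq> {..<m}"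
    and ok: "succeeds_within E Q (\<sigma> 18 0) [get_vec n 8 \<sigma>, get_vec n 9 \<sigma>] t (1 - p) (\<lambda>\<sigma>'. \<sigma>' 3 0 \<noteq> 0 \<longleftrightarrow> R)"
    and p: "0 \<le> p"
  shows "run E (hosted_verifier m Q) \<sigma> (t_verifier m (bit_length B) n (nat \<lfloor>t\<rfloor>))
    (\<lambda>\<sigma>'. bdd B \<sigma>' \<and> same {12} \<sigma> \<sigma>' \<and> \<sigma>' 12 0 \<le> 1) (\<lambda>\<sigma>'. of_bool ((\<sigma>' 12 0 \<noteq> 0) \<noteq> R)) (ennreal p)"
  unfolding hosted_verifier_def t_verifier_def
proof (rule run_Seq_sure[OF prepare_run[OF b n0(1) B m]])
  let ?L = "bit_length B"
  let ?\<tau> = "input_store n (\<sigma> 18 0) [get_vec n 8 \<sigma>, get_vec n 9 \<sigma>]"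
  fix \<sigma>1
  assume 1: "bdd B \<sigma>1 \<and> same {} \<sigma> \<sigma>1 \<and> (\<forall>a<m. \<sigma>1 (a + 40) = ?\<tau> a)"
  obtain \<mu> where \<mu>: "big_step E Q \<lparr>store = ?\<tau>, qmem = zero_ket, elapsed = 0\<rparr> \<mu>"
    "\<And>s. s \<in> set_pmf \<mu> \<Longrightarrow> real (elapsed s) \<le> t" "measure_pmf.prob \<mu> {s. store s 3 0 \<noteq> 0 \<longleftrightarrow> R} \<ge> 1 - p"
    using ok n0(2) unfolding succeeds_within_def by auto
  have "?\<tau> a j \<le> B" for a j
    using B b by (auto simp: input_store_def bit_nat_def bdd_def)
  then have cells: "bit_length (?\<tau> a j) \<le> ?L" for a j by (intro bit_length_mono)
  have "run E (Seq (Do QFresh) (shift Q)) \<sigma>1 (1 + nat \<lfloor>t\<rfloor>)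
    (\<lambda>\<sigma>'. (\<forall>a<40. \<sigma>' a = \<sigma>1 a) \<and> (\<forall>a\<in>{..<m}. \<forall>j. bit_length (\<sigma>' (a + 40) j) \<le> ?L + nat \<lfloor>t\<rfloor>))
    (\<lambda>\<sigma>'. of_bool (\<not> (\<sigma>' 43 0 \<noteq> 0 \<longleftrightarrow> R))) (ennreal p)"
  proof (rule run_shift[OF Q \<mu>(1) _ \<mu>(3) p _ _ cells bit_length_ge_1])
    show "elapsed s \<le> nat \<lfloor>t\<rfloor>" if "s \<in> set_pmf \<mu>" for s
      using \<mu>(2)[OF that] by (simp add: le_nat_iff le_floor_iff)
    show "\<sigma>1 (a + 40) = ?\<tau> a" if "a \<in> {..<m}" for a using 1 that by simp
    show "(\<sigma>' 43 0 \<noteq> 0 \<longleftrightarrow> R) = (\<tau>' 3 0 \<noteq> 0 \<longleftrightarrow> R)" if "\<And>a. a \<in> {..<m} \<Longrightarrow> \<sigma>' (a + 40) = \<tau>' a" for \<sigma>' \<tau>' :: store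
      using that[of 3] m by simp
  qed
  then show "run E (Seq (Seq (Do QFresh) (shift Q)) conclude) \<sigma>1 ((1 + nat \<lfloor>t\<rfloor>) + ((2 + (?L + nat \<lfloor>t\<rfloor>)) + ?L * 3))
    (\<lambda>\<sigma>'. bdd B \<sigma>' \<and> same {12} \<sigma> \<sigma>' \<and> \<sigma>' 12 0 \<le> 1) (\<lambda>\<sigma>'. of_bool ((\<sigma>' 12 0 \<noteq> 0) \<noteq> R)) (ennreal p)"
  proof (rule run_Seq)
    fix \<sigma>2
    assume 2: "(\<forall>a<40. \<sigma>2 a = \<sigma>1 a) \<and> (\<forall>a\<in>{..<m}. \<forall>j. bit_length (\<sigma>2 (a + 40) j) \<le> ?L + nat \<lfloor>t\<rfloor>)"
    have b2: "bdd B \<sigma>2" using 1 2 bdd_cong[of \<sigma>2 \<sigma>1] by simp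
    have "3 \<in> {..<m}" using m by simp
    then have "bit_length (\<sigma>2 (3 + 40) 0) \<le> ?L + nat \<lfloor>t\<rfloor>" using 2 by blast
    then have v: "bit_length (\<sigma>2 43 0) \<le> ?L + nat \<lfloor>t\<rfloor>" by simp
    show "run E conclude \<sigma>2 ((2 + (?L + nat \<lfloor>t\<rfloor>)) + ?L * 3)
      (\<lambda>\<sigma>'. bdd B \<sigma>' \<and> same {12} \<sigma> \<sigma>' \<and> \<sigma>' 12 0 \<le> 1) (\<lambda>\<sigma>'. of_bool ((\<sigma>' 12 0 \<noteq> 0) \<noteq> R))
      (of_bool (\<not> (\<sigma>2 43 0 \<noteq> 0 \<longleftrightarrow> R)))"
      by (rule run_mono[OF run_bound[OF conclude_run[OF b2 B(2) v],
            where b' = "of_bool (\<not> (\<sigma>2 43 0 \<noteq> 0 \<longleftrightarrow> R))" and g' = "\<lambda>\<sigma>'. of_bool ((\<sigma>' 12 0 \<noteq> 0) \<noteq> R)"]])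
        (use 1 2 in \<open>auto simp: same_def\<close>)
  qed
qed

section \<open>The quantum instance\<close>

lemma uses_hosted_verifier: "uses Q \<subseteq> {Quantum} \<Longrightarrow> uses (hosted_verifier m Q) \<subseteq> {Quantum}"
proof -
  have "uses (fresh_arrays m) = {}" by (induction m) auto
  then show "uses Q \<subseteq> {Quantum} \<Longrightarrow> uses (hosted_verifier m Q) \<subseteq> {Quantum}"
    by (auto simp: hosted_verifier_def prepare_def for_dim_def copy_in_body_def conclude_def uses_shift)
qed

lemma uses_quantum_reader: "uses quantum_reader \<subseteq> {Quantum}"
  by (simp add: quantum_reader_def load_def load_body_def)

lemma t_verifier_le:
  assumes "1 \<le> n" "1 \<le> l"
  shows "real (t_verifier m l n t) \<le> (real m + 330) * (real l * real n) + 2 * real t"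
proof -
  have ln: "1 * 1 \<le> l * n" "l * 1 \<le> l * n" using assms by (intro mult_le_mono; simp)+
  have "t_verifier m l n t = m * 1 + 3 + 64 * l + 256 * (l * n) + 2 * t"
    by (simp add: t_verifier_def t_copy_in_def algebra_simps)
  also have "\<dots> \<le> m * (l * n) + 3 * (l * n) + 64 * (l * n) + 256 * (l * n) + 2 * t"
    using ln by (intro add_mono mult_le_mono2) auto
  finally have "real (t_verifier m l n t) \<le> real (m * (l * n) + 3 * (l * n) + 64 * (l * n) + 256 * (l * n) + 2 * t)"
    by (simp only: of_nat_le_iff)
  also have "\<dots> = (real m + 323) * (real l * real n) + 2 * real t" by (simp add: algebra_simps)
  also have "\<dots> \<le> (real m + 330) * (real l * real n) + 2 * real t"
    by (intro add_right_mono mult_right_mono) auto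
  finally show ?thesis .
qed

lemma t_reader_le:
  assumes "1 \<le> w" "1 \<le> l"
  shows "t_reader l w \<le> 600 * (w * l)"
proof -
  have "t_reader l w = 1 + 108 * l + 490 * (w * l)"
    by (simp add: t_reader_def t_load_def power2_eq_square algebra_simps)
  moreover have "1 * 1 \<le> w * l" "1 * l \<le> w * l" using assms by (intro mult_le_mono; simp)+
  ultimately show ?thesis by linarith
qed

text \<open>The constant \<open>C\<close> in the verifier's specification is an arbitrary real,
  possibly negative. Replacing it by \<open>max C 1\<close> restores monotonicity both as a factor
  and as an exponent.\<close>

lemma quantum_time_bound:
  fixes C n l l' :: real
  assumes "1 \<le> l'" "l' \<le> 21 * l"
  shows "real (nat \<lfloor>C * n powr (3 / 2) * l' powr C\<rfloor>) \<le> max C 1 * 21 powr max C 1 * l powr max C 1 * n powr (3 / 2)"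
proof -
  let ?C = "max C 1"
  have "C * n powr (3 / 2) * l' powr C \<le> ?C * n powr (3 / 2) * (21 * l) powr ?C"
  proof (intro mult_mono)
    have "l' powr C \<le> l' powr ?C" using assms by (intro powr_mono) auto
    also have "\<dots> \<le> (21 * l) powr ?C" using assms by (intro powr_mono2) auto
    finally show "l' powr C \<le> (21 * l) powr ?C" .
  qed auto
  also have "\<dots> = ?C * 21 powr ?C * l powr ?C * n powr (3 / 2)"
    using assms by (subst powr_mult) auto
  finally have "C * n powr (3 / 2) * l' powr C \<le> ?C * 21 powr ?C * l powr ?C * n powr (3 / 2)" .
  moreover have "0 \<le> ?C * 21 powr ?C * l powr ?C * n powr (3 / 2)" by simp
  ultimately show ?thesis by linarith
qed

text \<open>The constants depend on \<open>m\<close> and \<open>C0\<close>, hence on the verifier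
  and not on the instance. In \<open>C\<close>, the summand \<open>C1 + 4\<close> provides the
  exponent of the logarithm: \<open>C1 + 2\<close> for the cost collected in \<open>X\<close> and 2
  for the number of trials.\<close>

lemma quantum_reduction:
  fixes M :: "bit mat" and m n :: nat and C0 :: real
  defines "C1 \<equiv> max C0 1"
  defines "K \<equiv> 21 * (real m + 330) + 30000 + 2 * (C1 * 21 powr C1)"
  defines "C \<equiv> 20000 * 864 * K + C1 + 4"
  assumes Q: "uses Q \<subseteq> {Quantum}" "arrays Q \<subseteq> {..<m}" and m: "4 \<le> m"
    and ver: "\<And>E (\<eta>::real) z y. mdim E \<ge> 1 \<Longrightarrow> matr E \<in> carrier_mat (mdim E) (mdim E) \<Longrightarrow>
        z \<in> carrier_vec (mdim E) \<Longrightarrow> y \<in> carrier_vec (mdim E) \<Longrightarrow> 0 < \<eta> \<Longrightarrow> \<eta> \<le> 1 / 2 \<Longrightarrow>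
        succeeds_within E Q (nat \<lceil>1 / \<eta>\<rceil>) [z, y]
          (C0 * real (mdim E) powr (3 / 2) * log 2 (real (mdim E) / \<eta>) powr C0)
          (1 - \<eta>) (\<lambda>\<sigma>. \<sigma> 3 0 \<noteq> 0 \<longleftrightarrow> y = matr E *\<^sub>v z)"
    and n: "n \<ge> 1" and \<epsilon>: "0 < \<epsilon>" "\<epsilon> \<le> 1 / 2" and M: "M \<in> carrier_mat n n"
    and \<O>: "\<O> \<in> carrier_vec n \<rightarrow> carrier_vec n"
    and dense: "measure_pmf.prob (pmf_of_set (carrier_vec n)) {z. \<O> z = M *\<^sub>v z} \<ge> \<epsilon>"
    and T: "T \<ge> n" and x: "x \<in> carrier_vec n"
  shows "succeeds_within
      \<lparr>mdim = n, matr = M, alg = \<O>, ver = \<V>, alg_cost = T, ver_cost = S\<rparr>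
      (reduce (hosted_verifier m Q) quantum_reader) (nat \<lceil>1 / \<epsilon>\<rceil>) [x]
      (C * (2 / \<epsilon>) powr (C * log 2 (1 / \<epsilon>)) * log 2 (real n / \<epsilon>) powr C * (real T + real n powr (3 / 2)))
      (2 / 3) (\<lambda>\<sigma>. get_vec n 2 \<sigma> = M *\<^sub>v x)"
proof -
  let ?E = "\<lparr>mdim = n, matr = M, alg = \<O>, ver = \<V>, alg_cost = T, ver_cost = S\<rparr>"
  define k where "k = nat \<lceil>1 / \<epsilon>\<rceil>"
  define D where "D = 2 * k + 1"
  define N where "N = 24 * k ^ 3 * bit_length n"
  define einv where "einv = 12 * k * bit_length n * N * D"
  define B where "B = einv + n + 2"
  define l where "l = log 2 (real n / \<epsilon>)"
  define L where "L = bit_length B"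
  define t where "t = C0 * real n powr (3 / 2) * log 2 (real n * real einv) powr C0"
  define tv where "tv = t_verifier m L n (nat \<lfloor>t\<rfloor>)"
  define tr where "tr = t_reader L (bit_length n)"
  note bounds = parameter_bounds[OF n \<epsilon> k_def D_def N_def einv_def, folded l_def B_def L_def]
  have W: "bit_length n \<ge> 1" and L1: "L \<ge> 1" by (simp_all only: bit_length_ge_1 L_def)
  have "0 < einv" using bounds(1) W by (simp only: einv_def D_def N_def nat_0_less_mult_iff) auto
  \<comment> \<open>The verifier is specified only for errors of at most 1/2; being positive and
    even, \<open>einv\<close> is at least 2.\<close>
  moreover have "2 dvd einv" by (simp add: einv_def)
  ultimately have e2: "einv \<ge> 2" by (auto dest: dvd_imp_le)
  have B3: "3 \<le> B" "n + 2 \<le> B" using e2 by (auto simp: B_def)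
  interpret reduction ?E n k D N einv B tv tr M x "hosted_verifier m Q" quantum_reader
  proof
    show "2 ^ n \<le> real (card {z \<in> carrier_vec n. alg ?E z = M *\<^sub>v z}) * real k"
      using dense_answers[OF dense bounds(2) \<epsilon>(1)] by simp
    fix \<sigma> :: store
    assume b: "bdd B \<sigma>" and n0: "\<sigma> 0 0 = n"
    {
      assume einv0: "\<sigma> 18 0 = einv"
      show "run ?E (hosted_verifier m Q) \<sigma> tv (\<lambda>\<sigma>'. bdd B \<sigma>' \<and> same {12} \<sigma> \<sigma>' \<and> \<sigma>' 12 0 \<le> 1)
        (\<lambda>\<sigma>'. of_bool ((\<sigma>' 12 0 \<noteq> 0) \<noteq> (get_vec n 9 \<sigma> = M *\<^sub>v get_vec n 8 \<sigma>))) (ennreal (1 / einv))"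
        unfolding tv_def L_def
      proof (rule hosted_verifier_run[OF b n0 _ B3(2,1) m Q])
        have "nat \<lceil>1 / (1 / real einv)\<rceil> = einv" by simp
        then show "succeeds_within ?E Q (\<sigma> 18 0) [get_vec n 8 \<sigma>, get_vec n 9 \<sigma>] t (1 - 1 / real einv)
          (\<lambda>\<sigma>'. (\<sigma>' 3 0 \<noteq> 0) = (get_vec n 9 \<sigma> = M *\<^sub>v get_vec n 8 \<sigma>))"
          using ver[of ?E "get_vec n 8 \<sigma>" "get_vec n 9 \<sigma>" "1 / real einv"] n M e2
          by (simp add: einv0 t_def get_vec_def)
      qed simp_all
    }
    {
      assume "\<sigma> 3 0 < n" "\<sigma> 14 0 \<le> n"
      then show "run ?E quantum_reader \<sigma> tr (\<lambda>\<sigma>'. bdd B \<sigma>' \<and> same {17} \<sigma> \<sigma>' \<and>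
          \<sigma>' 17 0 = bit_nat (entry ?E (\<sigma> 3 0) (\<sigma> 14 0))) (\<lambda>_. 0) 0"
        unfolding tr_def L_def using quantum_reader_run[OF b B3(2,1) n0, of ?E] n by simp
    }
  qed (use n M x \<O> bounds in \<open>auto simp: D_def N_def einv_def B_def\<close>)
  define X where "X = L * n + T + tv + n * tr"
  define Z where "Z = real T + real n powr (3 / 2)"
  have Z: "0 \<le> Z" "real T \<le> Z" "real n powr (3 / 2) \<le> Z" by (simp_all add: Z_def)
  have l1: "1 \<le> l" by (rule bounds(3))
  have C1: "1 \<le> C1" by (simp add: C1_def)
  \<comment> \<open>One exponent covers every contribution to \<open>X\<close>: a factor
    \<open>l\<close> from bit lengths, two such factors from reading a column, and
    \<open>l powr C1\<close> from the verifier.\<close>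
  have pow: "l \<le> l powr (C1 + 2)" "l * l \<le> l powr (C1 + 2)" "1 \<le> l powr (C1 + 2)" "l powr C1 \<le> l powr (C1 + 2)"
  proof -
    show "l \<le> l powr (C1 + 2)" using powr_mono[of 1 "C1 + 2" l] C1 l1 by simp
    show "l * l \<le> l powr (C1 + 2)" using powr_mono[of 2 "C1 + 2" l] C1 l1 by (simp add: power2_eq_square)
    show "1 \<le> l powr (C1 + 2)" using l1 C1 by (intro ge_one_powr_ge_zero) auto
    show "l powr C1 \<le> l powr (C1 + 2)" using l1 by (intro powr_mono) auto
  qed
  define Y where "Y = l powr (C1 + 2) * Z"
  have LT: "real L * real n \<le> 21 * Y"
  proof -
    have "real L * real n \<le> (21 * l) * Z" using bounds(5) T l1 Z by (intro mult_mono) auto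
    also have "\<dots> \<le> 21 * Y" unfolding Y_def using mult_right_mono[OF pow(1) Z(1)] by simp
    finally show ?thesis .
  qed
  have TY: "real T \<le> Y" unfolding Y_def using mult_mono[OF pow(3) Z(2)] pow(3) by simp
  have tY: "real (nat \<lfloor>t\<rfloor>) \<le> (C1 * 21 powr C1) * Y"
  proof -
    have "1 \<le> real n * real einv" "2 \<le> real n * real einv"
      using mult_mono[of 1 "real n" 2 "real einv"] n e2 by auto
    then have "1 \<le> log 2 (real n * real einv)" by (simp add: le_log_iff)
    then have "real (nat \<lfloor>t\<rfloor>) \<le> C1 * 21 powr C1 * l powr C1 * real n powr (3 / 2)"
      unfolding t_def C1_def using bounds(6) by (rule quantum_time_bound)
    also have "\<dots> \<le> (C1 * 21 powr C1) * Y"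
      unfolding Y_def mult.assoc using C1 pow(4) Z by (intro mult_left_mono mult_mono) auto
    finally show ?thesis .
  qed
  have trY: "real n * real tr \<le> 25200 * Y"
  proof -
    have "real tr \<le> 600 * (real (bit_length n) * real L)"
      using t_reader_le[OF W L1] unfolding tr_def by (metis of_nat_le_iff of_nat_mult of_nat_numeral)
    also have "\<dots> \<le> 600 * ((2 * l) * (21 * l))"
    proof (intro mult_left_mono mult_mono)
      have "log 2 (real n) \<le> l"
        unfolding l_def using n \<epsilon> by (intro log_mono) (auto simp: field_simps)
      then show "real (bit_length n) \<le> 2 * l" using bit_length_le_log[OF n] l1 by linarith
    qed (use bounds(5) l1 in auto)
    finally have "real n * real tr \<le> Z * (600 * ((2 * l) * (21 * l)))"
      using T Z by (intro mult_mono) auto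
    also have "\<dots> = 25200 * ((l * l) * Z)" by simp
    also have "\<dots> \<le> 25200 * Y" unfolding Y_def using mult_right_mono[OF pow(2) Z(1)] by simp
    finally show ?thesis .
  qed
  have "real tv \<le> (real m + 330) * (real L * real n) + 2 * real (nat \<lfloor>t\<rfloor>)"
    unfolding tv_def using n L1 by (rule t_verifier_le)
  also have "\<dots> \<le> (real m + 330) * (21 * Y) + 2 * ((C1 * 21 powr C1) * Y)"
    using LT tY by (intro add_mono mult_left_mono) auto
  finally have "real X \<le> 21 * Y + Y + ((real m + 330) * (21 * Y) + 2 * ((C1 * 21 powr C1) * Y)) + 25200 * Y"
    using LT TY trY by (simp add: X_def)
  also have "\<dots> = (21 * (real m + 330) + 25222 + 2 * (C1 * 21 powr C1)) * Y" by (simp add: algebra_simps)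
  also have "\<dots> \<le> K * Y" unfolding K_def Y_def using Z by (intro mult_right_mono) auto
  finally have XK: "real X \<le> K * l powr (C1 + 2) * Z" by (simp add: Y_def mult.assoc)
  have K: "0 \<le> K" using C1 by (simp add: K_def)
  have "t_total \<le> 20000 * (D * (bit_length n * (N * D)) * X)"
    using t_total_le[of X] by (simp add: X_def Ln_def L_def mult.assoc)
  then have "real t_total \<le> real (20000 * (D * (bit_length n * (N * D)) * X))" by (simp only: of_nat_le_iff)
  also have "\<dots> = 20000 * (real (D * (bit_length n * (N * D))) * real X)" by (simp only: of_nat_mult of_nat_numeral)
  also have "\<dots> \<le> 20000 * ((864 * (2 / \<epsilon>) ^ 5 * l ^ 2) * (K * l powr (C1 + 2) * Z))"
    using XK bounds(4) \<epsilon> by (intro mult_left_mono mult_mono) auto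
  also have "\<dots> = (20000 * 864 * K) * (2 / \<epsilon>) ^ 5 * (l ^ 2 * l powr (C1 + 2)) * Z" by simp
  also have "l ^ 2 * l powr (C1 + 2) = l powr (C1 + 4)"
    using l1 powr_add[of l 2 "C1 + 2"] by (simp add: add.commute)
  also have "(20000 * 864 * K) * (2 / \<epsilon>) ^ 5 * l powr (C1 + 4) * Z
      \<le> C * (2 / \<epsilon>) powr (C * log 2 (1 / \<epsilon>)) * l powr C * Z"
  proof (rule absorb_polynomial[OF \<epsilon> l1 Z(1)])
    show "0 \<le> 20000 * 864 * K" "20000 * 864 * K \<le> C" "5 \<le> C" "C1 + 4 \<le> C"
      using K C1 unfolding C_def by auto
  qed
  finally have "real t_total \<le> C * (2 / \<epsilon>) powr (C * log 2 (1 / \<epsilon>)) * l powr C * Z" .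
  then show ?thesis
    using succeeds_withinI[of ?E "reduce (hosted_verifier m Q) quantum_reader" k "[x]" t_total
        "\<lambda>\<sigma>. get_vec n 2 \<sigma> = M *\<^sub>v x" "1 / 3"] reduce_run
    by (simp add: k_def l_def Z_def)
qed

theorem corollary2p5:
  shows "(\<exists>R (C::real).
      uses R \<subseteq> {Solver, Verifier, Entries} \<and>
      (\<forall>n \<epsilon> M \<O> \<V> T S.
        n \<ge> 1 \<longrightarrow> 0 < \<epsilon> \<longrightarrow> \<epsilon> \<le> 1 / 2 \<longrightarrow>
        M \<in> carrier_mat n n \<longrightarrow>
        \<O> \<in> carrier_vec n \<rightarrow> carrier_vec n \<longrightarrow>
        measure_pmf.prob (pmf_of_set (carrier_vec n)) {z. \<O> z = M *\<^sub>v z} \<ge> \<epsilon> \<longrightarrow>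
        (\<forall>z \<in> carrier_vec n. \<forall>y \<in> carrier_vec n. \<V> z y \<longleftrightarrow> y = M *\<^sub>v z) \<longrightarrow>
        T \<ge> n \<longrightarrow>
        (\<forall>x \<in> carrier_vec n.
          succeeds_within
            \<lparr>mdim = n, matr = M, alg = \<O>, ver = \<V>, alg_cost = T, ver_cost = S\<rparr>
            R (nat \<lceil>1 / \<epsilon>\<rceil>) [x]
            (C * (2 / \<epsilon>) powr (C * log 2 (1 / \<epsilon>)) * log 2 (real n / \<epsilon>) powr C
              * (real T + real S))
            (2 / 3) (\<lambda>\<sigma>. get_vec n 2 \<sigma> = M *\<^sub>v x))))
    \<and>
    ((\<exists>Q. quantum_verifier Q) \<longrightarrow>
     (\<exists>R (C::real).
      uses R \<subseteq> {Solver, Quantum} \<and>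
      (\<forall>n \<epsilon> M \<O> \<V> T S.
        n \<ge> 1 \<longrightarrow> 0 < \<epsilon> \<longrightarrow> \<epsilon> \<le> 1 / 2 \<longrightarrow>
        M \<in> carrier_mat n n \<longrightarrow>
        \<O> \<in> carrier_vec n \<rightarrow> carrier_vec n \<longrightarrow>
        measure_pmf.prob (pmf_of_set (carrier_vec n)) {z. \<O> z = M *\<^sub>v z} \<ge> \<epsilon> \<longrightarrow>
        T \<ge> n \<longrightarrow>
        (\<forall>x \<in> carrier_vec n.
          succeeds_within
            \<lparr>mdim = n, matr = M, alg = \<O>, ver = \<V>, alg_cost = T, ver_cost = S\<rparr>
            R (nat \<lceil>1 / \<epsilon>\<rceil>) [x]
            (C * (2 / \<epsilon>) powr (C * log 2 (1 / \<epsilon>)) * log 2 (real n / \<epsilon>) powr C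
              * (real T + real n powr (3 / 2)))
            (2 / 3) (\<lambda>\<sigma>. get_vec n 2 \<sigma> = M *\<^sub>v x)))))"
proof (intro conjI impI, goal_cases)
  case 1
  show ?case
    using uses_reduce[of classical_verifier classical_reader] classical_reduction
    by (intro exI[of _ "reduce classical_verifier classical_reader"] exI[of _ "10 ^ 12"] conjI allI impI ballI)
      (auto simp: classical_verifier_def classical_reader_def)
next
  case 2
  then obtain Q and C0 :: real where Q: "uses Q \<subseteq> {Quantum}"
    and ver: "\<And>E (\<eta>::real) z y. mdim E \<ge> 1 \<Longrightarrow> matr E \<in> carrier_mat (mdim E) (mdim E) \<Longrightarrow>
        z \<in> carrier_vec (mdim E) \<Longrightarrow> y \<in> carrier_vec (mdim E) \<Longrightarrow> 0 < \<eta> \<Longrightarrow> \<eta> \<le> 1 / 2 \<Longrightarrow>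
        succeeds_within E Q (nat \<lceil>1 / \<eta>\<rceil>) [z, y]
          (C0 * real (mdim E) powr (3 / 2) * log 2 (real (mdim E) / \<eta>) powr C0)
          (1 - \<eta>) (\<lambda>\<sigma>. \<sigma> 3 0 \<noteq> 0 \<longleftrightarrow> y = matr E *\<^sub>v z)"
    unfolding quantum_verifier_def by blast
  \<comment> \<open>The bound on the array names is raised to at least 4 so that parameters, both
    input vectors and the verdict in array 3 are among the arrays prepared.\<close>
  obtain m0 where m0: "arrays Q \<subseteq> {..<m0}"
    using finite_nat_bounded[OF finite_arrays[of Q]] by blast
  define m where "m = max m0 4"
  have m: "4 \<le> m" "arrays Q \<subseteq> {..<m}" using m0 by (auto simp: m_def)
  have uses: "uses (reduce (hosted_verifier m Q) quantum_reader) \<subseteq> {Solver, Quantum}"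
    using uses_reduce[of "hosted_verifier m Q" quantum_reader] uses_hosted_verifier[OF Q, of m] uses_quantum_reader
    by blast
  show ?case
    by (intro exI conjI allI impI ballI, rule uses, rule quantum_reduction[OF Q m(2,1) ver])
qed

end
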